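(* Let $n\ge1$, $w\in \mathcal{BC}_n$ and $k\geq 0$. The $k$-truncation $\mathfrak B_w^{[k]}(\mathbf z,\mathbf x)$ of the type $B$ Schubert polynomial $\mathfrak B_w(\mathbf z,\mathbf x)$ is the sum of monomials over all reduced $b$-signed pipe dreams in $\mathrm{PD}_{\mathcal B_n}^k(w)$: \[ \sum_{D\in\mathrm{PD}_{\mathcal B_n}^k(w)} \mathbf x^{\alpha(D)}\mathbf z^{\beta(D)}=\sum_{\substack{u v=w\\ \ell(u)+\ell(v)=\ell(w) \\ v \in \mathcal S_{n}}}\ \sum_{\substack{\mathbf a \in R(u)\\ \mathbf x^{\alpha} \in \mathscr A_{x}(\mathbf{a})\\\alpha_{k+1}=\alpha_{k+2}=\ldots=0}}\ \sum_{\substack{\mathbf b \in R(v)\\ \mathbf z^{\beta} \in \mathscr A_{z}(\mathbf b)}} 2^{i(\alpha)-s(w)} \mathbf x^{\alpha} \mathbf z^{\beta}=\mathfrak B_w^{[k]}(\mathbf z,\mathbf x). \]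
   Context: **Groups.** $\mathcal{BC}_n$ is the group of permutations $w$ of $\{\pm1,\dots,\pm n\}$ with $w(-i)=-w(i)$, generated by $s_0=(1\leftrightarrow -1)$ and $s_i=(i\leftrightarrow i+1)$ (also exchanging $-i,-(i+1)$), $1\le i\le n-1$; products are compositions of maps, $(uv)(i)=u(v(i))$. $\mathcal S_n\subset\mathcal{BC}_n$ is the symmetric group generated by $s_1,\dots,s_{n-1}$. $\ell$ is the Coxeter length, $R(w)$ the set of reduced words of $w$; $\mathcal{BC}_\infty=\bigcup_n\mathcal{BC}_n$. $s(w)$ is the number of $i\in\{1,\dots,n\}$ with $w(i)<0$. **Schubert polynomials of types $C$ and $B$.** Let $\mathbb Q[\mathbf z,p_1(\mathbf x),p_3(\mathbf x),\dots]$ be the ring of polynomials in $z_1,z_2,\dots$ and the odd power sums $p_k(\mathbf x)=\sum_{i\ge1}x_i^k$ (algebraically independent generators). $\mathcal{BC}_\infty$ acts on it by ring automorphisms: $s_i$ ($i\ge1$) exchanges $z_i$ and $z_{i+1}$ and fixes each $p_k(\mathbf x)$; $s_0$ sends $z_1\mapsto -z_1$, fixes $z_j$ ($j\ge 2$), and sends $p_k(\mathbf x)\mapsto p_k(\mathbf x)+z_1^k$. Put $\partial_if=\frac{f-s_if}{z_i-z_{i+1}}$ ($i\ge1$), $\partial_0f=\frac{f-s_0f}{-2z_1}$. The polynomials $\mathfrak C_w$, $w\in\mathcal{BC}_\infty$, are the unique homogeneous elements ($\deg z_i=1$, $\deg p_k(\mathbf x)=k$) with $\mathfrak C_{\mathrm{id}}=1$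 and, for all $i\ge0$, $\partial_i\mathfrak C_w=\mathfrak C_{ws_i}$ if $\ell(ws_i)<\ell(w)$ and $\partial_i\mathfrak C_w=0$ otherwise (existence and uniqueness are due to Billey and Haiman). The type $B$ Schubert polynomial is $\mathfrak B_w=2^{-s(w)}\mathfrak C_w$. The $k$-truncation is $\mathfrak B_w^{[k]}(\mathbf z,\mathbf x)=\mathfrak B_w(\mathbf z;x_1,\dots,x_k,0,0,\dots)$. **Admissible monomials.** Let $\mathbf a=s_{a_1}\cdots s_{a_l}$ be a reduced word. Its peak set is $P(\mathbf a)=\{i\in\{2,\dots,l-1\}: a_{i-1}<a_i>a_{i+1}\}$. A sequence of positive integers $j_1\ge\dots\ge j_l$ is $x$-admissible for $\mathbf a$ if $j_{i-1}=j_i=j_{i+1}$ implies $i\notin P(\mathbf a)$; $\mathscr A_x(\mathbf a)$ is the set of monomials $\mathbf x^\alpha=x_{j_1}\cdots x_{j_l}$ of such sequences. If $\mathbf a$ is a reduced word of an element of $\mathcal S_n$, a sequence of positive integers $j_1\le\dots\le j_l$ is $z$-admissible for $\mathbf a$ if $j_i\le a_i$ for all $i$ and $j_i=j_{i+1}$ implies $a_i>a_{i+1}$; $\mathscr A_z(\mathbf a)$ is the set of monomials $\mathbf z^\beta=z_{j_1}\cdots z_{j_l}$ of such sequences. $i(\alpha)$ is the number of distinct variables occurring in $\mathbf x^\alpha$ with nonzero exponent. **$b$-signed pipe dreams.** The base $B^k_{\mathcal B_n}$ consists of a staircase block and $k$ $\Gamma$-blocks numbered $1,\dots,k$ from bottom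 to top, all lying above the staircase block. The staircase block has boxes $(i,j)$, $1\le i\le n-1$, $1\le j\le n-i$ (row $i$ from the top, column $j$ from the left); the box $(i,j)$ is indexed by $i+j-1$ and has variable $z_i$. Each $\Gamma$-block consists of $2n-1$ boxes: a corner box indexed $0$, boxes indexed $1,\dots,n-1$ from left to right in the same row as the corner and to its right (together with the corner: the horizontal part), and boxes indexed $1,\dots,n-1$ from top to bottom in a column below the corner (together with the corner: the vertical part); all boxes of the $m$-th $\Gamma$-block have variable $x_m$. A $b$-signed pipe dream $D$ is a filling of the base in which each corner contains either a single elbow or an elbow with a faucet, and every other box contains either a double elbow or a cross. Significant elements are crosses and elbows with a faucet. A cross in a box of index $i$ contributes the letter $s_i$, an elbow with a faucet the letter $s_0$, elbows without faucets contribute nothing. $\mathrm{word}(D)$ is obtained by reading the letters from top to bottom and in each row from right to left: i.e. the $\Gamma$-blocks $k,k-1,\dots,1$, in each of them first the horizontal boxes $n-1,\dots,1$, then the corner, then the vertical boxes $1,\dots,n-1$; then the staircase rows $1,\dots,n-1$, each from right to left. $\mathbf x^{\alpha(D)}\mathbf z^{\beta(D)}$ is the product of the variables of all boxes containing significant elements. $D$ is reduced of shape $w$ if $\mathrm{word}(D)$ is a reduced word of $w\in\mathcal{BC}_n$; $\mathrm{PD}^k_{\mathcal B_n}(w)$ is the set of reduced $b$-signed pipe dreams with $k$ $\Gamma$-blocks of shape $w$. *)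

theory Defs
  imports Complex_Main "HOL-Library.FuncSet" "HOL-Library.Poly_Mapping" "HOL-Combinatorics.Permutations"
begin

section \<open>Signed permutations\<close>

text \<open>
  A signed permutation is extended to all of \<^typ>\<open>int\<close> by the identity, so that
  \<open>BC n \<subseteq> BC (Suc n)\<close> and products are compositions.
\<close>

definition BC :: "nat \<Rightarrow> (int \<Rightarrow> int) set" where
  "BC n = {w. w permutes {i. 1 \<le> \<bar>i\<bar> \<and> \<bar>i\<bar> \<le> int n} \<and> (\<forall>i. w (- i) = - w i)}"

definition BC_inf :: "(int \<Rightarrow> int) set" where
  "BC_inf = (\<Union>n. BC n)"

fun sgen :: "nat \<Rightarrow> int \<Rightarrow> int" where
  "sgen 0 = transpose 1 (- 1)"
| "sgen (Suc i) = transpose (int i + 1) (int i + 2) \<circ> transpose (- (int i + 1)) (- (int i + 2))"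

text \<open>The word \<open>[a\<^sub>1, \<dots>, a\<^sub>l]\<close> stands for \<open>s\<^bsub>a\<^sub>1\<^esub> \<cdots> s\<^bsub>a\<^sub>l\<^esub>\<close>.\<close>

definition word_prod :: "nat list \<Rightarrow> int \<Rightarrow> int" where
  "word_prod as = foldr (\<lambda>a w. sgen a \<circ> w) as id"

text \<open>As the generators are involutions, the subgroup they generate consists of their products.\<close>

definition Sym :: "nat \<Rightarrow> (int \<Rightarrow> int) set" where
  "Sym n = {word_prod as | as. set as \<subseteq> {1..<n}}"

text \<open>
  Length and reduced words are taken in \<open>BC_inf\<close>.  As \<open>BC n\<close> is the standard parabolic
  subgroup generated by \<open>sgen 0, \<dots>, sgen (n - 1)\<close>, they agree with those taken in \<open>BC n\<close>.
\<close>

definition len :: "(int \<Rightarrow> int) \<Rightarrow> nat" where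
  "len w = (LEAST l. \<exists>as. length as = l \<and> word_prod as = w)"

definition R :: "(int \<Rightarrow> int) \<Rightarrow> nat list set" where
  "R w = {as. word_prod as = w \<and> length as = len w}"

definition neg :: "(int \<Rightarrow> int) \<Rightarrow> nat" where
  "neg w = card {i. 0 < i \<and> w i < 0}"


section \<open>Polynomials\<close>

text \<open>
  \<open>Z i\<close>, \<open>X i\<close> stand for \<open>z\<^sub>i\<close>, \<open>x\<^sub>i\<close> with \<open>i \<ge> 1\<close>, and \<open>P k\<close> for the
  power sum \<open>p\<^sub>k(x)\<close> with \<open>k\<close> odd, treated as an independent generator.  All of
  them live in one polynomial ring over the rationals; the ring of the odd power sums and the
  \<open>z\<^sub>i\<close> is the subring \<open>zp_ring\<close>.
\<close>

datatype var = Z nat | X nat | P nat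

type_synonym monomial = "var \<Rightarrow>\<^sub>0 nat"

type_synonym mpoly = "monomial \<Rightarrow>\<^sub>0 rat"

definition Const :: "rat \<Rightarrow> mpoly" where
  "Const c = Poly_Mapping.single 0 c"

definition monom_poly :: "monomial \<Rightarrow> mpoly" where
  "monom_poly m = Poly_Mapping.single m 1"

definition Var :: "var \<Rightarrow> mpoly" where
  "Var v = monom_poly (Poly_Mapping.single v 1)"

text \<open>The ring homomorphism that fixes constants and sends each variable \<open>v\<close> to \<open>\<sigma> v\<close>.\<close>

definition subst :: "(var \<Rightarrow> mpoly) \<Rightarrow> mpoly \<Rightarrow> mpoly" where
  "subst \<sigma> f = (\<Sum>m\<in>Poly_Mapping.keys f. Const (Poly_Mapping.lookup f m) *
     (\<Prod>v\<in>Poly_Mapping.keys m. \<sigma> v ^ Poly_Mapping.lookup m v))"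

definition zp_ring :: "mpoly set" where
  "zp_ring = {f. \<forall>m\<in>Poly_Mapping.keys f.
     Poly_Mapping.keys m \<subseteq> {Z i | i. 1 \<le> i} \<union> {P k | k. odd k}}"

fun var_degree :: "var \<Rightarrow> nat" where
  "var_degree (Z i) = 1"
| "var_degree (X i) = 1"
| "var_degree (P k) = k"

definition homogeneous :: "mpoly set" where
  "homogeneous = {f. \<exists>d. \<forall>m\<in>Poly_Mapping.keys f.
     (\<Sum>v\<in>Poly_Mapping.keys m. Poly_Mapping.lookup m v * var_degree v) = d}"


section \<open>Divided differences and Schubert polynomials\<close>

fun act_var :: "nat \<Rightarrow> var \<Rightarrow> mpoly" where
  "act_var 0 (Z j) = (if j = 1 then - Var (Z 1) else Var (Z j))"
| "act_var 0 (P k) = Var (P k) + Var (Z 1) ^ k"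
| "act_var 0 (X j) = Var (X j)"
| "act_var (Suc i) (Z j) = Var (Z (transpose (Suc i) (Suc (Suc i)) j))"
| "act_var (Suc i) (P k) = Var (P k)"
| "act_var (Suc i) (X j) = Var (X j)"

definition act :: "nat \<Rightarrow> mpoly \<Rightarrow> mpoly" where
  "act i = subst (act_var i)"

definition divisor :: "nat \<Rightarrow> mpoly" where
  "divisor i = (if i = 0 then - 2 * Var (Z 1) else Var (Z i) - Var (Z (i + 1)))"

text \<open>The exact quotient \<open>(f - s\<^sub>i f) / divisor i\<close> in the polynomial ring.\<close>

definition divdiff :: "nat \<Rightarrow> mpoly \<Rightarrow> mpoly" where
  "divdiff i f = (THE g. divisor i * g = f - act i f)"

text \<open>
  The value outside \<open>BC_inf\<close> is fixed to be \<^const>\<open>undefined\<close> (extensional functions), so that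
  uniqueness of the family is meaningful.
\<close>

definition schubert_C_family :: "((int \<Rightarrow> int) \<Rightarrow> mpoly) \<Rightarrow> bool" where
  "schubert_C_family C \<longleftrightarrow>
     C \<in> BC_inf \<rightarrow>\<^sub>E zp_ring \<inter> homogeneous \<and>
     C id = 1 \<and>
     (\<forall>w\<in>BC_inf. \<forall>i. divdiff i (C w) =
        (if len (w \<circ> sgen i) < len w then C (w \<circ> sgen i) else 0))"

definition schubert_C :: "(int \<Rightarrow> int) \<Rightarrow> mpoly" where
  "schubert_C = (THE C. schubert_C_family C)"

definition schubert_B :: "(int \<Rightarrow> int) \<Rightarrow> mpoly" where
  "schubert_B w = Const (2 powi (- int (neg w))) * schubert_C w"

text \<open>Substituting \<open>x\<^sub>i = 0\<close> for \<open>i > k\<close> turns \<open>p\<^sub>j\<close> into \<open>x\<^sub>1\<^sup>j + \<dots> + x\<^sub>k\<^sup>j\<close>.\<close>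

definition truncate :: "nat \<Rightarrow> mpoly \<Rightarrow> mpoly" where
  "truncate k = subst (\<lambda>v. case v of P j \<Rightarrow> (\<Sum>i=1..k. Var (X i) ^ j) | _ \<Rightarrow> Var v)"


section \<open>Admissible monomials\<close>

text \<open>Positions in words and in index sequences are counted from 0.\<close>

definition peaks :: "nat list \<Rightarrow> nat set" where
  "peaks as = {i. 0 < i \<and> i + 1 < length as \<and> as ! (i - 1) < as ! i \<and> as ! i > as ! (i + 1)}"

definition x_admissible :: "nat list \<Rightarrow> nat list \<Rightarrow> bool" where
  "x_admissible as js \<longleftrightarrow> length js = length as \<and> (\<forall>j\<in>set js. 1 \<le> j) \<and> sorted_wrt (\<ge>) js \<and>
     (\<forall>i. 0 < i \<and> i + 1 < length as \<and> js ! (i - 1) = js ! i \<and> js ! i = js ! (i + 1) \<longrightarrow> i \<notin> peaks as)"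

definition z_admissible :: "nat list \<Rightarrow> nat list \<Rightarrow> bool" where
  "z_admissible as js \<longleftrightarrow> length js = length as \<and> (\<forall>j\<in>set js. 1 \<le> j) \<and> sorted_wrt (\<le>) js \<and>
     (\<forall>i<length as. js ! i \<le> as ! i) \<and>
     (\<forall>i. i + 1 < length as \<and> js ! i = js ! (i + 1) \<longrightarrow> as ! i > as ! (i + 1))"

definition A_x :: "nat list \<Rightarrow> monomial set" where
  "A_x as = {(\<Sum>j\<leftarrow>js. Poly_Mapping.single (X j) 1) | js. x_admissible as js}"

definition A_z :: "nat list \<Rightarrow> monomial set" where
  "A_z as = {(\<Sum>j\<leftarrow>js. Poly_Mapping.single (Z j) 1) | js. z_admissible as js}"

definition num_vars :: "monomial \<Rightarrow> nat" where
  "num_vars \<alpha> = card (Poly_Mapping.keys \<alpha>)"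


section \<open>Signed pipe dreams\<close>

text \<open>
  \<open>Stair i j\<close> is the box \<open>(i, j)\<close> of the staircase block; \<open>Corner m\<close>, \<open>Hor m j\<close>, \<open>Vert m j\<close>
  are the corner of the \<open>m\<close>-th \<open>\<Gamma>\<close>-block and its boxes of index \<open>j\<close> to the right of
  the corner and below it.
\<close>

datatype box = Stair nat nat | Corner nat | Hor nat nat | Vert nat nat

datatype tile = Single_Elbow | Faucet | Double_Elbow | Cross

definition base :: "nat \<Rightarrow> nat \<Rightarrow> box set" where
  "base n k =
     {Stair i j | i j. 1 \<le> i \<and> i \<le> n - 1 \<and> 1 \<le> j \<and> j \<le> n - i} \<union>
     {Corner m | m. m \<in> {1..k}} \<union>
     {Hor m j | m j. m \<in> {1..k} \<and> j \<in> {1..n - 1}} \<union>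
     {Vert m j | m j. m \<in> {1..k} \<and> j \<in> {1..n - 1}}"

fun box_index :: "box \<Rightarrow> nat" where
  "box_index (Stair i j) = i + j - 1"
| "box_index (Corner m) = 0"
| "box_index (Hor m j) = j"
| "box_index (Vert m j) = j"

fun box_var :: "box \<Rightarrow> var" where
  "box_var (Stair i j) = Z i"
| "box_var (Corner m) = X m"
| "box_var (Hor m j) = X m"
| "box_var (Vert m j) = X m"

fun tiles :: "box \<Rightarrow> tile set" where
  "tiles (Corner m) = {Single_Elbow, Faucet}"
| "tiles _ = {Double_Elbow, Cross}"

definition pipe_dreams :: "nat \<Rightarrow> nat \<Rightarrow> (box \<Rightarrow> tile) set" where
  "pipe_dreams n k = (\<Pi>\<^sub>E b\<in>base n k. tiles b)"

definition significant :: "(box \<Rightarrow> tile) \<Rightarrow> box \<Rightarrow> bool" where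
  "significant D b \<longleftrightarrow> D b \<in> {Cross, Faucet}"

text \<open>The boxes of the base from top to bottom and, in each row, from right to left.\<close>

definition reading :: "nat \<Rightarrow> nat \<Rightarrow> box list" where
  "reading n k =
     concat (map (\<lambda>m. map (Hor m) (rev [1..<n]) @ [Corner m] @ map (Vert m) [1..<n])
       (rev [1..<k + 1])) @
     concat (map (\<lambda>i. map (Stair i) (rev [1..<n - i + 1])) [1..<n])"

definition word :: "nat \<Rightarrow> nat \<Rightarrow> (box \<Rightarrow> tile) \<Rightarrow> nat list" where
  "word n k D = map box_index (filter (significant D) (reading n k))"

definition PD :: "nat \<Rightarrow> nat \<Rightarrow> (int \<Rightarrow> int) \<Rightarrow> (box \<Rightarrow> tile) set" where
  "PD n k w = {D \<in> pipe_dreams n k. word n k D \<in> R w}"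

text \<open>The monomial \<open>x\<^sup>\<alpha> z\<^sup>\<beta>\<close> of a pipe dream.\<close>

definition weight :: "nat \<Rightarrow> nat \<Rightarrow> (box \<Rightarrow> tile) \<Rightarrow> mpoly" where
  "weight n k D = (\<Prod>b\<in>{b \<in> base n k. significant D b}. Var (box_var b))"

end

(* The nilCoxeter algebra of the hyperoctahedral group acts on functions on signed permutations
   through the operators (u_i f)(w) = f(w s_i) if i is a descent of w, and 0 otherwise. With
   h_i(x) = 1 + x u_i and A_i(x) = h_N(x) ... h_i(x), the Yang-Baxter equations show that the
   elements C(x) = h_N(x) ... h_1(x) h_0(2x) h_1(x) ... h_N(x) commute and satisfy C(x) C(-x) = 1,
   so the coefficients of x C'(x) / C(x) live in odd degrees. Hence the equation t G' = D G, with D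
   obtained from x C'(x) / C(x) by replacing x^k by p_k, has a solution G over the odd power sums;
   it specialises to C(x_k) ... C(x_1) under p_j = x_1^j + ... + x_k^j, and s_0 multiplies it by C(z_1).
   The coefficients of G A_1(z_1) ... A_N(z_N) therefore satisfy the divided difference equations
   that characterise the Schubert polynomials of type C. They are unique because an element of the
   ring that is invariant under all s_i is constant. After truncation the coefficients are expanded
   into subwords, which gives the pipe dreams, and into words without peaks followed by decreasing
   words, which gives the admissible monomials; each corner contributes the factor 2 of h_0(2x), and
   the number of corners is the number of sign changes. *)
theory Submission
  imports Defs "HOL-Computational_Algebra.Formal_Power_Series" "HOL-Computational_Algebra.Polynomial"
begin

section \<open>Length and descents of signed permutations\<close>

text \<open>The obstacle is that C_w lives over independent power sums, where no variables x_i are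
  available; a product of factors C(x_i) shows only specialisations. Homogeneity helps: with a
  series variable t that records length, the t^k coefficient of the logarithmic derivative of C(x)
  is x^k times an operator free of x. So x^k can be replaced by any p_k, and passing from p_k to p_k
  + z_1^k means one more factor C(z_1). Commutativity makes logarithmic derivatives add, and C(x)
  C(-x) = 1 confines the dependence on p to odd indices, the ones that the ring provides. The 2 in
  h_0(2x) is dictated by the divisor -2 z_1 of the zeroth divided difference. Products stop at a
  finite letter N: an element of BC_n has no descent at n or beyond, so its coefficients are stable
  once N >= n - 1. Expansions into words are not unique, because words that are not reduced have
  product 0. Hence word coefficients matter only on reduced words, and it is enough to describe C(x)
  on words without equal neighbours.\<close>

lemma BC_permutes: "w \<in> BC n \<Longrightarrow> w permutes {i. 1 \<le> \<bar>i\<bar> \<and> \<bar>i\<bar> \<le> int n}"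
  by (simp add: BC_def)

lemma BC_minus: "w \<in> BC n \<Longrightarrow> w (- i) = - w i"
  by (simp add: BC_def)

lemma BC_zero: "w \<in> BC n \<Longrightarrow> w 0 = 0"
  using BC_minus[of w n 0] by simp

lemma BC_outside: "w \<in> BC n \<Longrightarrow> int n < \<bar>i\<bar> \<Longrightarrow> w i = i"
  using permutes_not_in[OF BC_permutes, of w n i] by auto

lemma BC_bij: "w \<in> BC n \<Longrightarrow> bij w"
  by (rule permutes_bij[OF BC_permutes])

lemma BC_inj: "w \<in> BC n \<Longrightarrow> w i = w j \<longleftrightarrow> i = j"
  using BC_bij[of w n] by (auto simp: bij_def inj_def)

lemma BC_bound: "w \<in> BC n \<Longrightarrow> \<bar>i\<bar> \<le> int n \<Longrightarrow> \<bar>w i\<bar> \<le> int n"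
  using permutes_in_image[OF BC_permutes, of w n i] BC_zero[of w n] by (cases "i = 0") auto

lemma BC_nonzero: "w \<in> BC n \<Longrightarrow> i \<noteq> 0 \<Longrightarrow> w i \<noteq> 0"
  using BC_inj[of w n i 0] BC_zero[of w n] by simp

lemma BC_mono: assumes "m \<le> n" shows "BC m \<subseteq> BC n"
proof
  fix w assume w: "w \<in> BC m"
  have "w permutes {i. 1 \<le> \<bar>i\<bar> \<and> \<bar>i\<bar> \<le> int n}"
    by (rule permutes_subset[OF BC_permutes[OF w]]) (use assms in auto)
  then show "w \<in> BC n" using BC_minus[OF w] by (simp add: BC_def)
qed

lemma BC_comp: "v \<in> BC n \<Longrightarrow> w \<in> BC n \<Longrightarrow> v \<circ> w \<in> BC n"
  by (auto simp: BC_def permutes_compose)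

lemma id_BC: "id \<in> BC n"
  by (simp add: BC_def permutes_id)

lemma sgen_eq:
  "sgen i = (if i = 0 then transpose 1 (- 1)
     else transpose (int i) (int i + 1) \<circ> transpose (- int i) (- int i - 1))"
  by (cases i) (auto simp: algebra_simps)

lemma sgen_apply:
  "sgen i a = (if i = 0 then (if a = 1 then - 1 else if a = - 1 then 1 else a)
     else if a = int i then int i + 1 else if a = int i + 1 then int i
     else if a = - int i then - int i - 1 else if a = - int i - 1 then - int i else a)"
  by (auto simp: sgen_eq transpose_def)

declare sgen.simps [simp del]

lemma sgen_sgen: "sgen i (sgen i a) = a"
  by (simp add: sgen_apply)

lemma sgen_comp_sgen: "sgen i \<circ> sgen i = id"
  by (simp add: fun_eq_iff sgen_sgen)

lemma comp_sgen_sgen: "w \<circ> sgen i \<circ> sgen i = w"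
  by (simp add: fun_eq_iff sgen_sgen)

lemma sgen_BC: assumes "i < n" shows "sgen i \<in> BC n"
proof -
  have "sgen i permutes {a. 1 \<le> \<bar>a\<bar> \<and> \<bar>a\<bar> \<le> int n}"
    unfolding permutes_def
  proof (intro conjI allI impI)
    fix a assume "a \<notin> {a. 1 \<le> \<bar>a\<bar> \<and> \<bar>a\<bar> \<le> int n}"
    then show "sgen i a = a" using assms by (auto simp: sgen_apply)
  next
    fix b show "\<exists>!a. sgen i a = b" by (metis sgen_sgen)
  qed
  moreover have "\<forall>a. sgen i (- a) = - sgen i a" by (auto simp: sgen_apply)
  ultimately show ?thesis by (simp add: BC_def)
qed

lemma BC_inf_I: "w \<in> BC n \<Longrightarrow> w \<in> BC_inf"
  by (auto simp: BC_inf_def)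

lemma BC_inf_obtain: assumes "w \<in> BC_inf" obtains n where "m \<le> n" "w \<in> BC n"
proof -
  obtain k where "w \<in> BC k" using assms by (auto simp: BC_inf_def)
  then have "w \<in> BC (max k m)" using BC_mono[of k "max k m"] by auto
  then show ?thesis using that[of "max k m"] by simp
qed

lemma BC_inf_comp: assumes "v \<in> BC_inf" "w \<in> BC_inf" shows "v \<circ> w \<in> BC_inf"
proof -
  obtain m where m: "v \<in> BC m" using assms(1) by (auto simp: BC_inf_def)
  obtain n where n: "m \<le> n" "w \<in> BC n" using assms(2) by (rule BC_inf_obtain)
  then have "v \<in> BC n" using m BC_mono by blast
  then show ?thesis using n BC_comp BC_inf_I by blast
qed

lemma sgen_BC_inf: "sgen i \<in> BC_inf"
  by (rule BC_inf_I[OF sgen_BC[of i "Suc i"]]) simp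

lemma id_BC_inf: "id \<in> BC_inf"
  by (rule BC_inf_I[OF id_BC])

lemma comp_sgen_BC_inf_iff: "w \<circ> sgen i \<in> BC_inf \<longleftrightarrow> w \<in> BC_inf"
  using BC_inf_comp[OF _ sgen_BC_inf[of i]] comp_sgen_sgen by metis

lemma word_prod_Nil: "word_prod [] = id"
  by (simp add: word_prod_def)

lemma word_prod_Cons: "word_prod (a # as) = sgen a \<circ> word_prod as"
  by (simp add: word_prod_def)

lemma word_prod_append: "word_prod (as @ bs) = word_prod as \<circ> word_prod bs"
  by (induction as) (simp_all add: word_prod_Nil word_prod_Cons comp_assoc)

lemma word_prod_snoc: "word_prod (as @ [i]) = word_prod as \<circ> sgen i"
  by (simp add: word_prod_append word_prod_Nil word_prod_Cons)

lemma word_prod_BC: "set as \<subseteq> {..<n} \<Longrightarrow> word_prod as \<in> BC n"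
  by (induction as) (auto simp: word_prod_Nil word_prod_Cons id_BC intro!: BC_comp sgen_BC)

lemma word_prod_BC_inf: "word_prod as \<in> BC_inf"
  by (rule BC_inf_I[OF word_prod_BC[of as "Suc (Max (set as))"]]) (auto simp: less_Suc_eq_le)

section \<open>Descents, inversions and the length function\<close>

definition desc :: "(int \<Rightarrow> int) \<Rightarrow> nat \<Rightarrow> bool" where
  "desc w i \<longleftrightarrow> (if i = 0 then w 1 < 0 else w (int i + 1) < w (int i))"

definition invs :: "(int \<Rightarrow> int) \<Rightarrow> (int \<times> int) set" where
  "invs w = {(a, b). a < b \<and> a \<noteq> 0 \<and> b \<noteq> 0 \<and> w b < w a}"

text \<open>Twice the length: the inversions \<open>(a, b)\<close> and \<open>(- b, - a)\<close> come from the same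
  reflection, and the inversions \<open>(- b, b)\<close>, which are their own mirror images, are counted
  once more by \<^const>\<open>neg\<close>.\<close>

definition len2 :: "(int \<Rightarrow> int) \<Rightarrow> nat" where
  "len2 w = card (invs w) + neg w"

text \<open>Inversions stay inside -n..n: an entry beyond that range is fixed, and the remaining
  entries keep their values in the range.\<close>

lemma finite_invs: assumes "w \<in> BC n" shows "finite (invs w)"
proof (rule finite_subset)
  show "invs w \<subseteq> {- int n..int n} \<times> {- int n..int n}"
  proof (clarsimp simp: invs_def)
    fix a b assume ab: "a < b" "w b < w a"
    show "- int n \<le> a \<and> a \<le> int n \<and> - int n \<le> b \<and> b \<le> int n"
    proof (cases "\<bar>a\<bar> \<le> int n")
      case a: True
      then have "\<bar>w a\<bar> \<le> int n" by (rule BC_bound[OF assms])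
      then show ?thesis using a ab BC_outside[OF assms, of b] by (cases "\<bar>b\<bar> \<le> int n") auto
    next
      case a: False
      then have wa: "w a = a" using BC_outside[OF assms] by simp
      show ?thesis
      proof (cases "\<bar>b\<bar> \<le> int n")
        case True
        then show ?thesis using BC_bound[OF assms True] wa a ab by auto
      next
        case False
        then show ?thesis using BC_outside[OF assms, of b] wa ab by simp
      qed
    qed
  qed
qed simp

lemma finite_neg: assumes "w \<in> BC n" shows "finite {i. 0 < i \<and> w i < 0}"
proof (rule finite_subset)
  show "{i. 0 < i \<and> w i < 0} \<subseteq> {0..int n}"
  proof
    fix i assume "i \<in> {i. 0 < i \<and> w i < 0}"
    then show "i \<in> {0..int n}" using BC_outside[OF assms, of i] by (cases "int n < i") auto
  qed
qed simp

lemma desc_comp_sgen: "w \<in> BC_inf \<Longrightarrow> desc (w \<circ> sgen i) i \<longleftrightarrow> \<not> desc w i"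
proof -
  assume "w \<in> BC_inf"
  then obtain n where w: "w \<in> BC n" by (auto simp: BC_inf_def)
  show ?thesis
    using BC_inj[OF w, of "int i" "int i + 1"] BC_minus[OF w, of 1] BC_nonzero[OF w, of 1]
    by (auto simp: desc_def sgen_apply)
qed

lemma not_desc_outside: assumes "w \<in> BC n" "n \<le> i" shows "\<not> desc w i"
proof (cases "i = 0")
  case True
  then show ?thesis using BC_outside[OF assms(1), of 1] assms(2) by (simp add: desc_def)
next
  case False
  then show ?thesis
    using BC_outside[OF assms(1), of "int i"] BC_outside[OF assms(1), of "int i + 1"]
      BC_bound[OF assms(1), of "int i"] assms(2)
    by (cases "i = n") (auto simp: desc_def)
qed

text \<open>These are the inversions of \<open>sgen i\<close> itself. Leaving 0 out of all pairs
  makes (-1, 1) the only one for \<open>i = 0\<close>.\<close>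

definition simple_pairs :: "nat \<Rightarrow> (int \<times> int) set" where
  "simple_pairs i =
     (if i = 0 then {(- 1, 1)} else {(int i, int i + 1), (- int i - 1, - int i)})"

lemma sgen_strict_mono:
  assumes "a < b" "a \<noteq> 0" "b \<noteq> 0" "(a, b) \<notin> simple_pairs i"
  shows "sgen i a < sgen i b"
proof (cases "i = 0")
  case True
  then have "\<not> (a = - 1 \<and> b = 1)" using assms(4) by (simp add: simple_pairs_def)
  then show ?thesis using True assms(1-3) unfolding sgen_apply by presburger
next
  case False
  define j where "j = int i"
  have "1 \<le> j" "\<not> (a = j \<and> b = j + 1)" "\<not> (a = - j - 1 \<and> b = - j)"
    using False assms(4) by (auto simp: simple_pairs_def j_def)
  then show ?thesis using False assms(1-3) unfolding sgen_apply j_def[symmetric]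
    by (smt (verit))
qed

lemma sgen_eq_0_iff: "sgen i a = 0 \<longleftrightarrow> a = 0"
  by (auto simp: sgen_apply)

lemma sgen_simple_pairs:
  assumes "(a, b) \<in> simple_pairs i"
  shows "(sgen i b, sgen i a) \<in> simple_pairs i"
proof (cases "i = 0")
  case True
  then show ?thesis using assms by (simp add: simple_pairs_def sgen_apply)
next
  case False
  then have "a = int i \<and> b = int i + 1 \<or> a = - int i - 1 \<and> b = - int i"
    using assms by (simp add: simple_pairs_def)
  then show ?thesis using False by (elim disjE conjE) (simp_all add: simple_pairs_def sgen_apply)
qed

lemma simple_pairs_less:
  "(a, b) \<in> simple_pairs i \<Longrightarrow> a < b \<and> a \<noteq> 0 \<and> b \<noteq> 0"
  by (auto simp: simple_pairs_def split: if_splits)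

lemma simple_pairs_desc:
  assumes "w \<in> BC n" "(a, b) \<in> simple_pairs i"
  shows "w b < w a \<longleftrightarrow> desc w i"
proof (cases "i = 0")
  case True
  then show ?thesis using assms(2) BC_minus[OF assms(1), of 1]
    by (simp add: simple_pairs_def desc_def)
next
  case False
  then have "a = int i \<and> b = int i + 1 \<or> a = - (int i + 1) \<and> b = - int i"
    using assms(2) by (simp add: simple_pairs_def)
  then have "w b < w a \<longleftrightarrow> w (int i + 1) < w (int i)"
    using BC_minus[OF assms(1), of "int i"] BC_minus[OF assms(1), of "int i + 1"]
    by (metis neg_less_iff_less)
  then show ?thesis using False by (simp add: desc_def)
qed

lemma card_simple_pairs: "card (simple_pairs i) = (if i = 0 then 1 else 2)"
  by (simp add: simple_pairs_def)

text \<open>\<open>sgen i\<close> preserves the order of every pair outside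
  \<open>simple_pairs i\<close>, so old inversions are merely transported. The simple pairs are in
  order for \<open>w\<close>, as \<open>i\<close> is no descent, and become reversed.\<close>

lemma invs_asc:
  assumes w: "w \<in> BC n" and asc: "\<not> desc w i"
  shows "invs (w \<circ> sgen i) = map_prod (sgen i) (sgen i) ` invs w \<union> simple_pairs i"
    and "map_prod (sgen i) (sgen i) ` invs w \<inter> simple_pairs i = {}"
proof -
  let ?s = "sgen i"
  have desc': "desc (w \<circ> ?s) i"
    using asc desc_comp_sgen[OF BC_inf_I[OF w]] by simp
  have sp: "(w \<circ> ?s) b < (w \<circ> ?s) a" if "(a, b) \<in> simple_pairs i" for a b
  proof -
    have "(?s b, ?s a) \<in> simple_pairs i" by (rule sgen_simple_pairs[OF that])
    then have "\<not> w (?s a) < w (?s b)" using simple_pairs_desc[OF w] asc by blast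
    moreover have "w (?s a) \<noteq> w (?s b)"
      using BC_inj[OF w] simple_pairs_less[OF that] by (metis less_irrefl sgen_sgen)
    ultimately show ?thesis by simp
  qed
  have img: "(a, b) \<in> map_prod ?s ?s ` invs w \<longleftrightarrow> (?s a, ?s b) \<in> invs w" for a b
  proof
    assume "(?s a, ?s b) \<in> invs w"
    then have "map_prod ?s ?s (?s a, ?s b) \<in> map_prod ?s ?s ` invs w" by (rule imageI)
    then show "(a, b) \<in> map_prod ?s ?s ` invs w" by (simp add: sgen_sgen)
  qed (auto simp: sgen_sgen)
  have notsp: "(a, b) \<notin> simple_pairs i" if "(?s a, ?s b) \<in> invs w" for a b
  proof
    assume "(a, b) \<in> simple_pairs i"
    then have "(?s b, ?s a) \<in> simple_pairs i" by (rule sgen_simple_pairs)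
    then show False using simple_pairs_less[of "?s b" "?s a" i] that by (auto simp: invs_def)
  qed
  have notsp2: "(a, b) \<notin> simple_pairs i" if "(a, b) \<in> invs w" for a b
    using that simple_pairs_desc[OF w] asc by (auto simp: invs_def)
  show "map_prod ?s ?s ` invs w \<inter> simple_pairs i = {}"
    using img notsp by auto
  show "invs (w \<circ> ?s) = map_prod ?s ?s ` invs w \<union> simple_pairs i"
  proof (rule set_eqI, clarify)
    fix a b
    show "(a, b) \<in> invs (w \<circ> ?s) \<longleftrightarrow> (a, b) \<in> map_prod ?s ?s ` invs w \<union> simple_pairs i"
    proof (cases "(a, b) \<in> simple_pairs i")
      case True
      then show ?thesis using sp simple_pairs_less by (auto simp: invs_def)
    next
      case False
      have "(a, b) \<in> invs (w \<circ> ?s) \<longleftrightarrow> (?s a, ?s b) \<in> invs w"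
      proof
        assume "(a, b) \<in> invs (w \<circ> ?s)"
        then show "(?s a, ?s b) \<in> invs w"
          using sgen_strict_mono[OF _ _ _ False] by (auto simp: invs_def sgen_eq_0_iff)
      next
        assume *: "(?s a, ?s b) \<in> invs w"
        then have "sgen i (?s a) < sgen i (?s b)"
          using notsp2[OF *] by (intro sgen_strict_mono[of "?s a" "?s b"]) (auto simp: invs_def)
        then have "a < b" by (simp add: sgen_sgen)
        then show "(a, b) \<in> invs (w \<circ> ?s)"
          using * sgen_eq_0_iff[of i a] sgen_eq_0_iff[of i b] by (simp add: invs_def)
      qed
      then show ?thesis using False img by simp
    qed
  qed
qed

lemma neg_comp_sgen:
  assumes w: "w \<in> BC n" and asc: "\<not> desc w i"
  shows "neg (w \<circ> sgen i) = neg w + (if i = 0 then 1 else 0)"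
proof (cases "i = 0")
  case True
  have w1: "0 < w 1" using asc True BC_nonzero[OF w, of 1] by (auto simp: desc_def)
  have "{a. 0 < a \<and> (w \<circ> sgen 0) a < 0} = insert 1 {a. 0 < a \<and> w a < 0}"
    using w1 BC_minus[OF w, of 1] by (auto simp: sgen_apply simp del: sgen.simps split: if_splits)
  then show ?thesis using True w1 finite_neg[OF w] by (simp add: neg_def)
next
  case False
  have "bij_betw (sgen i) {a. 0 < a \<and> (w \<circ> sgen i) a < 0} {a. 0 < a \<and> w a < 0}"
    by (rule bij_betw_byWitness[where f' = "sgen i"])
       (use False in \<open>auto simp: sgen_sgen\<close>, auto simp: sgen_apply split: if_splits)
  then show ?thesis using False by (simp add: neg_def bij_betw_same_card)
qed

text \<open>For \<open>i = 0\<close> there is one new inversion and one new negative value, for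
  positive \<open>i\<close> two new inversions and no new negative value.\<close>

lemma len2_asc:
  assumes w: "w \<in> BC_inf" and asc: "\<not> desc w i"
  shows "len2 (w \<circ> sgen i) = len2 w + 2"
proof -
  obtain n where n: "w \<in> BC n" using w by (auto simp: BC_inf_def)
  have inj: "inj (map_prod (sgen i) (sgen i))"
    by (rule inj_on_inverseI[where g = "map_prod (sgen i) (sgen i)"]) (auto simp: sgen_sgen)
  have "card (map_prod (sgen i) (sgen i) ` invs w) = card (invs w)"
    by (rule card_image[OF inj_on_subset[OF inj]]) simp
  then have "card (invs (w \<circ> sgen i)) = card (invs w) + card (simple_pairs i)"
    using invs_asc[OF n asc] finite_invs[OF n]
    by (simp add: card_Un_disjoint simple_pairs_def)
  then show ?thesis
    by (simp add: len2_def neg_comp_sgen[OF n asc] card_simple_pairs)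
qed

lemma len2_desc:
  assumes w: "w \<in> BC_inf" and "desc w i"
  shows "len2 w = len2 (w \<circ> sgen i) + 2"
proof -
  have "w \<circ> sgen i \<in> BC_inf" "\<not> desc (w \<circ> sgen i) i"
    using assms desc_comp_sgen[OF w] comp_sgen_BC_inf_iff by auto
  from len2_asc[OF this] show ?thesis by (simp add: comp_sgen_sgen)
qed

text \<open>Without descents 0 < w(1) < w(2) < ..., so w(i) is at least i; counting down from the
  fixed point n + 1 shows that w(i) is at most i.\<close>

lemma ex_desc: assumes w: "w \<in> BC_inf" and "w \<noteq> id" shows "\<exists>i. desc w i"
proof (rule ccontr)
  assume "\<nexists>i. desc w i"
  then have nd: "\<not> desc w i" for i by blast
  obtain n where n: "w \<in> BC n" using w by (auto simp: BC_inf_def)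
  have step: "w (int i) < w (int i + 1)" if "i \<noteq> 0" for i
    using nd[of i] that BC_inj[OF n, of "int i" "int i + 1"] by (auto simp: desc_def not_less)
  have lower: "int i \<le> w (int i)" if "1 \<le> i" for i using that
  proof (induction rule: nat_induct_at_least)
    case base
    then show ?case using nd[of 0] BC_nonzero[OF n, of 1] by (auto simp: desc_def)
  next
    case (Suc i)
    then show ?case using step[of i] by (simp add: add.commute)
  qed
  have upper: "w (int (Suc n - i)) \<le> int (Suc n - i)" if "i \<le> n" for i using that
  proof (induction i)
    case 0
    then show ?case using BC_outside[OF n, of "int (Suc n)"] by simp
  next
    case (Suc i)
    have "w (int (Suc n - Suc i)) < w (int (Suc n - Suc i) + 1)" using Suc by (intro step) simp
    moreover have "int (Suc n - Suc i) + 1 = int (Suc n - i)" using Suc by simp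
    ultimately show ?case using Suc.IH Suc.prems by (metis Suc_leD add_le_cancel_right less_le_trans zless_imp_add1_zle order_trans zle_add1_eq_le)
  qed
  have pos: "w (int i) = int i" if "1 \<le> i" for i
  proof (cases "i \<le> n")
    case True
    then show ?thesis using lower[OF that] upper[of "Suc n - i"] that by simp
  next
    case False
    then show ?thesis using BC_outside[OF n] by simp
  qed
  have "w a = a" for a
  proof (cases "0 < a")
    case True
    then show ?thesis using pos[of "nat a"] by simp
  next
    case False
    then show ?thesis
      using pos[of "nat (- a)"] BC_minus[OF n, of "- a"] BC_zero[OF n] by (cases "a = 0") auto
  qed
  then show False using \<open>w \<noteq> id\<close> by (auto simp: fun_eq_iff)
qed

lemma len2_id: "len2 id = 0"
proof -
  have "invs id = {}" by (auto simp: invs_def)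
  moreover have "{i::int. 0 < i \<and> i < 0} = {}" by auto
  ultimately show ?thesis by (simp add: len2_def neg_def)
qed

lemma len2_word_prod: "len2 (word_prod as) \<le> 2 * length as"
proof (induction as rule: rev_induct)
  case Nil
  then show ?case using len2_id by (metis word_prod_Nil le0)
next
  case (snoc i as)
  have "len2 (word_prod as \<circ> sgen i) \<le> len2 (word_prod as) + 2"
    using len2_asc[OF word_prod_BC_inf, of as i] len2_desc[OF word_prod_BC_inf, of as i]
    by linarith
  with snoc show ?case by (simp add: word_prod_snoc comp_def)
qed

lemma ex_word_len2: "w \<in> BC_inf \<Longrightarrow> \<exists>as. word_prod as = w \<and> 2 * length as = len2 w"
proof (induction "len2 w" arbitrary: w rule: less_induct)
  case less
  show ?case
  proof (cases "w = id")
    case True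
    then show ?thesis using word_prod_Nil len2_id by (metis list.size(3) mult_0_right)
  next
    case False
    then obtain i where i: "desc w i" using ex_desc less by blast
    then have l: "len2 w = len2 (w \<circ> sgen i) + 2" using len2_desc less by blast
    then obtain as where "word_prod as = w \<circ> sgen i" "2 * length as = len2 (w \<circ> sgen i)"
      using less comp_sgen_BC_inf_iff by (metis less_add_same_cancel1 pos2)
    then show ?thesis
      using l by (intro exI[of _ "as @ [i]"]) (simp add: word_prod_snoc comp_sgen_sgen)
  qed
qed

text \<open>\<open>len2_word_prod\<close> bounds the length of every word for \<open>w\<close> from
  below, and cancelling descents one by one (\<open>ex_word_len2\<close>) attains the bound.\<close>

lemma len_len2: assumes "w \<in> BC_inf" shows "2 * len w = len2 w"
proof -
  obtain as where as: "word_prod as = w" "2 * length as = len2 w"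
    using ex_word_len2[OF assms] by blast
  have "len w = length as"
    unfolding len_def
  proof (rule Least_equality)
    show "\<exists>bs. length bs = length as \<and> word_prod bs = w" using as by blast
    fix l assume "\<exists>bs. length bs = l \<and> word_prod bs = w"
    then obtain bs where "length bs = l" "word_prod bs = w" by blast
    then show "length as \<le> l" using len2_word_prod[of bs] as by simp
  qed
  then show ?thesis using as by simp
qed

lemma len_desc: "w \<in> BC_inf \<Longrightarrow> desc w i \<Longrightarrow> len w = Suc (len (w \<circ> sgen i))"
  using len2_desc[of w i] len_len2[of w] len_len2[of "w \<circ> sgen i"] comp_sgen_BC_inf_iff[of w i]
  by simp

lemma len_asc: "w \<in> BC_inf \<Longrightarrow> \<not> desc w i \<Longrightarrow> len (w \<circ> sgen i) = Suc (len w)"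
  using len2_asc[of w i] len_len2[of w] len_len2[of "w \<circ> sgen i"] comp_sgen_BC_inf_iff[of w i]
  by simp

lemma desc_iff_len: "w \<in> BC_inf \<Longrightarrow> desc w i \<longleftrightarrow> len (w \<circ> sgen i) < len w"
  using len_desc[of w i] len_asc[of w i] by (cases "desc w i") auto

lemma len_id: "len id = 0"
  using len_len2[OF id_BC_inf] len2_id by simp

lemma len_eq_0_iff: assumes "w \<in> BC_inf" shows "len w = 0 \<longleftrightarrow> w = id"
  using ex_desc[OF assms] len_desc[OF assms] len_id by fastforce

lemma len_le_length: "len (word_prod as) \<le> length as"
  using len2_word_prod[of as] len_len2[OF word_prod_BC_inf, of as] by simp

section \<open>Reduced words\<close>

lemma R_BC_inf: "a \<in> R w \<Longrightarrow> w \<in> BC_inf"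
  using word_prod_BC_inf by (auto simp: R_def)

lemma R_length: "a \<in> R w \<Longrightarrow> length a = len w"
  by (simp add: R_def)

lemma Nil_R_iff: "[] \<in> R w \<longleftrightarrow> w = id"
  using len_id by (auto simp: R_def word_prod_Nil)

text \<open>The last letter of a reduced word is a descent because removing it shortens the product.
  Inductions on reduced words run from the right, in step with the right multiplications
  \<open>nil_u\<close>.\<close>

lemma snoc_R_iff:
  assumes w: "w \<in> BC_inf"
  shows "a @ [i] \<in> R w \<longleftrightarrow> desc w i \<and> a \<in> R (w \<circ> sgen i)"
proof
  assume *: "a @ [i] \<in> R w"
  then have a: "word_prod a = w \<circ> sgen i" "Suc (length a) = len w"
    by (auto simp: R_def word_prod_snoc comp_sgen_sgen)
  then have "len (w \<circ> sgen i) \<le> length a" using len_le_length[of a] by simp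
  then have d: "desc w i" using a desc_iff_len[OF w] by simp
  then show "desc w i \<and> a \<in> R (w \<circ> sgen i)"
    using a len_desc[OF w d] by (auto simp: R_def)
next
  assume "desc w i \<and> a \<in> R (w \<circ> sgen i)"
  then show "a @ [i] \<in> R w"
    using len_desc[OF w] by (auto simp: R_def word_prod_snoc comp_sgen_sgen)
qed

lemma R_letters:
  assumes "w \<in> BC n" "a \<in> R w" shows "set a \<subseteq> {..<n}"
  using assms
proof (induction a arbitrary: w rule: rev_induct)
  case (snoc i a)
  then have i: "desc w i" "a \<in> R (w \<circ> sgen i)"
    using snoc_R_iff[OF BC_inf_I] by auto
  then have "i < n" using not_desc_outside[OF snoc.prems(1)] by (meson not_le)
  then have "w \<circ> sgen i \<in> BC n" using BC_comp[OF snoc.prems(1) sgen_BC] by blast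
  then show ?case using snoc.IH i(2) \<open>i < n\<close> by fastforce
qed simp

lemma finite_R: "finite (R w)"
proof (cases "w \<in> BC_inf")
  case True
  then obtain n where "w \<in> BC n" by (auto simp: BC_inf_def)
  then have "R w \<subseteq> {a. set a \<subseteq> {..<n} \<and> length a = len w}"
    using R_letters by (auto simp: R_def)
  then show ?thesis using finite_lists_length_eq[of "{..<n}"] finite_subset by blast
next
  case False
  then have "R w = {}" using R_BC_inf by blast
  then show ?thesis by simp
qed

text \<open>Only the letter 0 changes the number of negative values, and in a reduced word each
  occurrence adds one. The exponent s(w) of the theorem meets the pipe dreams through this
  count.\<close>

lemma count_zeros_R: "a \<in> R w \<Longrightarrow> count_list a 0 = neg w"
proof (induction a arbitrary: w rule: rev_induct)
  case Nil
  then have "w = id" using Nil_R_iff by blast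
  moreover have "neg id = 0" using len2_id unfolding len2_def by linarith
  ultimately show ?case by (metis count_list.simps(1))
next
  case (snoc i a)
  have w: "w \<in> BC_inf" using R_BC_inf snoc by blast
  then have i: "desc w i" "a \<in> R (w \<circ> sgen i)" using snoc snoc_R_iff by auto
  obtain n where n: "w \<circ> sgen i \<in> BC n"
    using w comp_sgen_BC_inf_iff BC_inf_obtain by metis
  have "neg w = neg (w \<circ> sgen i) + (if i = 0 then 1 else 0)"
    using neg_comp_sgen[OF n, of i] i desc_comp_sgen[OF w] by (simp add: comp_sgen_sgen)
  then show ?case using snoc.IH[OF i(2)] by (cases "i = 0") (simp_all add: comp_def)
qed

text \<open>If one of the two parts had a shorter word, inserting it would give a word for
  \<open>w\<close> that is too short.\<close>

lemma append_R:
  assumes "a @ b \<in> R w"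
  shows "a \<in> R (word_prod a)" "b \<in> R (word_prod b)"
    "len (word_prod a) + len (word_prod b) = len w"
proof -
  have w: "word_prod a \<circ> word_prod b = w" "length a + length b = len w"
    using assms by (auto simp: R_def word_prod_append)
  obtain a' where a': "word_prod a' = word_prod a" "length a' = len (word_prod a)"
    using ex_word_len2[OF word_prod_BC_inf, of a] len_len2[OF word_prod_BC_inf, of a] by auto
  obtain b' where b': "word_prod b' = word_prod b" "length b' = len (word_prod b)"
    using ex_word_len2[OF word_prod_BC_inf, of b] len_len2[OF word_prod_BC_inf, of b] by auto
  have "len w \<le> length a' + length b'"
    using len_le_length[of "a' @ b'"] a' b' w by (simp add: word_prod_append)
  then have "length a = len (word_prod a)" "length b = len (word_prod b)"
    using len_le_length[of a] len_le_length[of b] a' b' w by auto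
  then show "a \<in> R (word_prod a)" "b \<in> R (word_prod b)"
    "len (word_prod a) + len (word_prod b) = len w"
    using w by (auto simp: R_def)
qed

lemma append_R_I:
  assumes "a \<in> R u" "b \<in> R v" "len u + len v = len (u \<circ> v)"
  shows "a @ b \<in> R (u \<circ> v)"
  using assms by (auto simp: R_def word_prod_append)

text \<open>Two equal neighbours would form a reduced factor of length 2 whose product is the
  identity.\<close>

lemma R_adjacent_distinct:
  assumes "a \<in> R w" "Suc i < length a" shows "a ! i \<noteq> a ! Suc i"
proof
  assume eq: "a ! i = a ! Suc i"
  have "a = take i a @ [a ! i, a ! i] @ drop (Suc (Suc i)) a"
    using assms(2) eq
    by (metis Cons_nth_drop_Suc Suc_lessD append_Cons append_Nil append_take_drop_id)
  then have "[a ! i, a ! i] @ drop (Suc (Suc i)) a \<in> R (word_prod ([a ! i, a ! i] @ drop (Suc (Suc i)) a))"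
    using append_R(2) assms(1) by metis
  then have "[a ! i, a ! i] \<in> R (word_prod [a ! i, a ! i])" by (rule append_R(1))
  then show False
    using len_id by (auto simp: R_def word_prod_Cons word_prod_Nil sgen_comp_sgen)
qed

section \<open>The polynomial ring\<close>

fun var_kind :: "var \<Rightarrow> nat" where
  "var_kind (Z i) = 0"
| "var_kind (X i) = 1"
| "var_kind (P i) = 2"

fun var_index :: "var \<Rightarrow> nat" where
  "var_index (Z i) = i"
| "var_index (X i) = i"
| "var_index (P i) = i"

text \<open>An order on the variables makes the library recognise \<^typ>\<open>mpoly\<close> as an integral domain.\<close>

instantiation var :: linorder
begin

definition less_eq_var where
  "v \<le> v' \<longleftrightarrow> var_kind v < var_kind v' \<or> var_kind v = var_kind v' \<and> var_index v \<le> var_index v'"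

definition less_var where
  "v < v' \<longleftrightarrow> var_kind v < var_kind v' \<or> var_kind v = var_kind v' \<and> var_index v < var_index v'"

instance
proof
  fix x y z :: var
  show "x < y \<longleftrightarrow> x \<le> y \<and> \<not> y \<le> x" unfolding less_eq_var_def less_var_def by linarith
  show "x \<le> x" unfolding less_eq_var_def by simp
  show "x \<le> y \<Longrightarrow> y \<le> z \<Longrightarrow> x \<le> z" unfolding less_eq_var_def by linarith
  show "x \<le> y \<Longrightarrow> y \<le> x \<Longrightarrow> x = y"
    by (cases x; cases y) (simp_all add: less_eq_var_def)
  show "x \<le> y \<or> y \<le> x" unfolding less_eq_var_def by linarith
qed

end

lemma mpoly_sum_single:
  "f = (\<Sum>m\<in>Poly_Mapping.keys f. Poly_Mapping.single m (Poly_Mapping.lookup f m))"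
proof (rule poly_mapping_eqI)
  fix m
  have "Poly_Mapping.lookup
      (\<Sum>m\<in>Poly_Mapping.keys f. Poly_Mapping.single m (Poly_Mapping.lookup f m)) m =
    (\<Sum>m'\<in>Poly_Mapping.keys f. if m' = m then Poly_Mapping.lookup f m' else 0)"
    by (simp add: lookup_sum lookup_single when_def)
  then show "Poly_Mapping.lookup f m = Poly_Mapping.lookup
      (\<Sum>m\<in>Poly_Mapping.keys f. Poly_Mapping.single m (Poly_Mapping.lookup f m)) m"
    by (simp add: in_keys_iff)
qed

lemma Const_add: "Const (a + b) = Const a + Const b"
  by (simp add: Const_def single_add)

lemma Const_mult: "Const (a * b) = Const a * Const b"
  by (simp add: Const_def mult_single)

lemma Const_0: "Const 0 = 0"
  by (simp add: Const_def)

lemma Const_1: "Const 1 = 1"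
  by (simp add: Const_def)

lemma Const_of_nat: "Const (of_nat n) = of_nat n"
  by (induction n) (simp_all add: Const_0 Const_1 Const_add)

lemma Const_uminus: "Const (- a) = - Const a"
  by (simp add: Const_def single_uminus)

lemma Const_power: "Const (a ^ n) = Const a ^ n"
  by (induction n) (simp_all add: Const_1 Const_mult)

lemma lookup_Const_mult: "Poly_Mapping.lookup (Const c * f) m = c * Poly_Mapping.lookup f m"
proof -
  have "Const c * f = (\<Sum>m\<in>Poly_Mapping.keys f. Poly_Mapping.single m (c * Poly_Mapping.lookup f m))"
    by (subst mpoly_sum_single[of f]) (simp add: sum_distrib_left Const_def mult_single)
  then show ?thesis
    by (simp add: lookup_sum lookup_single when_def in_keys_iff)
qed

section \<open>Substitutions as algebra homomorphisms\<close>

definition mon_subst :: "(var \<Rightarrow> mpoly) \<Rightarrow> monomial \<Rightarrow> mpoly" where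
  "mon_subst \<sigma> m = (\<Prod>v\<in>Poly_Mapping.keys m. \<sigma> v ^ Poly_Mapping.lookup m v)"

lemma mon_subst_superset:
  "finite A \<Longrightarrow> Poly_Mapping.keys m \<subseteq> A \<Longrightarrow>
    mon_subst \<sigma> m = (\<Prod>v\<in>A. \<sigma> v ^ Poly_Mapping.lookup m v)"
  unfolding mon_subst_def by (rule prod.mono_neutral_left) (auto simp: in_keys_iff)

lemma mon_subst_add: "mon_subst \<sigma> (m + m') = mon_subst \<sigma> m * mon_subst \<sigma> m'"
proof -
  let ?A = "Poly_Mapping.keys m \<union> Poly_Mapping.keys m'"
  have "Poly_Mapping.keys (m + m') \<subseteq> ?A" by (rule keys_add)
  then show ?thesis
    by (simp add: mon_subst_superset[of ?A] lookup_add power_add prod.distrib)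
qed

lemma mon_subst_0: "mon_subst \<sigma> 0 = 1"
  by (simp add: mon_subst_def)

lemma mon_subst_single: "mon_subst \<sigma> (Poly_Mapping.single v k) = \<sigma> v ^ k"
  by (subst mon_subst_superset[of "{v}"]) auto

lemma subst_superset:
  "finite A \<Longrightarrow> Poly_Mapping.keys f \<subseteq> A \<Longrightarrow>
    subst \<sigma> f = (\<Sum>m\<in>A. Const (Poly_Mapping.lookup f m) * mon_subst \<sigma> m)"
  unfolding subst_def mon_subst_def
  by (rule sum.mono_neutral_left) (auto simp: in_keys_iff Const_0)

lemma subst_add: "subst \<sigma> (f + g) = subst \<sigma> f + subst \<sigma> g"
proof -
  let ?A = "Poly_Mapping.keys f \<union> Poly_Mapping.keys g"
  have "Poly_Mapping.keys (f + g) \<subseteq> ?A" by (rule keys_add)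
  then show ?thesis
    by (simp add: subst_superset[of ?A] lookup_add Const_add distrib_right sum.distrib)
qed

lemma subst_0: "subst \<sigma> 0 = 0"
  by (simp add: subst_def)

lemma subst_sum: "subst \<sigma> (\<Sum>i\<in>A. f i) = (\<Sum>i\<in>A. subst \<sigma> (f i))"
  by (induction A rule: infinite_finite_induct) (simp_all add: subst_0 subst_add)

lemma subst_single: "subst \<sigma> (Poly_Mapping.single m c) = Const c * mon_subst \<sigma> m"
  by (subst subst_superset[of "{m}"]) auto

lemma subst_Const: "subst \<sigma> (Const c) = Const c"
  unfolding Const_def subst_single by (simp add: mon_subst_0 Const_def)

lemma subst_Var: "subst \<sigma> (Var v) = \<sigma> v"
  by (simp add: Var_def monom_poly_def subst_single mon_subst_single Const_1)

lemma subst_mult: "subst \<sigma> (f * g) = subst \<sigma> f * subst \<sigma> g"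
proof -
  have *: "subst \<sigma> (Poly_Mapping.single m c * Poly_Mapping.single m' c') =
      subst \<sigma> (Poly_Mapping.single m c) * subst \<sigma> (Poly_Mapping.single m' c')" for m m' c c'
    by (simp add: mult_single subst_single mon_subst_add Const_mult)
  have s: "subst \<sigma> h = (\<Sum>m\<in>Poly_Mapping.keys h.
      subst \<sigma> (Poly_Mapping.single m (Poly_Mapping.lookup h m)))" for h
    by (rule trans[OF arg_cong[where f = "subst \<sigma>", OF mpoly_sum_single] subst_sum])
  have "f * g = (\<Sum>m\<in>Poly_Mapping.keys f. \<Sum>m'\<in>Poly_Mapping.keys g.
      Poly_Mapping.single m (Poly_Mapping.lookup f m) *
      Poly_Mapping.single m' (Poly_Mapping.lookup g m'))"
    by (rule trans[OF arg_cong2[where f = "(*)", OF mpoly_sum_single mpoly_sum_single] sum_product])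
  then have "subst \<sigma> (f * g) = (\<Sum>m\<in>Poly_Mapping.keys f. \<Sum>m'\<in>Poly_Mapping.keys g.
      subst \<sigma> (Poly_Mapping.single m (Poly_Mapping.lookup f m)) *
      subst \<sigma> (Poly_Mapping.single m' (Poly_Mapping.lookup g m')))"
    by (simp only: subst_sum *)
  then show ?thesis by (simp only: s[of f] s[of g] sum_product)
qed

text \<open>Isolates what the generating functions need to know about \<open>act i\<close> and
  \<open>truncate k\<close>, both of which are instances of \<open>subst\<close>.\<close>

definition alg_hom :: "(mpoly \<Rightarrow> mpoly) \<Rightarrow> bool" where
  "alg_hom \<phi> \<longleftrightarrow> (\<forall>f g. \<phi> (f + g) = \<phi> f + \<phi> g) \<and> (\<forall>f g. \<phi> (f * g) = \<phi> f * \<phi> g) \<and>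
     (\<forall>c. \<phi> (Const c) = Const c)"

lemma alg_hom_subst: "alg_hom (subst \<sigma>)"
  by (simp add: alg_hom_def subst_add subst_mult subst_Const)

lemma alg_hom_simps:
  assumes "alg_hom \<phi>"
  shows "\<phi> (f + g) = \<phi> f + \<phi> g" "\<phi> (f * g) = \<phi> f * \<phi> g" "\<phi> (Const c) = Const c"
    "\<phi> 0 = 0" "\<phi> 1 = 1" "\<phi> (- f) = - \<phi> f" "\<phi> (f - g) = \<phi> f - \<phi> g" "\<phi> (f ^ n) = \<phi> f ^ n" "\<phi> (numeral k) = numeral k"
proof -
  have add: "\<phi> (f + g) = \<phi> f + \<phi> g" and mult: "\<phi> (f * g) = \<phi> f * \<phi> g"
    and const: "\<phi> (Const c) = Const c" for f g c
    using assms by (simp_all add: alg_hom_def)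
  show "\<phi> (f + g) = \<phi> f + \<phi> g" "\<phi> (f * g) = \<phi> f * \<phi> g" "\<phi> (Const c) = Const c"
    by (fact add mult const)+
  show "\<phi> 0 = 0" "\<phi> 1 = 1" using const[of 0] const[of 1] by (simp_all add: Const_0 Const_1)
  have neg: "\<phi> (- f) = - \<phi> f" for f
    using add[of f "- f"] \<open>\<phi> 0 = 0\<close> by (simp add: add_eq_0_iff)
  show "\<phi> (- f) = - \<phi> f" by (rule neg)
  show "\<phi> (f - g) = \<phi> f - \<phi> g" using add[of f "- g"] neg[of g] by simp
  show "\<phi> (numeral k) = numeral k"
    using const[of "of_nat (numeral k)"] unfolding Const_of_nat by simp
  show "\<phi> (f ^ n) = \<phi> f ^ n" by (induction n) (simp_all add: mult \<open>\<phi> 1 = 1\<close>)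
qed

lemma monomial_sum_single:
  "m = (\<Sum>v\<in>Poly_Mapping.keys m. Poly_Mapping.single v (Poly_Mapping.lookup m v))" for m :: monomial
proof (rule poly_mapping_eqI)
  fix v
  have "Poly_Mapping.lookup
      (\<Sum>v\<in>Poly_Mapping.keys m. Poly_Mapping.single v (Poly_Mapping.lookup m v)) v =
    (\<Sum>v'\<in>Poly_Mapping.keys m. if v' = v then Poly_Mapping.lookup m v' else 0)"
    by (simp add: lookup_sum lookup_single when_def)
  then show "Poly_Mapping.lookup m v = Poly_Mapping.lookup
      (\<Sum>v\<in>Poly_Mapping.keys m. Poly_Mapping.single v (Poly_Mapping.lookup m v)) v"
    by (simp add: in_keys_iff)
qed

lemma monom_poly_add: "monom_poly (m + m') = monom_poly m * monom_poly m'"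
  by (simp add: monom_poly_def mult_single)

lemma monom_poly_0: "monom_poly 0 = 1"
  by (simp add: monom_poly_def)

lemma monom_poly_sum: "monom_poly (\<Sum>i\<in>A. m i) = (\<Prod>i\<in>A. monom_poly (m i))"
  by (induction A rule: infinite_finite_induct) (simp_all add: monom_poly_0 monom_poly_add)

lemma Var_power: "Var v ^ k = monom_poly (Poly_Mapping.single v k)"
proof (induction k)
  case (Suc k)
  have "monom_poly (Poly_Mapping.single v (Suc k)) =
      monom_poly (Poly_Mapping.single v 1) * monom_poly (Poly_Mapping.single v k)"
    by (simp add: monom_poly_add[symmetric] single_add[symmetric])
  then show ?case using Suc by (simp add: Var_def)
qed (simp add: monom_poly_0)

lemma Var_nonzero: "Var v \<noteq> 0"
proof
  assume "Var v = 0"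
  then have "Poly_Mapping.lookup (Var v) (Poly_Mapping.single v 1) = 0" by simp
  then show False by (simp add: Var_def monom_poly_def)
qed

lemma mon_subst_Var: "mon_subst Var m = monom_poly m"
proof -
  have "mon_subst Var m = monom_poly
      (\<Sum>v\<in>Poly_Mapping.keys m. Poly_Mapping.single v (Poly_Mapping.lookup m v))"
    by (simp add: monom_poly_sum mon_subst_def Var_power)
  then show ?thesis by (simp only: monomial_sum_single[symmetric])
qed

lemma single_eq: "Poly_Mapping.single m c = Const c * monom_poly m"
  by (simp add: Const_def monom_poly_def mult_single)

section \<open>Subrings given by variables, and degrees\<close>

definition vars_in :: "var set \<Rightarrow> mpoly set" where
  "vars_in V = {f. \<forall>m\<in>Poly_Mapping.keys f. Poly_Mapping.keys m \<subseteq> V}"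

lemma vars_in_Const: "Const c \<in> vars_in V"
  by (auto simp: vars_in_def Const_def)

lemma vars_in_0: "0 \<in> vars_in V"
  by (simp add: vars_in_def)

lemma vars_in_Var: "v \<in> V \<Longrightarrow> Var v \<in> vars_in V"
  by (simp add: vars_in_def Var_def monom_poly_def)

lemma vars_in_add: "f \<in> vars_in V \<Longrightarrow> g \<in> vars_in V \<Longrightarrow> f + g \<in> vars_in V"
  using keys_add[of f g] by (auto simp: vars_in_def)

lemma keys_minus_mpoly: "Poly_Mapping.keys (- f) = Poly_Mapping.keys f" for f :: mpoly
  by (auto simp: in_keys_iff)

lemma vars_in_uminus: "f \<in> vars_in V \<Longrightarrow> - f \<in> vars_in V"
  by (auto simp: vars_in_def keys_minus_mpoly)

lemma vars_in_mult: assumes "f \<in> vars_in V" "g \<in> vars_in V" shows "f * g \<in> vars_in V"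
  unfolding vars_in_def
proof (clarify)
  fix m v assume m: "m \<in> Poly_Mapping.keys (f * g)" and v: "v \<in> Poly_Mapping.keys m"
  obtain a b where ab: "m = a + b" "a \<in> Poly_Mapping.keys f" "b \<in> Poly_Mapping.keys g"
    using m keys_mult[of f g] by auto
  then show "v \<in> V" using assms v keys_add[of a b] unfolding vars_in_def by blast
qed

lemma vars_in_sum: "(\<And>i. i \<in> A \<Longrightarrow> f i \<in> vars_in V) \<Longrightarrow> (\<Sum>i\<in>A. f i) \<in> vars_in V"
  by (induction A rule: infinite_finite_induct) (simp_all add: vars_in_0 vars_in_add)

text \<open>Serves properties that pass to sums and products, such as the divisibility of
  \<open>f - act i f\<close>.\<close>

lemma mpoly_induct [consumes 1, case_names Const Var add mult]:
  assumes "f \<in> vars_in V"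
    and const: "\<And>c. Q (Const c)" and var: "\<And>v. v \<in> V \<Longrightarrow> Q (Var v)"
    and add: "\<And>f g. Q f \<Longrightarrow> Q g \<Longrightarrow> Q (f + g)" and mult: "\<And>f g. Q f \<Longrightarrow> Q g \<Longrightarrow> Q (f * g)"
  shows "Q f"
proof -
  have pow: "Q (g ^ n)" if "Q g" for g n
    using that const[of 1] by (induction n) (simp_all add: Const_1 mult)
  have prod: "Q (prod g A)" if "\<And>x. x \<in> A \<Longrightarrow> Q (g x)" for g and A :: "var set"
    using that const[of 1] by (induction A rule: infinite_finite_induct) (simp_all add: Const_1 mult)
  have sum: "Q (sum g A)" if "\<And>x. x \<in> A \<Longrightarrow> Q (g x)" for g and A :: "monomial set"
    using that const[of 0] by (induction A rule: infinite_finite_induct) (simp_all add: Const_0 add)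
  have "Q (Poly_Mapping.single m (Poly_Mapping.lookup f m))" if "m \<in> Poly_Mapping.keys f" for m
    unfolding single_eq mon_subst_Var[symmetric] mon_subst_def
    by (intro mult const prod pow var) (use that assms(1) in \<open>auto simp: vars_in_def\<close>)
  then show ?thesis by (subst mpoly_sum_single) (rule sum)
qed

lemma subst_vars_in:
  "f \<in> vars_in V \<Longrightarrow> (\<And>v. v \<in> V \<Longrightarrow> \<sigma> v \<in> vars_in W) \<Longrightarrow> subst \<sigma> f \<in> vars_in W"
  by (induction rule: mpoly_induct)
     (simp_all add: subst_Const subst_Var subst_add subst_mult vars_in_Const vars_in_add vars_in_mult)

lemma zp_ring_eq: "zp_ring = vars_in ({Z i | i. 1 \<le> i} \<union> {P k | k. odd k})"
  by (simp add: zp_ring_def vars_in_def)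

definition mdeg :: "monomial \<Rightarrow> nat" where
  "mdeg m = (\<Sum>v\<in>Poly_Mapping.keys m. Poly_Mapping.lookup m v * var_degree v)"

lemma mdeg_add: "mdeg (m + m') = mdeg m + mdeg m'"
proof -
  let ?A = "Poly_Mapping.keys m \<union> Poly_Mapping.keys m'"
  have *: "mdeg a = (\<Sum>v\<in>?A. Poly_Mapping.lookup a v * var_degree v)"
    if "Poly_Mapping.keys a \<subseteq> ?A" for a
    unfolding mdeg_def by (rule sum.mono_neutral_left) (use that in \<open>auto simp: in_keys_iff\<close>)
  show ?thesis
    using *[of m] *[of m'] *[of "m + m'", OF keys_add]
    by (simp add: lookup_add algebra_simps sum.distrib)
qed

definition hom_deg :: "nat \<Rightarrow> mpoly set" where
  "hom_deg d = {f. \<forall>m\<in>Poly_Mapping.keys f. mdeg m = d}"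

lemma homogeneous_eq: "homogeneous = (\<Union>d. hom_deg d)"
  by (auto simp: homogeneous_def hom_deg_def mdeg_def)

lemma hom_deg_0: "0 \<in> hom_deg d"
  by (simp add: hom_deg_def)

lemma hom_deg_Const: "Const c \<in> hom_deg 0"
  by (auto simp: hom_deg_def Const_def mdeg_def)

lemma hom_deg_Var: "Var v \<in> hom_deg (var_degree v)"
  by (auto simp: hom_deg_def Var_def monom_poly_def mdeg_def)

lemma hom_deg_add: "f \<in> hom_deg d \<Longrightarrow> g \<in> hom_deg d \<Longrightarrow> f + g \<in> hom_deg d"
  using keys_add[of f g] by (auto simp: hom_deg_def)

lemma hom_deg_mult: assumes "f \<in> hom_deg d" "g \<in> hom_deg e" shows "f * g \<in> hom_deg (d + e)"
  using keys_mult[of f g] assms by (fastforce simp: hom_deg_def mdeg_add)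

definition vars_of :: "mpoly \<Rightarrow> var set" where
  "vars_of f = (\<Union>m\<in>Poly_Mapping.keys f. Poly_Mapping.keys m)"

lemma finite_vars_of: "finite (vars_of f)"
  by (simp add: vars_of_def)

lemma vars_in_iff: "f \<in> vars_in V \<longleftrightarrow> vars_of f \<subseteq> V"
  by (auto simp: vars_in_def vars_of_def)

section \<open>Exactness of the divided differences\<close>

lemma divisor_nonzero: "divisor i \<noteq> 0"
proof
  \<comment> \<open>Evaluation at the point with all variables 1 if \<open>i = 0\<close>, and
    otherwise at z_i = 1 with all other variables 0.\<close>
  have sub: "subst (\<lambda>v. Const (if v = Z i \<or> i = 0 then 1 else 0)) (divisor i) =
      (if i = 0 then - 2 else 1)"
    by (simp add: divisor_def alg_hom_simps[OF alg_hom_subst] subst_Var Const_1 Const_0)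
  assume "divisor i = 0"
  then have "(if i = 0 then - 2 else 1 :: mpoly) = 0" using sub by (simp add: subst_0)
  then show False by (simp split: if_splits)
qed

text \<open>In an integral domain the quotient is unique, as the definite description in
  \<open>divdiff\<close> demands.\<close>

lemma divdiff_eqI: "divisor i * g = f - act i f \<Longrightarrow> divdiff i f = g"
  unfolding divdiff_def using divisor_nonzero[of i] by (intro the_equality) (auto, metis mult_cancel_left)

lemma act_simps:
  "act i (f + g) = act i f + act i g" "act i (f * g) = act i f * act i g" "act i (Const c) = Const c"
  "act i (f - g) = act i f - act i g" "act i (Var v) = act_var i v"
  by (simp_all add: act_def alg_hom_simps[OF alg_hom_subst] subst_Var)

text \<open>Divisibility passes to products by the twisted Leibniz rule f g - s(f) s(g) = (f - s(f))
  g + s(f) (g - s(g)), so only variables need checking. An odd \<open>k\<close> is positive, hence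
  z_1 divides the change of \<open>P k\<close> under s_0; the 2 is inverted in the
  rationals.\<close>

lemma divisor_dvd:
  assumes "f \<in> zp_ring" shows "divisor i dvd f - act i f"
  using assms unfolding zp_ring_eq
proof (induction rule: mpoly_induct)
  case (Const c)
  then show ?case by (simp add: act_simps)
next
  case (add f g)
  have "f + g - act i (f + g) = (f - act i f) + (g - act i g)" by (simp add: act_simps)
  then show ?case using add by (simp only: dvd_add)
next
  case (mult f g)
  have "f * g - act i (f * g) = (f - act i f) * g + act i f * (g - act i g)"
    by (simp add: act_simps algebra_simps)
  then show ?case using mult by (simp only: dvd_add dvd_mult dvd_mult2)
next
  case (Var v)
  then consider j where "v = Z j" | k where "v = P k" "odd k" by blast
  then show ?case
  proof cases
    case 1
    show ?thesis
    proof (cases i)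
      case 0
      then show ?thesis using 1 by (auto simp: act_simps divisor_def)
    next
      case (Suc i')
      have "divisor i dvd - divisor i" by simp
      then show ?thesis using 1 Suc by (auto simp: act_simps divisor_def transpose_def)
    qed
  next
    case 2
    show ?thesis
    proof (cases i)
      case 0
      have half: "2 * Const (1 / 2) = 1"
        using Const_mult[of "of_nat 2" "1 / 2"] unfolding Const_of_nat by (simp add: Const_1)
      have "Var v - act 0 (Var v) = - (Var (Z 1) ^ k)" using 2 by (simp add: act_simps)
      also have "\<dots> = - (1 * (Var (Z 1) * Var (Z 1) ^ (k - 1)))"
        using \<open>odd k\<close> by (cases k) simp_all
      also have "\<dots> = - 2 * Var (Z 1) * (Const (1 / 2) * Var (Z 1) ^ (k - 1))"
        unfolding half[symmetric] by (simp only: mult_ac mult_minus_left mult_minus_right)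
      finally have "divisor 0 dvd Var v - act 0 (Var v)"
        unfolding divisor_def by (simp only: if_True refl dvd_triv_left)
      then show ?thesis using 0 by simp
    next
      case (Suc i')
      then show ?thesis using 2 by (simp add: act_simps)
    qed
  qed
qed

section \<open>Invariants are constant\<close>

lemma vars_of_act_Suc:
  assumes "act (Suc i) f = f"
  shows "vars_of f \<subseteq> {X j | j. True} \<union> {P j | j. True} \<union>
    {Z (transpose (Suc i) (Suc (Suc i)) j) | j. Z j \<in> vars_of f}"
proof -
  have "act (Suc i) f \<in> vars_in ({X j | j. True} \<union> {P j | j. True} \<union>
    {Z (transpose (Suc i) (Suc (Suc i)) j) | j. Z j \<in> vars_of f})"
    unfolding act_def
  proof (rule subst_vars_in[where V = "vars_of f"])
    show "f \<in> vars_in (vars_of f)" by (simp add: vars_in_iff)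
    fix v assume "v \<in> vars_of f"
    then show "act_var (Suc i) v \<in> vars_in ({X j | j. True} \<union> {P j | j. True} \<union>
      {Z (transpose (Suc i) (Suc (Suc i)) j) | j. Z j \<in> vars_of f})"
      by (cases v) (auto intro!: vars_in_Var)
  qed
  then show ?thesis using assms by (simp add: vars_in_iff)
qed

text \<open>An invariant that contains z_j also contains z_(j+1), hence infinitely many variables,
  which no polynomial does.\<close>

lemma invariant_no_Z:
  assumes "\<And>i. act (Suc i) f = f" "1 \<le> j"
  shows "Z j \<notin> vars_of f"
proof
  assume "Z j \<in> vars_of f"
  have "Z (j + k) \<in> vars_of f" for k
  proof (induction k)
    case (Suc k)
    obtain i where i: "j + k = Suc i" using \<open>1 \<le> j\<close> by (cases "j + k") auto
    obtain j' where j': "j + k = transpose (Suc i) (Suc (Suc i)) j'" "Z j' \<in> vars_of f"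
      using vars_of_act_Suc[OF assms(1), of i] Suc by auto
    then have "j' = Suc (Suc i)" using i by (auto simp: transpose_def split: if_splits)
    then show ?case using j' i by simp
  qed (use \<open>Z j \<in> vars_of f\<close> in simp)
  then have "range (\<lambda>k. Z (j + k)) \<subseteq> vars_of f" by blast
  moreover have "infinite (range (\<lambda>k. Z (j + k)))"
    by (simp add: finite_image_iff inj_on_def)
  ultimately show False using finite_vars_of finite_subset by blast
qed

lemma dvd_diff_mult:
  fixes a :: "'a :: comm_ring_1"
  assumes "d dvd a - a'" "d dvd b - b'"
  shows "d dvd a * b - a' * b'"
proof -
  have "a * b - a' * b' = (a - a') * b + a' * (b - b')" by (simp add: algebra_simps)
  then show ?thesis using assms by (simp only: dvd_add dvd_mult dvd_mult2)
qed

lemma dvd_diff_power: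
  fixes a :: "'a :: comm_ring_1"
  assumes "d dvd a - a'"
  shows "d dvd a ^ n - a' ^ n"
  by (induction n) (simp_all add: dvd_diff_mult assms)

lemma dvd_diff_prod:
  fixes a :: "'b \<Rightarrow> 'a :: comm_ring_1"
  assumes "\<And>i. i \<in> A \<Longrightarrow> d dvd a i - b i"
  shows "d dvd prod a A - prod b A"
  using assms by (induction A rule: infinite_finite_induct) (simp_all add: dvd_diff_mult)

lemma dvd_power_first_order:
  fixes a :: "'a :: comm_ring_1"
  shows "h ^ 2 dvd (a + h) ^ n - (a ^ n + of_nat n * h * a ^ (n - 1))"
proof (induction n)
  case (Suc n)
  \<comment> \<open>At \<open>n = 0\<close> the exponent \<open>n - 1\<close> is 0 rather than
    negative, and the factor \<open>of_nat n\<close> vanishes.\<close>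
  have "of_nat n * h * a ^ n = of_nat n * h * (a ^ (n - 1) * a)"
    by (cases n) (simp_all add: mult.commute)
  then have "(a + h) ^ Suc n - (a ^ Suc n + of_nat (Suc n) * h * a ^ (Suc n - 1)) =
      (a + h) * ((a + h) ^ n - (a ^ n + of_nat n * h * a ^ (n - 1))) +
      h ^ 2 * (of_nat n * a ^ (n - 1))"
    by (simp add: algebra_simps power2_eq_square)
  then show ?case using Suc by (simp only: dvd_add dvd_mult dvd_triv_left)
qed simp

text \<open>On polynomials in \<open>P j\<close>, \<open>j \<ge> k\<close>, the operator \<open>act 0\<close> is
  \<open>f \<mapsto> f + z\<^sub>1\<^sup>k \<partial>f/\<partial>P\<^sub>k\<close> modulo \<open>z\<^sub>1\<^sup>k\<^sup>+\<^sup>1\<close>.\<close>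

lemma act_0_monomial_first_order:
  fixes m :: monomial
  assumes k: "1 \<le> k" and keys: "Poly_Mapping.keys m \<subseteq> {P j | j. k \<le> j}"
  defines "e \<equiv> Poly_Mapping.lookup m (P k)" and "z \<equiv> Var (Z 1)"
  shows "z ^ Suc k dvd mon_subst (act_var 0) m -
    (monom_poly m + of_nat e * z ^ k * monom_poly (m - Poly_Mapping.single (P k) 1))"
proof -
  let ?A = "Poly_Mapping.keys m - {P k}"
  define q where "q \<sigma> = (\<Prod>v\<in>?A. \<sigma> v ^ Poly_Mapping.lookup m v)" for \<sigma> :: "var \<Rightarrow> mpoly"
  have split: "mon_subst \<sigma> m = \<sigma> (P k) ^ e * q \<sigma>" for \<sigma>
  proof -
    have "mon_subst \<sigma> m = (\<Prod>v\<in>insert (P k) ?A. \<sigma> v ^ Poly_Mapping.lookup m v)"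
      by (rule mon_subst_superset) auto
    also have "\<dots> = \<sigma> (P k) ^ e * q \<sigma>"
      unfolding q_def e_def by (subst prod.insert) simp_all
    finally show ?thesis .
  qed
  \<comment> \<open>For j > k the change z_1^j of \<open>P j\<close> is already 0 modulo
    z_1^(k+1).\<close>
  have "z ^ Suc k dvd act_var 0 v - Var v" if v: "v \<in> ?A" for v
  proof -
    obtain j where j: "v = P j" "k \<le> j" "j \<noteq> k" using v keys by blast
    then have "Suc k \<le> j" by simp
    then show ?thesis using j by (simp add: z_def le_imp_power_dvd del: power_Suc)
  qed
  then have q: "z ^ Suc k dvd q (act_var 0) - q Var"
    unfolding q_def by (intro dvd_diff_prod dvd_diff_power)
  \<comment> \<open>Dividing the monomial by \<open>P k\<close> makes sense only for positive
    \<open>e\<close>; for \<open>e = 0\<close> both sides vanish through the factor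
    \<open>of_nat e\<close>.\<close>
  have e1: "of_nat e * monom_poly (m - Poly_Mapping.single (P k) 1) =
      of_nat e * (Var (P k) ^ (e - 1) * q Var)"
  proof (cases "e = 0")
    case False
    have "Poly_Mapping.single (P k) 1 + (m - Poly_Mapping.single (P k) 1) = m"
      by (rule poly_mapping_eqI)
         (use False in \<open>auto simp: lookup_add lookup_minus lookup_single when_def e_def\<close>)
    then have "Var (P k) * monom_poly (m - Poly_Mapping.single (P k) 1) = Var (P k) ^ e * q Var"
      using monom_poly_add[of "Poly_Mapping.single (P k) 1" "m - Poly_Mapping.single (P k) 1"]
        split[of Var] by (simp add: mon_subst_Var Var_def)
    also have "Var (P k) ^ e = Var (P k) * Var (P k) ^ (e - 1)" using False by (cases e) simp_all
    finally have "Var (P k) * monom_poly (m - Poly_Mapping.single (P k) 1) =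
        Var (P k) * (Var (P k) ^ (e - 1) * q Var)" by (simp only: mult.assoc)
    then show ?thesis using Var_nonzero[of "P k"] by simp
  qed simp
  \<comment> \<open>2k >= k + 1 because k >= 1, so second-order terms disappear.\<close>
  have "z ^ Suc k dvd (z ^ k) ^ 2"
    using k by (simp only: power_mult[symmetric] le_imp_power_dvd)
  then have p: "z ^ Suc k dvd (Var (P k) + z ^ k) ^ e -
      (Var (P k) ^ e + of_nat e * z ^ k * Var (P k) ^ (e - 1))"
    using dvd_power_first_order dvd_trans by blast
  have "z ^ Suc k dvd (Var (P k) + z ^ k) ^ e * q (act_var 0) -
      (Var (P k) ^ e + of_nat e * z ^ k * Var (P k) ^ (e - 1)) * q Var"
    by (rule dvd_diff_mult[OF p q])
  also have "(Var (P k) + z ^ k) ^ e * q (act_var 0) = mon_subst (act_var 0) m"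
    by (simp add: split z_def)
  also have "(Var (P k) ^ e + of_nat e * z ^ k * Var (P k) ^ (e - 1)) * q Var =
      mon_subst Var m + z ^ k * (of_nat e * (Var (P k) ^ (e - 1) * q Var))"
    by (simp only: split) (simp only: distrib_right distrib_left mult_ac)
  also have "\<dots> = monom_poly m + of_nat e * z ^ k * monom_poly (m - Poly_Mapping.single (P k) 1)"
    unfolding e1[symmetric] mon_subst_Var by (simp only: mult_ac)
  finally show ?thesis .
qed

text \<open>By the first-order expansion, invariance makes z_1 divide the partial derivative by
  \<open>P k\<close>. That derivative contains no z_1, so it is 0, and in characteristic 0 this
  excludes \<open>P k\<close> from \<open>f\<close>.\<close>

lemma invariant_no_P:
  assumes k: "1 \<le> k" and f: "f \<in> vars_in {P j | j. k \<le> j}" and inv: "act 0 f = f"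
  shows "P k \<notin> vars_of f"
proof
  assume "P k \<in> vars_of f"
  then obtain m0 where m0: "m0 \<in> Poly_Mapping.keys f" "P k \<in> Poly_Mapping.keys m0"
    by (auto simp: vars_of_def)
  let ?s = "Poly_Mapping.single (P k) (1 :: nat)"
  let ?c = "\<lambda>m. Poly_Mapping.lookup f m"
  let ?e = "\<lambda>m. Poly_Mapping.lookup m (P k)"
  define z where "z = Var (Z 1)"
  \<comment> \<open>The formal partial derivative of \<open>f\<close> with respect to
    \<open>P k\<close>.\<close>
  define g where "g = (\<Sum>m\<in>Poly_Mapping.keys f. Const (?c m * of_nat (?e m)) * monom_poly (m - ?s))"
  have act: "act 0 f = (\<Sum>m\<in>Poly_Mapping.keys f. Const (?c m) * mon_subst (act_var 0) m)"
    unfolding act_def by (rule subst_superset) simp_all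
  have f': "f = (\<Sum>m\<in>Poly_Mapping.keys f. Const (?c m) * monom_poly m)"
    using mpoly_sum_single[of f] by (simp add: single_eq)
  have "act 0 f - (f + z ^ k * g) = (\<Sum>m\<in>Poly_Mapping.keys f. Const (?c m) *
      (mon_subst (act_var 0) m - (monom_poly m + of_nat (?e m) * z ^ k * monom_poly (m - ?s))))"
    by (subst act, subst (2) f')
       (simp add: g_def sum_distrib_left sum.distrib[symmetric] sum_subtractf[symmetric]
          Const_mult Const_of_nat algebra_simps)
  also have "z ^ Suc k dvd \<dots>"
    using act_0_monomial_first_order[OF k] f unfolding z_def vars_in_def
    by (intro dvd_sum dvd_mult) auto
  finally have "z ^ k * z dvd z ^ k * g" using inv by (simp add: mult.commute)
  moreover have "z \<noteq> 0" by (simp add: z_def Var_nonzero)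
  ultimately obtain h where h: "g = z * h" by (auto simp: dvd_def)
  have gv: "g \<in> vars_in {P j | j. k \<le> j}"
    unfolding g_def
  proof (intro vars_in_sum vars_in_mult vars_in_Const)
    fix m assume m: "m \<in> Poly_Mapping.keys f"
    have "Poly_Mapping.keys (m - ?s) \<subseteq> Poly_Mapping.keys m"
      by (auto simp: in_keys_iff lookup_minus)
    then show "monom_poly (m - ?s) \<in> vars_in {P j | j. k \<le> j}"
      using m f by (auto simp: vars_in_def monom_poly_def)
  qed
  \<comment> \<open>Setting z_1 = 0 leaves \<open>g\<close> unchanged but kills
    \<open>z * h\<close>.\<close>
  have "subst (\<lambda>v. if v = Z 1 then 0 else Var v) g = g"
    using gv by (induction rule: mpoly_induct) (auto simp: subst_Const subst_Var subst_add subst_mult)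
  then have "g = 0" using h by (metis (mono_tags, lifting) subst_mult subst_Var z_def mult_zero_left)
  \<comment> \<open>Monomials that contain \<open>P k\<close> stay distinct after division by it, so
    \<open>m0\<close> alone contributes to the coefficient at \<open>m0 - ?s\<close>.\<close>
  have ne: "?c m * of_nat (?e m) * Poly_Mapping.lookup (monom_poly (m - ?s)) (m0 - ?s) =
      (if m = m0 then ?c m0 * of_nat (?e m0) else 0)" if m: "m \<in> Poly_Mapping.keys f" for m
  proof (cases "?e m = 0")
    case False
    have "m = m0" if "m - ?s = m0 - ?s"
    proof -
      have "m - ?s + ?s = m" "m0 - ?s + ?s = m0"
        using False m0
        by (auto intro!: poly_mapping_eqI simp: lookup_add lookup_minus lookup_single when_def in_keys_iff)
      then show ?thesis using that by metis
    qed
    then show ?thesis by (auto simp: monom_poly_def lookup_single when_def)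
  qed (use m0 in \<open>auto simp: in_keys_iff\<close>)
  have "Poly_Mapping.lookup g (m0 - ?s) = (\<Sum>m\<in>Poly_Mapping.keys f. if m = m0 then ?c m0 * of_nat (?e m0) else 0)"
    unfolding g_def lookup_sum lookup_Const_mult by (rule sum.cong[OF refl ne])
  also have "\<dots> = ?c m0 * of_nat (?e m0)" using m0 by simp
  finally show False using \<open>g = 0\<close> m0 by (auto simp: in_keys_iff)
qed

lemma invariant_Const:
  assumes f: "f \<in> zp_ring" and inv: "\<And>i. act i f = f"
  shows "\<exists>c. f = Const c"
proof -
  have V: "vars_of f \<subseteq> {P k | k. odd k}"
    using f invariant_no_Z[OF inv] by (auto simp: zp_ring_eq vars_in_iff)
  have "vars_of f = {}"
  proof (rule ccontr)
    assume ne: "vars_of f \<noteq> {}"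
    \<comment> \<open>With the smallest index, all power sums in \<open>f\<close> have index at
      least \<open>k\<close>, as \<open>invariant_no_P\<close> requires.\<close>
    define k where "k = (LEAST k. P k \<in> vars_of f)"
    have "\<exists>k. P k \<in> vars_of f" using ne V by blast
    then have k: "P k \<in> vars_of f" and least: "\<And>j. P j \<in> vars_of f \<Longrightarrow> k \<le> j"
      unfolding k_def by (auto intro: LeastI_ex Least_le)
    have "odd k" using k V by blast
    then have "1 \<le> k" by (cases k) auto
    moreover have "f \<in> vars_in {P j | j. k \<le> j}"
      unfolding vars_in_iff
    proof
      fix v assume v: "v \<in> vars_of f"
      then obtain j where "v = P j" using V by blast
      then show "v \<in> {P j | j. k \<le> j}" using least v by blast
    qed
    ultimately show False using invariant_no_P inv k by blast
  qed
  then have "f \<in> vars_in {}" by (simp add: vars_in_iff)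
  then show ?thesis
    by (induction rule: mpoly_induct) (auto simp: Const_add[symmetric] Const_mult[symmetric])
qed

section \<open>The nilCoxeter algebra\<close>

type_synonym coeff_fun = "(int \<Rightarrow> int) \<Rightarrow> mpoly"

text \<open>An element \<open>\<Sum>\<^sub>w f\<^sub>w T\<^sub>w\<close> of the nilCoxeter algebra is its coefficient function \<open>f\<close>, and
  right multiplications are linear operators on such functions.\<close>

definition linop :: "(coeff_fun \<Rightarrow> coeff_fun) \<Rightarrow> bool" where
  "linop T \<longleftrightarrow> (\<forall>f g. T (\<lambda>w. f w + g w) = (\<lambda>w. T f w + T g w)) \<and>
     (\<forall>c f. T (\<lambda>w. c * f w) = (\<lambda>w. c * T f w))"

typedef op = "{T. linop T}" morphisms app Op
  by (rule exI[of _ "\<lambda>f. f"]) (simp add: linop_def)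

lemma linop_app: "linop (app T)"
  using app[of T] by simp

lemma app_Op: "linop T \<Longrightarrow> app (Op T) = T"
  by (simp add: Op_inverse)

lemma op_eqI: "(\<And>f w. app S f w = app T f w) \<Longrightarrow> S = T"
  by (metis app_inject ext)

lemma app_add_fun: "app T (\<lambda>w. f w + g w) = (\<lambda>w. app T f w + app T g w)"
  and app_mult_fun: "app T (\<lambda>w. c * f w) = (\<lambda>w. c * app T f w)"
  using linop_app[of T] by (simp_all add: linop_def)

text \<open>The product is reversed composition, because operators act as right multiplications.\<close>

instantiation op :: ring_1
begin

definition zero_op where "0 = Op (\<lambda>f w. 0)"

definition one_op where "1 = Op (\<lambda>f. f)"

definition plus_op where "S + T = Op (\<lambda>f w. app S f w + app T f w)"

definition minus_op where "S - T = Op (\<lambda>f w. app S f w - app T f w)"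

definition uminus_op where "- T = Op (\<lambda>f w. - app T f w)"

definition times_op where "S * T = Op (\<lambda>f. app T (app S f))"

lemma app_simps:
  "app 0 f w = 0" "app 1 f = f" "app (S + T) f w = app S f w + app T f w"
  "app (S - T) f w = app S f w - app T f w" "app (- T) f w = - app T f w"
  "app (S * T) f = app T (app S f)"
  unfolding zero_op_def one_op_def plus_op_def minus_op_def uminus_op_def times_op_def
  by (subst app_Op; simp add: linop_def app_add_fun app_mult_fun algebra_simps)+

lemma app_plus: "app (S + T) f = (\<lambda>w. app S f w + app T f w)"
  by (simp add: fun_eq_iff app_simps)

instance
proof
  fix a b c :: op
  show "a + b + c = a + (b + c)" "a + b = b + a" "0 + a = a" "- a + a = 0" "a - b = a + - b"
    "(a + b) * c = a * c + b * c" "a * (b + c) = a * b + a * c"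
    "a * b * c = a * (b * c)" "1 * a = a" "a * 1 = a"
    by (rule op_eqI; simp add: app_simps app_plus app_add_fun)+
  show "(0 :: op) \<noteq> 1"
  proof
    assume "(0 :: op) = 1"
    then have "app 0 (\<lambda>w. 1) id = app 1 (\<lambda>w. 1) id" by simp
    then show False by (simp add: app_simps)
  qed
qed

end

lemma app_sum: "app (\<Sum>i\<in>A. T i) f w = (\<Sum>i\<in>A. app (T i) f w)"
  by (induction A rule: infinite_finite_induct) (simp_all add: app_simps)

definition sc :: "mpoly \<Rightarrow> op" where
  "sc x = Op (\<lambda>f w. x * f w)"

lemma app_sc: "app (sc x) f w = x * f w"
  unfolding sc_def by (subst app_Op) (auto simp: linop_def algebra_simps)

lemma app_sc_mult: "app (T * sc x) f w = x * app T f w"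
  by (simp add: app_simps app_sc)

lemma sc_simps:
  "sc 0 = 0" "sc 1 = 1" "sc (x + y) = sc x + sc y" "sc (x * y) = sc x * sc y" "sc (- x) = - sc x"
  by (rule op_eqI; simp add: app_simps app_sc algebra_simps)+

text \<open>Operators are linear over the polynomial ring, so its elements act as central
  scalars.\<close>

lemma sc_comm: "T * sc x = sc x * T"
proof (rule op_eqI)
  fix f :: coeff_fun and w :: "int \<Rightarrow> int"
  have "app (sc x) f = (\<lambda>w. x * f w)" by (simp add: fun_eq_iff app_sc)
  then show "app (T * sc x) f w = app (sc x * T) f w"
    by (simp add: app_simps app_sc app_mult_fun)
qed

lemma sc_sum: "sc (\<Sum>i\<in>A. x i) = (\<Sum>i\<in>A. sc (x i))"
  by (induction A rule: infinite_finite_induct) (simp_all add: sc_simps)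

section \<open>Generators of the nilCoxeter algebra and their relations\<close>

definition nil_u :: "nat \<Rightarrow> op" where
  "nil_u i = Op (\<lambda>f w. if w \<in> BC_inf \<and> desc w i then f (w \<circ> sgen i) else 0)"

lemma app_nil_u: "app (nil_u i) f w = (if w \<in> BC_inf \<and> desc w i then f (w \<circ> sgen i) else 0)"
  unfolding nil_u_def by (subst app_Op) (auto simp: linop_def fun_eq_iff)

text \<open>Right multiplication by \<open>sgen i\<close> toggles the descent at \<open>i\<close>
  for signed permutations; the guard \<open>w \<in> BC_inf\<close> in \<open>nil_u\<close> makes
  this available.\<close>

lemma nil_u_square: "nil_u i * nil_u i = 0"
  by (rule op_eqI) (simp add: app_simps app_nil_u comp_sgen_BC_inf_iff desc_comp_sgen)

lemma sgen_below: "\<bar>a\<bar> < int j \<Longrightarrow> sgen j a = a"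
  by (auto simp: sgen_apply)

lemma sgen_moved:
  assumes "sgen i a \<noteq> a"
  shows "\<bar>sgen i a\<bar> \<le> int i + 1 \<and> \<bar>a\<bar> \<le> int i + 1"
proof (cases "i = 0")
  case True
  then have "a = 1 \<or> a = - 1" using assms by (metis sgen_apply)
  then show ?thesis using True by (elim disjE) (simp_all add: sgen_apply)
next
  case False
  then have "a = int i \<or> a = int i + 1 \<or> a = - int i \<or> a = - int i - 1"
    using assms by (metis sgen_apply)
  then show ?thesis using False by (elim disjE) (simp_all add: sgen_apply)
qed

lemma sgen_above: "int j + 1 < \<bar>a\<bar> \<Longrightarrow> sgen j a = a"
  using sgen_moved[of j a] by linarith

lemma sgen_large: "int j \<le> \<bar>a\<bar> \<Longrightarrow> int j \<le> \<bar>sgen j a\<bar>"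
  using sgen_below[of "sgen j a" j] by (cases "\<bar>sgen j a\<bar> < int j") (simp_all add: sgen_sgen)

lemma desc_comp_sgen_far:
  assumes "i + 2 \<le> j \<or> j + 2 \<le> i"
  shows "desc (w \<circ> sgen j) i \<longleftrightarrow> desc w i"
proof (cases "i = 0")
  case True
  then have "sgen j 1 = 1" using assms by (intro sgen_below) simp
  then show ?thesis using True by (simp add: desc_def)
next
  case False
  have "sgen j (int i) = int i \<and> sgen j (int i + 1) = int i + 1"
    using assms
  proof
    assume "i + 2 \<le> j"
    then show ?thesis by (intro conjI sgen_below) simp_all
  next
    assume "j + 2 \<le> i"
    then show ?thesis by (intro conjI sgen_above) simp_all
  qed
  then show ?thesis using False by (simp add: desc_def)
qed

lemma sgen_comm_far: assumes "i + 2 \<le> j" shows "sgen i \<circ> sgen j = sgen j \<circ> sgen i"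
proof
  fix a
  show "(sgen i \<circ> sgen j) a = (sgen j \<circ> sgen i) a"
  proof (cases "\<bar>a\<bar> < int j")
    case True
    moreover have "int i + 2 \<le> int j" using assms by linarith
    ultimately have "\<bar>sgen i a\<bar> < int j" using sgen_moved[of i a] by linarith
    then show ?thesis using True by (simp add: sgen_below)
  next
    case False
    then have "int j \<le> \<bar>sgen j a\<bar>" by (intro sgen_large) linarith
    moreover have "int i + 1 < int j" using assms by linarith
    ultimately show ?thesis using False sgen_above[of i a] sgen_above[of i "sgen j a"] by simp
  qed
qed

lemma nil_u_comm:
  assumes "i + 2 \<le> j" shows "nil_u i * nil_u j = nil_u j * nil_u i"
proof (rule op_eqI)
  fix f :: coeff_fun and w :: "int \<Rightarrow> int"
  have "w \<circ> sgen i \<circ> sgen j = w \<circ> sgen j \<circ> sgen i"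
    using sgen_comm_far[OF assms] by (metis comp_assoc)
  then show "app (nil_u i * nil_u j) f w = app (nil_u j * nil_u i) f w"
    using desc_comp_sgen_far[of i j w] desc_comp_sgen_far[of j i w] assms
    by (simp add: app_simps app_nil_u comp_sgen_BC_inf_iff)
qed

lemma app_nil_u3:
  "app (nil_u i * nil_u j * nil_u k) f w = (if w \<in> BC_inf \<and> desc w k \<and> desc (w \<circ> sgen k) j \<and>
     desc (w \<circ> sgen k \<circ> sgen j) i then f (w \<circ> sgen k \<circ> sgen j \<circ> sgen i) else 0)"
  by (simp add: app_simps app_nil_u comp_sgen_BC_inf_iff)

lemma sgen_braid:
  assumes "1 \<le> i"
  shows "sgen i \<circ> sgen (Suc i) \<circ> sgen i = sgen (Suc i) \<circ> sgen i \<circ> sgen (Suc i)"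
proof
  fix a
  have "sgen i a = a \<and> sgen (Suc i) a = a"
    if "a \<noteq> int i" "a \<noteq> int i + 1" "a \<noteq> int i + 2" "a \<noteq> - int i" "a \<noteq> - int i - 1" "a \<noteq> - int i - 2"
    using assms that by (simp add: sgen_apply)
  then consider "a = int i" | "a = int i + 1" | "a = int i + 2" | "a = - int i" | "a = - int i - 1"
    | "a = - int i - 2" | "sgen i a = a \<and> sgen (Suc i) a = a"
    by blast
  then show "(sgen i \<circ> sgen (Suc i) \<circ> sgen i) a = (sgen (Suc i) \<circ> sgen i \<circ> sgen (Suc i)) a"
    by cases (use assms in \<open>simp_all add: sgen_apply\<close>)
qed

text \<open>Along either word the three descent conditions together say w(i) > w(i+1) >
  w(i+2).\<close>

lemma nil_u_braid:
  assumes "1 \<le> i"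
  shows "nil_u i * nil_u (Suc i) * nil_u i = nil_u (Suc i) * nil_u i * nil_u (Suc i)"
proof (rule op_eqI)
  fix f :: coeff_fun and w :: "int \<Rightarrow> int"
  have "w \<circ> sgen i \<circ> sgen (Suc i) \<circ> sgen i = w \<circ> sgen (Suc i) \<circ> sgen i \<circ> sgen (Suc i)"
    using sgen_braid[OF assms] by (metis comp_assoc)
  moreover have "desc w i \<and> desc (w \<circ> sgen i) (Suc i) \<and> desc (w \<circ> sgen i \<circ> sgen (Suc i)) i \<longleftrightarrow>
      desc w (Suc i) \<and> desc (w \<circ> sgen (Suc i)) i \<and> desc (w \<circ> sgen (Suc i) \<circ> sgen i) (Suc i)"
    using assms by (auto simp: desc_def sgen_apply add.commute)
  ultimately show "app (nil_u i * nil_u (Suc i) * nil_u i) f w = app (nil_u (Suc i) * nil_u i * nil_u (Suc i)) f w"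
    unfolding app_nil_u3 by presburger
qed

lemma sgen_braid4:
  "sgen 0 \<circ> sgen 1 \<circ> sgen 0 \<circ> sgen 1 = sgen 1 \<circ> sgen 0 \<circ> sgen 1 \<circ> sgen 0"
proof
  fix a
  have "sgen 0 a = a \<and> sgen 1 a = a" if "a \<noteq> 1" "a \<noteq> 2" "a \<noteq> - 1" "a \<noteq> - 2"
    using that by (simp add: sgen_apply)
  then consider "a = 1" | "a = 2" | "a = - 1" | "a = - 2" | "sgen 0 a = a \<and> sgen 1 a = a"
    by blast
  then show "(sgen 0 \<circ> sgen 1 \<circ> sgen 0 \<circ> sgen 1) a = (sgen 1 \<circ> sgen 0 \<circ> sgen 1 \<circ> sgen 0) a"
    by cases (simp_all add: sgen_apply)
qed

text \<open>Along either word the four descent conditions together say w(2) < w(1) < 0.\<close>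

lemma nil_u_braid4: "nil_u 0 * nil_u 1 * nil_u 0 * nil_u 1 = nil_u 1 * nil_u 0 * nil_u 1 * nil_u 0"
proof (rule op_eqI)
  fix f :: coeff_fun and w :: "int \<Rightarrow> int"
  have w4: "w \<circ> sgen 1 \<circ> sgen 0 \<circ> sgen 1 \<circ> sgen 0 = w \<circ> sgen 0 \<circ> sgen 1 \<circ> sgen 0 \<circ> sgen 1"
    using sgen_braid4 by (metis comp_assoc)
  have "desc w 1 \<and> desc (w \<circ> sgen 1) 0 \<and> desc (w \<circ> sgen 1 \<circ> sgen 0) 1 \<and>
        desc (w \<circ> sgen 1 \<circ> sgen 0 \<circ> sgen 1) 0 \<longleftrightarrow>
      desc w 0 \<and> desc (w \<circ> sgen 0) 1 \<and> desc (w \<circ> sgen 0 \<circ> sgen 1) 0 \<and>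
        desc (w \<circ> sgen 0 \<circ> sgen 1 \<circ> sgen 0) 1" if w: "w \<in> BC_inf"
  proof -
    obtain n where n: "w \<in> BC n" using w by (auto simp: BC_inf_def)
    have "w (- 1) = - w 1" "w (- 2) = - w 2" using BC_minus[OF n] by (metis, metis)
    then show ?thesis by (auto simp: desc_def sgen_apply)
  qed
  then show "app (nil_u 0 * nil_u 1 * nil_u 0 * nil_u 1) f w = app (nil_u 1 * nil_u 0 * nil_u 1 * nil_u 0) f w"
    by (auto simp: app_simps app_nil_u comp_sgen_BC_inf_iff w4[unfolded One_nat_def])
qed

text \<open>The power series variable records the length grading.\<close>

definition scal :: "mpoly \<Rightarrow> op fps" where
  "scal x = fps_const (sc x)"

definition nil_v :: "nat \<Rightarrow> op fps" where
  "nil_v i = fps_const (nil_u i) * fps_X"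

definition H_fps :: "nat \<Rightarrow> mpoly \<Rightarrow> op fps" where
  "H_fps i x = 1 + scal x * nil_v i"

lemma scal_simps:
  "scal 0 = 0" "scal 1 = 1" "scal (x + y) = scal x + scal y" "scal (x * y) = scal x * scal y" "scal (- x) = - scal x"
  unfolding scal_def sc_simps fps_const_add[symmetric] fps_const_mult[symmetric] fps_const_neg[symmetric]
  by simp_all

lemma scal_comm: "F * scal x = scal x * F"
  by (rule fps_ext) (simp add: scal_def sc_comm)

lemma nil_v_mult_const: "nil_v i * (fps_const a * fps_X ^ n) = fps_const (nil_u i * a) * fps_X ^ Suc n"
proof -
  have "nil_v i * (fps_const a * fps_X ^ n) = fps_const (nil_u i) * (fps_X * (fps_const a * fps_X ^ n))"
    by (simp only: nil_v_def mult.assoc)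
  also have "\<dots> = fps_const (nil_u i) * ((fps_const a * fps_X ^ n) * fps_X)"
    by (simp only: fps_mult_fps_X_commute)
  also have "\<dots> = (fps_const (nil_u i) * fps_const a) * (fps_X ^ n * fps_X)"
    by (simp only: mult.assoc)
  finally show ?thesis by (simp only: fps_const_mult power_Suc2)
qed

lemma nil_v_mult: "nil_v i * nil_v j = fps_const (nil_u i * nil_u j) * fps_X ^ 2"
  using nil_v_mult_const[of i "nil_u j" 1] by (simp only: nil_v_def power_one_right Suc_1)

lemma nil_v_square: "nil_v i * nil_v i = 0"
  by (simp add: nil_v_mult nil_u_square)

lemma nil_v_comm: "i + 2 \<le> j \<Longrightarrow> nil_v i * nil_v j = nil_v j * nil_v i"
  using nil_u_comm[of i j] by (simp only: nil_v_mult)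

lemma nil_v_braid: "1 \<le> i \<Longrightarrow> nil_v i * nil_v (Suc i) * nil_v i = nil_v (Suc i) * nil_v i * nil_v (Suc i)"
  unfolding mult.assoc
  by (simp only: nil_v_mult nil_v_mult_const) (simp only: mult.assoc[symmetric] nil_u_braid)

lemma nil_v_braid4: "nil_v 0 * nil_v 1 * nil_v 0 * nil_v 1 = nil_v 1 * nil_v 0 * nil_v 1 * nil_v 0"
  unfolding mult.assoc
  by (simp only: nil_v_mult nil_v_mult_const) (simp only: mult.assoc[symmetric] nil_u_braid4)

lemma nil_v_scal: "nil_v i * scal x = scal x * nil_v i" "nil_v i * (scal x * G) = scal x * (nil_v i * G)"
proof -
  show *: "nil_v i * scal x = scal x * nil_v i" by (rule scal_comm)
  show "nil_v i * (scal x * G) = scal x * (nil_v i * G)" using * by (metis mult.assoc)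
qed

section \<open>Yang-Baxter equations\<close>

lemma H_mult_expand:
  "H_fps i x * H_fps j y = 1 + scal x * nil_v i + scal y * nil_v j + scal (x * y) * (nil_v i * nil_v j)"
  by (simp add: H_fps_def distrib_left distrib_right scal_simps mult.assoc nil_v_scal add_ac)

lemma H_add: "H_fps i x * H_fps i y = H_fps i (x + y)"
  unfolding H_mult_expand by (simp add: nil_v_square H_fps_def scal_simps distrib_right add.assoc)

lemma H_0: "H_fps i 0 = 1"
  by (simp add: H_fps_def scal_simps)

lemma H_inverse: "H_fps i x * H_fps i (- x) = 1" "H_fps i (- x) * H_fps i x = 1"
  by (simp_all add: H_add H_0)

lemma H_comm: "i + 2 \<le> j \<or> j + 2 \<le> i \<Longrightarrow> H_fps i x * H_fps j y = H_fps j y * H_fps i x"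
  using nil_v_comm[of i j] nil_v_comm[of j i] unfolding H_mult_expand by (auto simp: mult.commute add_ac)

text \<open>Only alternating words survive \<open>nil_v_square\<close>. Setting \<open>d = 0\<close>
  leaves three factors, so one expansion serves both Yang-Baxter equations.\<close>

lemma H4_expand:
  "H_fps i a * H_fps j b * H_fps i c * H_fps j d = 1 + scal (a + c) * nil_v i + scal (b + d) * nil_v j +
     scal (a * b + a * d + c * d) * (nil_v i * nil_v j) + scal (b * c) * (nil_v j * nil_v i) +
     scal (a * b * c) * (nil_v i * nil_v j * nil_v i) + scal (b * c * d) * (nil_v j * nil_v i * nil_v j) +
     scal (a * b * c * d) * (nil_v i * nil_v j * nil_v i * nil_v j)"
proof -
  have z: "nil_v k * (nil_v k * F) = 0" for k F by (simp add: mult.assoc[symmetric] nil_v_square)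
  show ?thesis
    by (simp add: H_fps_def distrib_left distrib_right scal_simps mult.assoc nil_v_scal nil_v_square z add_ac)
qed

text \<open>The Yang-Baxter equation of type A. The middle parameter is the sum of the others so
  that each generator has the coefficient x + y on both sides; the cubic terms agree by the braid
  relation.\<close>

lemma H_braid:
  assumes "1 \<le> i"
  shows "H_fps i x * H_fps (Suc i) (x + y) * H_fps i y = H_fps (Suc i) y * H_fps i (x + y) * H_fps (Suc i) x"
  using H4_expand[of i x "Suc i" "x + y" y 0] H4_expand[of "Suc i" y i "x + y" x 0] nil_v_braid[OF assms]
  by (simp add: H_0 scal_simps algebra_simps)

text \<open>The Yang-Baxter equation of type B. The quadratic terms agree by \<open>e1\<close> and
  \<open>e2\<close>, the quartic ones by the braid relation of length 4.\<close>

lemma H_braid4: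
  "H_fps 1 (x - y) * H_fps 0 (x + x) * H_fps 1 (x + y) * H_fps 0 (y + y) =
   H_fps 0 (y + y) * H_fps 1 (x + y) * H_fps 0 (x + x) * H_fps 1 (x - y)"
proof -
  have e1: "(x - y) * (x + x) + (x - y) * (y + y) + (x + y) * (y + y) = (x + y) * (x + x)"
    and e2: "(y + y) * (x + y) + (y + y) * (x - y) + (x + x) * (x - y) = (x + x) * (x + y)"
    by (simp_all add: algebra_simps)
  have e3: "(x + y) * (x + x) * (x - y) * (y + y) = (y + y) * (x + y) * (x + x) * (x - y)"
    and e4: "(x - y) * (x + x) * (x + y) = (x + y) * (x + x) * (x - y)"
    and e5: "(x + x) * (x + y) * (y + y) = (y + y) * (x + y) * (x + x)"
    and e6: "x - y + (x + y) = x + y + (x - y)"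
    and e7: "x + x + (y + y) = y + y + (x + x)"
    by (simp_all only: mult_ac add.commute)
  show ?thesis
    unfolding H4_expand by (simp only: e1 e2 e3 e4 e5 e6 e7 nil_v_braid4) (simp only: add_ac)
qed

lemma inverse_commute:
  fixes a :: "'a :: monoid_mult"
  assumes "a * b = b * a" "b * c = 1" "c * b = 1"
  shows "a * c = c * a"
proof -
  have "a * c = c * (b * a) * c" using assms(3) by (simp add: mult.assoc[symmetric])
  also have "\<dots> = c * (a * b) * c" by (simp only: assms(1))
  also have "\<dots> = c * a" using assms(2) by (simp add: mult.assoc)
  finally show ?thesis .
qed

section \<open>Row products A(x) and their commutation\<close>

definition A_fps :: "nat \<Rightarrow> nat \<Rightarrow> mpoly \<Rightarrow> op fps" where
  "A_fps N i x = prod_list (map (\<lambda>j. H_fps j x) (rev [i..<Suc N]))"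

definition A_fps' :: "nat \<Rightarrow> nat \<Rightarrow> mpoly \<Rightarrow> op fps" where
  "A_fps' N i x = prod_list (map (\<lambda>j. H_fps j x) [i..<Suc N])"

lemma A_rec: "i \<le> N \<Longrightarrow> A_fps N i x = A_fps N (Suc i) x * H_fps i x"
  unfolding A_fps_def by (subst upt_conv_Cons) simp_all

lemma A'_rec: "i \<le> N \<Longrightarrow> A_fps' N i x = H_fps i x * A_fps' N (Suc i) x"
  unfolding A_fps'_def by (subst upt_conv_Cons) simp_all

lemma A_empty: "N < i \<Longrightarrow> A_fps N i x = 1"
  by (simp add: A_fps_def)

lemma A'_empty: "N < i \<Longrightarrow> A_fps' N i x = 1"
  by (simp add: A_fps'_def)

lemma A_induct [case_names empty step]:
  assumes "\<And>i. N < i \<Longrightarrow> Q i" "\<And>i. i \<le> N \<Longrightarrow> Q (Suc i) \<Longrightarrow> Q i"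
  shows "Q i"
proof (induction "Suc N - i" arbitrary: i)
  case 0
  then show ?case using assms(1) by simp
next
  case (Suc d)
  then show ?case using assms(2)[of i] by simp
qed

text \<open>The factors come in opposite order with opposite sign, so they cancel in pairs.\<close>

lemma A_A'_inverse: "A_fps N i (- x) * A_fps' N i x = 1 \<and> A_fps' N i x * A_fps N i (- x) = 1"
proof (induction i rule: A_induct[where N = N])
  case (empty i)
  then show ?case by (simp add: A_empty A'_empty)
next
  case (step i)
  have "A_fps N i (- x) * A_fps' N i x = A_fps N (Suc i) (- x) * (H_fps i (- x) * H_fps i x) * A_fps' N (Suc i) x"
    using step(1) by (simp only: A_rec A'_rec mult.assoc)
  moreover have "A_fps' N i x * A_fps N i (- x) = H_fps i x * (A_fps' N (Suc i) x * A_fps N (Suc i) (- x)) * H_fps i (- x)"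
    using step(1) by (simp only: A_rec A'_rec mult.assoc)
  ultimately show ?case using step by (simp add: H_inverse)
qed

lemma H_A_comm: "j + 2 \<le> i \<Longrightarrow> H_fps j y * A_fps N i x = A_fps N i x * H_fps j y"
proof (induction i rule: A_induct[where N = N])
  case (empty i)
  then show ?case by (simp add: A_empty)
next
  case (step i)
  have "H_fps j y * A_fps N i x = (H_fps j y * A_fps N (Suc i) x) * H_fps i x"
    using step(1) by (simp only: A_rec mult.assoc)
  also have "H_fps j y * A_fps N (Suc i) x = A_fps N (Suc i) x * H_fps j y" using step by simp
  also have "A_fps N (Suc i) x * H_fps j y * H_fps i x = A_fps N (Suc i) x * (H_fps i x * H_fps j y)"
    using step(3) H_comm[of i j x y] by (simp add: mult.assoc)
  also have "\<dots> = A_fps N i x * H_fps j y"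
    using step(1) by (simp only: A_rec mult.assoc)
  finally show ?case .
qed

lemma H_A'_comm:
  assumes "j + 2 \<le> i" shows "H_fps j y * A_fps' N i x = A_fps' N i x * H_fps j y"
  using inverse_commute[OF H_A_comm[OF assms]] A_A'_inverse by blast

text \<open>The two sides differ by exchanging \<open>x\<close> and \<open>y\<close>: the
  commutation of A(x) and A(y) reduces to this symmetry.\<close>

lemma H_exchange:
  assumes "1 \<le> i"
  shows "H_fps (Suc i) (- y) * H_fps i x * H_fps (Suc i) y * H_fps i y =
    H_fps (Suc i) (- x) * H_fps i y * H_fps (Suc i) x * H_fps i x"
proof -
  have b: "H_fps (Suc i) (x - y) * H_fps i x * H_fps (Suc i) y = H_fps i y * H_fps (Suc i) x * H_fps i (x - y)"
    using H_braid[OF assms, of y "x - y"] by simp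
  have "H_fps (Suc i) (- y) * H_fps i x * H_fps (Suc i) y * H_fps i y =
      H_fps (Suc i) (- x) * (H_fps (Suc i) (x - y) * H_fps i x * H_fps (Suc i) y) * H_fps i y"
    using H_add[of "Suc i" "- x" "x - y"] by (simp add: mult.assoc[symmetric])
  also have "\<dots> = H_fps (Suc i) (- x) * H_fps i y * H_fps (Suc i) x * (H_fps i (x - y) * H_fps i y)"
    by (simp only: b) (simp only: mult.assoc)
  finally show ?thesis by (simp add: H_add)
qed

text \<open>Descending induction on \<open>i\<close>. Writing A_(i+2)(y) as A_(i+1)(y) h_(i+1)(-y)
  and moving it past h_i(x) leaves A_(i+1)(x) A_(i+1)(y), symmetric by induction, times the
  symmetric expression of \<open>H_exchange\<close>.\<close>

lemma A_comm: "1 \<le> i \<Longrightarrow> A_fps N i x * A_fps N i y = A_fps N i y * A_fps N i x"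
proof (induction i arbitrary: x y rule: A_induct[where N = N])
  case (empty i)
  then show ?case by (simp add: A_empty)
next
  case (step i)
  show ?case
  proof (cases "i = N")
    case True
    then show ?thesis by (simp add: A_rec A_empty H_add add.commute)
  next
    case False
    then have le: "Suc i \<le> N" using step by simp
    have *: "A_fps N i x * A_fps N i y = A_fps N (Suc i) x * A_fps N (Suc i) y *
        (H_fps (Suc i) (- y) * H_fps i x * H_fps (Suc i) y * H_fps i y)" for x y
    proof -
      have D: "A_fps N (Suc (Suc i)) y = A_fps N (Suc i) y * H_fps (Suc i) (- y)"
        using le by (simp add: A_rec mult.assoc H_inverse)
      have "A_fps N i x * A_fps N i y =
          A_fps N (Suc i) x * (H_fps i x * A_fps N (Suc (Suc i)) y) * H_fps (Suc i) y * H_fps i y"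
        using step(1) le by (simp only: A_rec mult.assoc)
      also have "\<dots> = A_fps N (Suc i) x * (A_fps N (Suc (Suc i)) y * H_fps i x) * H_fps (Suc i) y * H_fps i y"
        by (simp add: H_A_comm)
      finally show ?thesis by (simp only: D mult.assoc)
    qed
    show ?thesis
      using *[of x y] *[of y x] H_exchange[OF step.prems, of y x] step by simp
  qed
qed

section \<open>The commuting elements C(x)\<close>

definition C_fps :: "nat \<Rightarrow> mpoly \<Rightarrow> op fps" where
  "C_fps N x = A_fps N 1 x * H_fps 0 (x + x) * A_fps' N 1 x"

lemma C_inverse: "C_fps N x * C_fps N (- x) = 1"
proof -
  have "C_fps N x * C_fps N (- x) =
      A_fps N 1 x * (H_fps 0 (x + x) * ((A_fps' N 1 x * A_fps N 1 (- x)) * H_fps 0 (- x + - x))) * A_fps' N 1 (- x)"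
    by (simp only: C_fps_def mult.assoc)
  also have "\<dots> = A_fps N 1 x * (H_fps 0 (x + x) * H_fps 0 (- (x + x))) * A_fps' N 1 (- x)"
    using A_A'_inverse[of N 1 x] by simp
  also have "\<dots> = 1" using A_A'_inverse[of N 1 "- x"] by (simp add: H_inverse)
  finally show ?thesis .
qed

lemma A_A'_comm: "1 \<le> i \<Longrightarrow> A_fps N i y * A_fps' N i x = A_fps' N i x * A_fps N i y"
  by (rule inverse_commute[OF A_comm]) (use A_A'_inverse in blast)+

lemma A'_comm: "1 \<le> i \<Longrightarrow> A_fps' N i y * A_fps' N i x = A_fps' N i x * A_fps' N i y"
  using inverse_commute[of "A_fps' N i y" "A_fps N i (- x)" "A_fps' N i x"] A_A'_comm[of i N "- x" y]
    A_A'_inverse[of N i x] by simp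

text \<open>The counterpart of \<open>H_exchange\<close> in type B: again a symmetry in
  \<open>x\<close> and \<open>y\<close>.\<close>

lemma H4_exchange:
  "H_fps 1 (- y) * H_fps 0 (x + x) * H_fps 1 (x + y) * H_fps 0 (y + y) * H_fps 1 (- x) =
   H_fps 1 (- x) * H_fps 0 (y + y) * H_fps 1 (x + y) * H_fps 0 (x + x) * H_fps 1 (- y)"
proof -
  have "H_fps 1 (- y) * H_fps 0 (x + x) * H_fps 1 (x + y) * H_fps 0 (y + y) * H_fps 1 (- x) =
      H_fps 1 (- x) * (H_fps 1 (x - y) * H_fps 0 (x + x) * H_fps 1 (x + y) * H_fps 0 (y + y)) * H_fps 1 (- x)"
    using H_add[of 1 "- x" "x - y"] by (simp add: mult.assoc[symmetric])
  also have "\<dots> = H_fps 1 (- x) * H_fps 0 (y + y) * H_fps 1 (x + y) * H_fps 0 (x + x) * (H_fps 1 (x - y) * H_fps 1 (- x))"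
    by (simp only: H_braid4) (simp only: mult.assoc)
  also have "H_fps 1 (x - y) * H_fps 1 (- x) = H_fps 1 (- y)" by (simp add: H_add)
  finally show ?thesis .
qed

text \<open>Only h_1 obstructs the passage of h_0 through a row product, so h_0 moves at the cost of
  a conjugation by h_1. What remains is the symmetric expression of \<open>H4_exchange\<close>
  between commuting row products.\<close>

lemma C_comm:
  assumes "1 \<le> N"
  shows "C_fps N x * C_fps N y = C_fps N y * C_fps N x"
proof -
  have *: "C_fps N x * C_fps N y = A_fps N 1 x * A_fps N 1 y *
      (H_fps 1 (- y) * H_fps 0 (x + x) * H_fps 1 (x + y) * H_fps 0 (y + y) * H_fps 1 (- x)) * (A_fps' N 1 x * A_fps' N 1 y)" for x y
  proof -
    have r: "A_fps N 1 y = A_fps N 2 y * H_fps 1 y" "A_fps' N 1 x = H_fps 1 x * A_fps' N 2 x"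
      using A_rec[OF assms] A'_rec[OF assms] by (simp_all add: numeral_2_eq_2)
    have l: "H_fps 0 (x + x) * A_fps N 1 y = A_fps N 1 y * (H_fps 1 (- y) * H_fps 0 (x + x) * H_fps 1 y)"
    proof -
      have "H_fps 0 (x + x) * A_fps N 1 y = (H_fps 0 (x + x) * A_fps N 2 y) * H_fps 1 y" by (simp only: r mult.assoc)
      also have "\<dots> = A_fps N 2 y * (H_fps 1 y * H_fps 1 (- y)) * H_fps 0 (x + x) * H_fps 1 y"
        by (simp add: H_A_comm H_inverse)
      finally show ?thesis by (simp only: r mult.assoc)
    qed
    have m: "A_fps' N 1 x * H_fps 0 (y + y) = H_fps 1 x * H_fps 0 (y + y) * H_fps 1 (- x) * A_fps' N 1 x"
    proof -
      have "A_fps' N 1 x * H_fps 0 (y + y) = H_fps 1 x * (H_fps 0 (y + y) * A_fps' N 2 x)"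
        by (simp only: r mult.assoc H_A'_comm)
      also have "\<dots> = H_fps 1 x * H_fps 0 (y + y) * (H_fps 1 (- x) * H_fps 1 x) * A_fps' N 2 x"
        by (simp add: H_inverse mult.assoc)
      finally show ?thesis by (simp only: r mult.assoc)
    qed
    have "C_fps N x * C_fps N y =
        A_fps N 1 x * (H_fps 0 (x + x) * (A_fps' N 1 x * A_fps N 1 y)) * (H_fps 0 (y + y) * A_fps' N 1 y)"
      by (simp only: C_fps_def mult.assoc)
    also have "\<dots> = A_fps N 1 x * (H_fps 0 (x + x) * A_fps N 1 y) * (A_fps' N 1 x * H_fps 0 (y + y)) * A_fps' N 1 y"
      by (simp only: A_A'_comm[symmetric, where i = 1 and N = N and y = y and x = x] order_refl) (simp only: mult.assoc)
    also have "\<dots> = A_fps N 1 x * A_fps N 1 y * (H_fps 1 (- y) * H_fps 0 (x + x) * (H_fps 1 y * H_fps 1 x) *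
        H_fps 0 (y + y) * H_fps 1 (- x)) * (A_fps' N 1 x * A_fps' N 1 y)"
      by (simp only: l m) (simp only: mult.assoc)
    finally show ?thesis by (simp only: H_add add.commute[of y x])
  qed
  show ?thesis
    using *[of x y] *[of y x] H4_exchange[of y x] A_comm[of 1 N x y] A'_comm[of 1 N x y]
    by (simp add: add.commute[of y x])
qed

unbundle fps_syntax

section \<open>The logarithmic derivative and the generating function in the odd power sums\<close>

lemma H_nth: "H_fps i x $ m = (if m = 0 then 1 else if m = 1 then sc x * nil_u i else 0)"
proof -
  have "H_fps i x = 1 + fps_const (sc x * nil_u i) * fps_X"
    by (simp add: H_fps_def scal_def nil_v_def mult.assoc[symmetric])
  then show ?thesis by (simp add: fps_X_nth)
qed

text \<open>\<open>F'\<close> is \<open>F\<close> with the series variable multiplied by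
  \<open>x\<close>; in this way every \<open>C_fps N x\<close> comes from the one at
  \<open>x = 1\<close>.\<close>

definition scaled :: "mpoly \<Rightarrow> op fps \<Rightarrow> op fps \<Rightarrow> bool" where
  "scaled x F F' \<longleftrightarrow> (\<forall>m. F' $ m = sc (x ^ m) * F $ m)"

lemma sc_mult_interchange: "(sc x * S) * (sc y * T) = sc (x * y) * (S * T)"
proof -
  have "(sc x * S) * (sc y * T) = sc x * (S * sc y) * T" by (simp only: mult.assoc)
  also have "\<dots> = sc x * (sc y * S) * T" by (simp only: sc_comm)
  finally show ?thesis by (simp only: mult.assoc sc_simps)
qed

lemma scaled_mult:
  assumes "scaled x F F'" "scaled x G G'" shows "scaled x (F * G) (F' * G')"
  unfolding scaled_def
proof
  fix m
  have "(F' * G') $ m = (\<Sum>i=0..m. sc (x ^ i * x ^ (m - i)) * (F $ i * G $ (m - i)))"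
    using assms by (simp add: fps_mult_nth scaled_def sc_mult_interchange)
  also have "\<dots> = (\<Sum>i=0..m. sc (x ^ m) * (F $ i * G $ (m - i)))"
    by (rule sum.cong) (simp_all add: power_add[symmetric])
  finally show "(F' * G') $ m = sc (x ^ m) * (F * G) $ m"
    by (simp add: fps_mult_nth sum_distrib_left)
qed

lemma scaled_H: "scaled x (H_fps i y) (H_fps i (x * y))"
  by (simp add: scaled_def H_nth sc_simps mult.assoc)

lemma scaled_prod_list:
  "(\<And>a. a \<in> set as \<Longrightarrow> scaled x (F a) (F' a)) \<Longrightarrow>
    scaled x (prod_list (map F as)) (prod_list (map F' as))"
  by (induction as) (simp_all add: scaled_mult, simp add: scaled_def sc_simps)

lemma scaled_C: "scaled x (C_fps N 1) (C_fps N x)"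
proof -
  have "scaled x (A_fps N 1 1) (A_fps N 1 x)" "scaled x (A_fps' N 1 1) (A_fps' N 1 x)"
    unfolding A_fps_def A_fps'_def using scaled_H[of x _ 1] by (simp_all only: scaled_prod_list mult_1_right)
  moreover have "scaled x (H_fps 0 (1 + 1)) (H_fps 0 (x + x))"
    using scaled_H[of x 0 "1 + 1"] by (simp only: distrib_left mult_1_right)
  ultimately show ?thesis unfolding C_fps_def by (intro scaled_mult)
qed

definition C_coeff :: "nat \<Rightarrow> nat \<Rightarrow> op" where
  "C_coeff N m = C_fps N 1 $ m"

lemma C_nth: "C_fps N x $ m = sc (x ^ m) * C_coeff N m"
  using scaled_C[of x N] by (simp add: scaled_def C_coeff_def)

text \<open>Comparing coefficients of y^j in C(1) C(y) = C(y) C(1) separates the operators. As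
  \<open>y\<close> ranges over an infinite integral domain, the polynomial \<open>p\<close> that
  vanishes at every \<open>y\<close> is 0.\<close>

lemma C_coeff_comm:
  assumes "1 \<le> N" shows "C_coeff N i * C_coeff N j = C_coeff N j * C_coeff N i"
proof (rule op_eqI)
  fix f :: coeff_fun and w :: "int \<Rightarrow> int"
  define m where "m = i + j"
  define g where "g k = app (C_coeff N (m - k) * C_coeff N k - C_coeff N k * C_coeff N (m - k)) f w" for k
  define p where "p = (\<Sum>k=0..m. monom (g k) k)"
  have "poly p y = 0" for y
  proof -
    have "(C_fps N 1 * C_fps N y) $ m = (\<Sum>k=0..m. C_coeff N k * (sc (y ^ (m - k)) * C_coeff N (m - k)))"
      by (simp add: fps_mult_nth C_nth sc_simps)
    also have "\<dots> = (\<Sum>k=0..m. C_coeff N (m - k) * (sc (y ^ k) * C_coeff N k))"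
      by (subst sum.atLeastAtMost_rev) (rule sum.cong; simp)
    also have "\<dots> = (\<Sum>k=0..m. sc (y ^ k) * (C_coeff N (m - k) * C_coeff N k))"
      using sc_mult_interchange[of 1] by (simp add: sc_simps)
    finally have 1: "(C_fps N 1 * C_fps N y) $ m = (\<Sum>k=0..m. sc (y ^ k) * (C_coeff N (m - k) * C_coeff N k))" .
    have 2: "(C_fps N y * C_fps N 1) $ m = (\<Sum>k=0..m. sc (y ^ k) * (C_coeff N k * C_coeff N (m - k)))"
      by (simp add: fps_mult_nth C_nth sc_simps mult.assoc)
    have "(\<Sum>k=0..m. sc (y ^ k) * (C_coeff N (m - k) * C_coeff N k - C_coeff N k * C_coeff N (m - k))) = 0"
      using 1 2 C_comm[OF assms, of 1 y] by (simp add: right_diff_distrib sum_subtractf)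
    then have "app (\<Sum>k=0..m. sc (y ^ k) * (C_coeff N (m - k) * C_coeff N k - C_coeff N k * C_coeff N (m - k))) f w = 0"
      by (simp add: app_simps)
    then have "(\<Sum>k=0..m. y ^ k * g k) = 0"
      by (simp add: app_sum g_def sc_comm[symmetric] app_sc_mult)
    then show ?thesis by (simp add: p_def poly_sum poly_monom mult.commute)
  qed
  then have "p = 0" using poly_all_0_iff_0 by blast
  then have "coeff p j = 0" by simp
  then have "g j = 0" by (simp add: p_def coeff_sum m_def)
  then show "app (C_coeff N i * C_coeff N j) f w = app (C_coeff N j * C_coeff N i) f w"
    by (simp add: g_def m_def app_simps)
qed

text \<open>\<open>C_fps N (- 1)\<close> is the inverse of \<open>C_fps N 1\<close> by
  \<open>C_inverse\<close>, so this is a coefficient of t C'(t) / C(t).\<close>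

definition log_C :: "nat \<Rightarrow> nat \<Rightarrow> op" where
  "log_C N k = (fps_X * fps_deriv (C_fps N 1) * C_fps N (- 1)) $ k"

lemma fps_X_deriv_nth: "(fps_X * fps_deriv F) $ m = of_nat m * F $ m"
  by (cases m) (simp_all add: fps_deriv_nth)

lemma log_C_eq: "log_C N k = (\<Sum>i=0..k. of_nat i * (sc ((- 1) ^ (k - i)) * (C_coeff N i * C_coeff N (k - i))))"
proof -
  have "log_C N k = (\<Sum>i=0..k. (of_nat i * C_fps N 1 $ i) * C_fps N (- 1) $ (k - i))"
    by (simp only: log_C_def fps_mult_nth[of "fps_X * fps_deriv (C_fps N 1)"] fps_X_deriv_nth)
  also have "\<dots> = (\<Sum>i=0..k. of_nat i * (sc ((- 1) ^ (k - i)) * (C_coeff N i * C_coeff N (k - i))))"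
    using sc_mult_interchange[of 1] by (simp add: C_nth sc_simps mult.assoc)
  finally show ?thesis .
qed

lemma log_C_0: "log_C N 0 = 0"
  by (simp add: log_C_eq)

lemma log_C_comm:
  assumes "1 \<le> N" shows "log_C N k * C_coeff N j = C_coeff N j * log_C N k"
proof -
  have "of_nat i * (sc y * (C_coeff N i * C_coeff N l)) * C_coeff N j = C_coeff N j * (of_nat i * (sc y * (C_coeff N i * C_coeff N l)))"
    for i l y
  proof -
    have "of_nat i * (sc y * (C_coeff N i * C_coeff N l)) * C_coeff N j = of_nat i * (sc y * (C_coeff N i * (C_coeff N l * C_coeff N j)))"
      by (simp only: mult.assoc)
    also have "C_coeff N i * (C_coeff N l * C_coeff N j) = C_coeff N j * (C_coeff N i * C_coeff N l)"
      using C_coeff_comm[OF assms] by (metis mult.assoc)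
    also have "of_nat i * (sc y * (C_coeff N j * (C_coeff N i * C_coeff N l))) =
        (of_nat i * C_coeff N j) * (sc y * (C_coeff N i * C_coeff N l))"
      using sc_comm[of "C_coeff N j" y] by (metis mult.assoc)
    also have "of_nat i * C_coeff N j = C_coeff N j * of_nat i" by (rule mult_of_nat_commute)
    finally show ?thesis by (simp only: mult.assoc)
  qed
  then show ?thesis by (simp add: log_C_eq sum_distrib_left sum_distrib_right)
qed

lemma of_nat_op_cancel:
  assumes "of_nat m * S = of_nat m * T" "m \<noteq> 0" shows "S = (T :: op)"
proof -
  have "of_nat m = sc (of_nat m)"
    by (induction m) (simp_all add: sc_simps)
  then have "sc (Const (1 / of_nat m)) * of_nat m = sc (Const (1 / of_nat m) * Const (of_nat m))"
    by (simp add: sc_simps Const_of_nat)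
  also have "\<dots> = 1" using \<open>m \<noteq> 0\<close> by (simp add: Const_mult[symmetric] Const_1 sc_simps)
  finally have "sc (Const (1 / of_nat m)) * (of_nat m * R) = R" for R
    by (metis mult.assoc mult_1_left)
  then show ?thesis using assms(1) by metis
qed

text \<open>The logarithmic derivative of \<open>C\<close> is odd because \<open>C(x) C(- x) = 1\<close>.\<close>

lemma log_C_even:
  assumes "1 \<le> N" "even k" shows "log_C N k = 0"
proof (cases "k = 0")
  case False
  let ?t = "\<lambda>i. sc ((- 1) ^ (k - i)) * (C_coeff N i * C_coeff N (k - i))"
  have sym: "?t (k - i) = ?t i" if "i \<le> k" for i
  proof -
    have "(- 1) ^ i = (- 1 :: mpoly) ^ (k - i)"
      using that \<open>even k\<close> by (simp add: minus_one_power_iff)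
    then show ?thesis using that C_coeff_comm[OF assms(1), of "k - i" i] by simp
  qed
  \<comment> \<open>Reflecting i to k - i keeps the sign because \<open>k\<close> is even. Adding
    both forms of the sum turns the weights i and k - i into the constant \<open>k\<close>, and a
    coefficient of C(1) C(-1) = 1 is left.\<close>
  have "log_C N k = (\<Sum>i=0..k. of_nat (k - i) * ?t (k - i))"
    unfolding log_C_eq by (subst sum.atLeastAtMost_rev) simp
  also have "\<dots> = (\<Sum>i=0..k. of_nat (k - i) * ?t i)"
    by (rule sum.cong) (simp_all only: sym atLeastAtMost_iff)
  finally have "log_C N k + log_C N k = (\<Sum>i=0..k. of_nat i * ?t i) + (\<Sum>i=0..k. of_nat (k - i) * ?t i)"
    using log_C_eq[of N k] by argo
  also have "\<dots> = (\<Sum>i=0..k. (of_nat i + of_nat (k - i)) * ?t i)"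
    by (simp only: distrib_right sum.distrib)
  also have "\<dots> = (\<Sum>i=0..k. of_nat k * ?t i)"
    by (rule sum.cong) (simp_all only: of_nat_add[symmetric] atLeastAtMost_iff le_add_diff_inverse)
  also have "\<dots> = of_nat k * (C_fps N 1 * C_fps N (- 1)) $ k"
    using sc_mult_interchange[of 1] by (simp add: fps_mult_nth C_nth sc_simps sum_distrib_left)
  also have "\<dots> = 0" using C_inverse[of N 1] False by simp
  finally have "of_nat 2 * log_C N k = of_nat 2 * 0" by (simp add: mult_2)
  then show ?thesis by (rule of_nat_op_cancel) simp
qed (simp add: log_C_0)

text \<open>An arbitrary \<open>p\<close> covers the generators \<open>P k\<close>, their images
  under \<open>act 0\<close>, and the power sums of finitely many variables.\<close>

definition log_G :: "nat \<Rightarrow> (nat \<Rightarrow> mpoly) \<Rightarrow> op fps" where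
  "log_G N p = Abs_fps (\<lambda>k. sc (p k) * log_C N k)"

lemma log_G_nth: "log_G N p $ k = sc (p k) * log_C N k"
  by (simp add: log_G_def)

lemma log_G_add: "log_G N (\<lambda>k. p k + q k) = log_G N p + log_G N q"
  by (rule fps_ext) (simp only: log_G_nth fps_add_nth sc_simps distrib_right)

lemma log_G_cong_odd:
  assumes "1 \<le> N" "\<And>k. odd k \<Longrightarrow> p k = q k" shows "log_G N p = log_G N q"
proof (rule fps_ext)
  fix k show "log_G N p $ k = log_G N q $ k"
  proof (cases "even k")
    case True
    then show ?thesis using log_C_even[OF assms(1)] by (simp only: log_G_nth mult_zero_right)
  next
    case False
    then show ?thesis by (simp only: log_G_nth assms(2)[OF False])
  qed
qed

lemma log_G_C_comm: assumes "1 \<le> N" shows "log_G N p * C_fps N x = C_fps N x * log_G N p"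
proof (rule fps_ext)
  fix m
  have "(log_G N p * C_fps N x) $ m = (\<Sum>i=0..m. sc (p i * x ^ (m - i)) * (log_C N i * C_coeff N (m - i)))"
    by (simp add: fps_mult_nth log_G_nth C_nth sc_mult_interchange)
  also have "\<dots> = (\<Sum>i=0..m. sc (p (m - i) * x ^ i) * (log_C N (m - i) * C_coeff N i))"
    by (subst sum.atLeastAtMost_rev) (rule sum.cong; simp)
  also have "\<dots> = (\<Sum>i=0..m. sc (x ^ i * p (m - i)) * (C_coeff N i * log_C N (m - i)))"
    using log_C_comm[OF assms] by (simp add: mult.commute)
  finally show "(log_G N p * C_fps N x) $ m = (C_fps N x * log_G N p) $ m"
    by (simp add: fps_mult_nth log_G_nth C_nth sc_mult_interchange)
qed

text \<open>At \<open>x = 1\<close> this is the definition of \<open>log_C\<close>, and scaling the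
  series variable carries it to every \<open>x\<close>.\<close>

lemma C_ode: "fps_X * fps_deriv (C_fps N x) = log_G N (\<lambda>k. x ^ k) * C_fps N x"
proof (rule fps_ext)
  fix m
  have E: "log_G N (\<lambda>k. 1) = fps_X * fps_deriv (C_fps N 1) * C_fps N (- 1)"
    by (rule fps_ext) (simp add: log_G_nth log_C_def sc_simps)
  have "C_fps N (- 1) * C_fps N 1 = 1" using C_inverse[of N "- 1"] by simp
  then have one: "log_G N (\<lambda>k. 1) * C_fps N 1 = fps_X * fps_deriv (C_fps N 1)"
    unfolding E by (simp add: mult.assoc)
  have "scaled x (log_G N (\<lambda>k. 1)) (log_G N (\<lambda>k. x ^ k))" by (simp add: scaled_def log_G_nth sc_simps)
  then have "scaled x (fps_X * fps_deriv (C_fps N 1)) (log_G N (\<lambda>k. x ^ k) * C_fps N x)"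
    using scaled_mult[OF _ scaled_C[of x N]] unfolding one[symmetric] by blast
  then have "(log_G N (\<lambda>k. x ^ k) * C_fps N x) $ m = sc (x ^ m) * (of_nat m * C_coeff N m)"
    by (simp only: scaled_def fps_X_deriv_nth C_coeff_def)
  also have "\<dots> = of_nat m * (sc (x ^ m) * C_coeff N m)"
    by (simp only: mult.assoc[symmetric] mult_of_nat_commute[of m "sc (x ^ m)"])
  finally show "(fps_X * fps_deriv (C_fps N x)) $ m = (log_G N (\<lambda>k. x ^ k) * C_fps N x) $ m"
    by (simp only: fps_X_deriv_nth C_nth)
qed

text \<open>As \<open>L $ 0 = 0\<close>, the t^m coefficient reads m F_m = sum of L_i F_(m-i) over i
  >= 1. This is a recursion because positive integers can be cancelled.\<close>

lemma ode_unique: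
  fixes F G :: "op fps"
  assumes "fps_X * fps_deriv F = L * F" "fps_X * fps_deriv G = L * G" "L $ 0 = 0" "F $ 0 = G $ 0"
  shows "F = G"
proof (rule fps_ext)
  fix m show "F $ m = G $ m"
  proof (induction m rule: less_induct)
    case (less m)
    show ?case
    proof (cases "m = 0")
      case False
      have "of_nat m * F $ m = (L * F) $ m"
        by (simp only: fps_X_deriv_nth[symmetric] assms(1))
      also have "\<dots> = (\<Sum>i=0..m. L $ i * F $ (m - i))" by (rule fps_mult_nth)
      also have "\<dots> = (\<Sum>i=0..m. L $ i * G $ (m - i))"
      proof (rule sum.cong[OF refl])
        fix i assume "i \<in> {0..m}"
        then show "L $ i * F $ (m - i) = L $ i * G $ (m - i)"
          using less[of "m - i"] False assms(3) by (cases "i = 0") simp_all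
      qed
      also have "\<dots> = (L * G) $ m" by (rule fps_mult_nth[symmetric])
      also have "\<dots> = of_nat m * G $ m"
        by (simp only: fps_X_deriv_nth[symmetric] assms(2))
      finally show ?thesis using False by (rule of_nat_op_cancel)
    qed (use assms(4) in simp)
  qed
qed

text \<open>The recursion behind \<open>ode_unique\<close>, solved for the top coefficient. The
  guard on \<open>k\<close> serves termination.\<close>

fun G_coeff :: "nat \<Rightarrow> (nat \<Rightarrow> mpoly) \<Rightarrow> nat \<Rightarrow> op" where
  "G_coeff N p m = (if m = 0 then 1 else sc (Const (1 / of_nat m)) *
     (\<Sum>k=1..m. sc (p k) * log_C N k * (if k = 0 then 0 else G_coeff N p (m - k))))"

declare G_coeff.simps [simp del]

definition G_fps :: "nat \<Rightarrow> (nat \<Rightarrow> mpoly) \<Rightarrow> op fps" where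
  "G_fps N p = Abs_fps (G_coeff N p)"

lemma G_nth_0: "G_fps N p $ 0 = 1"
  by (simp add: G_fps_def G_coeff.simps)

lemma G_nth_rec:
  assumes "m \<noteq> 0"
  shows "G_fps N p $ m = sc (Const (1 / of_nat m)) * (\<Sum>k=1..m. sc (p k) * log_C N k * G_fps N p $ (m - k))"
  unfolding G_fps_def fps_nth_Abs_fps
  by (subst G_coeff.simps) (use assms in \<open>auto intro!: arg_cong2[where f = "(*)"] sum.cong\<close>)

lemma of_nat_sc: "of_nat m * (sc (Const (1 / of_nat m)) * T) = (if m = 0 then 0 else T)"
proof -
  have "of_nat m = sc (of_nat m)" by (induction m) (simp_all add: sc_simps)
  then have "of_nat m * (sc (Const (1 / of_nat m)) * T) = sc (Const (of_nat m) * Const (1 / of_nat m)) * T"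
    by (simp add: sc_simps Const_of_nat mult.assoc)
  then show ?thesis by (simp add: Const_mult[symmetric] Const_1 Const_0 sc_simps)
qed

lemma G_ode: "fps_X * fps_deriv (G_fps N p) = log_G N p * G_fps N p"
proof (rule fps_ext)
  fix m
  have "(log_G N p * G_fps N p) $ m = (\<Sum>k=0..m. sc (p k) * log_C N k * G_fps N p $ (m - k))"
    by (simp only: fps_mult_nth log_G_nth)
  also have "\<dots> = (\<Sum>k=1..m. sc (p k) * log_C N k * G_fps N p $ (m - k))"
    by (subst sum.atLeast_Suc_atMost) (simp_all add: log_C_0)
  also have "\<dots> = of_nat m * G_fps N p $ m"
    by (cases "m = 0") (simp_all add: G_nth_rec of_nat_sc)
  finally show "(fps_X * fps_deriv (G_fps N p)) $ m = (log_G N p * G_fps N p) $ m"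
    by (simp only: fps_X_deriv_nth)
qed

lemma log_G_nth_0: "log_G N p $ 0 = 0"
  by (simp add: log_G_nth log_C_0)

lemma prod_list_nth_0:
  "(\<And>a. a \<in> set as \<Longrightarrow> F a $ 0 = 1) \<Longrightarrow> prod_list (map F as) $ 0 = (1 :: op)"
  by (induction as) simp_all

text \<open>By the product rule both sides satisfy the same equation, since \<open>log_G\<close>
  commutes with C and so logarithmic derivatives add. With \<open>x = z_1\<close> this is the effect
  of s_0 on the power sums.\<close>

lemma C_mult_G:
  assumes "1 \<le> N"
  shows "C_fps N x * G_fps N p = G_fps N (\<lambda>k. p k + x ^ k)"
proof (rule ode_unique[OF _ G_ode])
  have "fps_X * fps_deriv (C_fps N x * G_fps N p) =
      (fps_X * C_fps N x) * fps_deriv (G_fps N p) + (fps_X * fps_deriv (C_fps N x)) * G_fps N p"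
    by (simp add: distrib_left mult.assoc)
  also have "\<dots> = C_fps N x * (fps_X * fps_deriv (G_fps N p)) + (fps_X * fps_deriv (C_fps N x)) * G_fps N p"
    by (simp only: fps_mult_fps_X_commute[of "C_fps N x"] mult.assoc)
  also have "\<dots> = (C_fps N x * log_G N p) * G_fps N p + log_G N (\<lambda>k. x ^ k) * C_fps N x * G_fps N p"
    by (simp only: G_ode C_ode mult.assoc)
  also have "\<dots> = log_G N (\<lambda>k. p k + x ^ k) * (C_fps N x * G_fps N p)"
    by (simp only: log_G_C_comm[OF assms, symmetric] log_G_add distrib_right mult.assoc)
  finally show "fps_X * fps_deriv (C_fps N x * G_fps N p) = log_G N (\<lambda>k. p k + x ^ k) * (C_fps N x * G_fps N p)" .
  have "C_fps N x $ 0 = 1"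
    by (simp add: C_nth C_coeff_def C_fps_def A_fps_def A_fps'_def prod_list_nth_0 H_nth sc_simps)
  then show "(C_fps N x * G_fps N p) $ 0 = G_fps N (\<lambda>k. p k + x ^ k) $ 0" by (simp add: G_nth_0)
qed (rule log_G_nth_0)

lemma G_cong_odd:
  assumes "1 \<le> N" "\<And>k. odd k \<Longrightarrow> p k = q k" shows "G_fps N p = G_fps N q"
proof (rule ode_unique[OF G_ode _ log_G_nth_0])
  have "log_G N p = log_G N q" using assms by (rule log_G_cong_odd)
  then show "fps_X * fps_deriv (G_fps N q) = log_G N p * G_fps N q" by (simp only: G_ode)
qed (simp add: G_nth_0)

lemma G_0: "G_fps N (\<lambda>k. 0) = 1"
proof (rule ode_unique[OF G_ode _ log_G_nth_0])
  have "log_G N (\<lambda>k. 0) = 0" by (rule fps_ext) (simp add: log_G_nth sc_simps)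
  then show "fps_X * fps_deriv 1 = log_G N (\<lambda>k. 0) * 1" by simp
qed (simp add: G_nth_0)

text \<open>Variables are adjoined to \<open>G_0\<close> one at a time; the newest factor stands
  leftmost, as the topmost block comes first in the reading order.\<close>

lemma G_power_sums:
  assumes "1 \<le> N"
  shows "G_fps N (\<lambda>j. \<Sum>i=1..k. x i ^ j) = prod_list (map (\<lambda>i. C_fps N (x i)) (rev [1..<k + 1]))"
proof (induction k)
  case (Suc k)
  have "(\<lambda>j. \<Sum>i=1..Suc k. x i ^ j) = (\<lambda>j. (\<Sum>i=1..k. x i ^ j) + x (Suc k) ^ j)" by simp
  then have "G_fps N (\<lambda>j. \<Sum>i=1..Suc k. x i ^ j) = C_fps N (x (Suc k)) * G_fps N (\<lambda>j. \<Sum>i=1..k. x i ^ j)"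
    by (simp only: C_mult_G[OF assms])
  then show ?case using Suc by simp
qed (simp add: G_0)

section \<open>Graded relations preserved by the generating functions\<close>

text \<open>Homogeneity, compatibility with substitutions and independence of the rank are all instances
  of relations \<open>Q d f f'\<close> between coefficient functions of degree \<open>d\<close>.\<close>

definition graded_rel :: "(nat \<Rightarrow> coeff_fun \<Rightarrow> coeff_fun \<Rightarrow> bool) \<Rightarrow> bool" where
  "graded_rel Q \<longleftrightarrow> (\<forall>d. Q d (\<lambda>w. 0) (\<lambda>w. 0)) \<and>
     (\<forall>d f f' g g'. Q d f f' \<longrightarrow> Q d g g' \<longrightarrow> Q d (\<lambda>w. f w + g w) (\<lambda>w. f' w + g' w)) \<and>
     (\<forall>d f f' a. Q d f f' \<longrightarrow> Q d (\<lambda>w. Const a * f w) (\<lambda>w. Const a * f' w)) \<and>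
     (\<forall>d f f' i. Q d f f' \<longrightarrow> Q d (app (nil_u i) f) (app (nil_u i) f'))"

definition rel_op :: "(nat \<Rightarrow> coeff_fun \<Rightarrow> coeff_fun \<Rightarrow> bool) \<Rightarrow> nat \<Rightarrow> op \<Rightarrow> op \<Rightarrow> bool" where
  "rel_op Q s S T \<longleftrightarrow> (\<forall>d f f'. Q d f f' \<longrightarrow> Q (d + s) (app S f) (app T f'))"

text \<open>The t^m coefficient raises degrees by \<open>s * m\<close>: \<open>s = 1\<close> gives
  homogeneity, \<open>s = 0\<close> serves relations without grading.\<close>

definition rel_fps :: "(nat \<Rightarrow> coeff_fun \<Rightarrow> coeff_fun \<Rightarrow> bool) \<Rightarrow> nat \<Rightarrow> op fps \<Rightarrow> op fps \<Rightarrow> bool" where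
  "rel_fps Q s F F' \<longleftrightarrow> (\<forall>m. rel_op Q (s * m) (F $ m) (F' $ m))"

lemma app_0: "app 0 f = (\<lambda>w. 0)"
  by (simp add: fun_eq_iff app_simps)

lemma rel_op_0: "graded_rel Q \<Longrightarrow> rel_op Q s 0 0"
  by (simp add: rel_op_def graded_rel_def app_0)

lemma rel_op_1: "rel_op Q 0 1 1"
  by (simp add: rel_op_def app_simps)

lemma rel_op_add: "graded_rel Q \<Longrightarrow> rel_op Q s S S' \<Longrightarrow> rel_op Q s T T' \<Longrightarrow> rel_op Q s (S + T) (S' + T')"
  unfolding rel_op_def app_plus by (simp add: graded_rel_def)

lemma rel_op_sum:
  assumes "graded_rel Q" "\<And>i. i \<in> I \<Longrightarrow> rel_op Q s (S i) (T i)"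
  shows "rel_op Q s (\<Sum>i\<in>I. S i) (\<Sum>i\<in>I. T i)"
  using assms(2)
  by (induction I rule: infinite_finite_induct) (simp_all add: rel_op_0 rel_op_add assms(1))

lemma rel_op_mult:
  assumes "rel_op Q s S S'" "rel_op Q t T T'" shows "rel_op Q (s + t) (S * T) (S' * T')"
  unfolding rel_op_def app_simps
proof (intro allI impI)
  fix d f f' assume "Q d f f'"
  then have "Q (d + s) (app S f) (app S' f')" using assms(1) by (simp only: rel_op_def)
  then have "Q (d + s + t) (app T (app S f)) (app T' (app S' f'))"
    using assms(2) by (simp only: rel_op_def)
  then show "Q (d + (s + t)) (app T (app S f)) (app T' (app S' f'))" by (simp only: add.assoc)
qed

lemma app_sc_fun: "app (sc x) f = (\<lambda>w. x * f w)"
  by (simp add: fun_eq_iff app_sc)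

lemma rel_op_Const: "graded_rel Q \<Longrightarrow> rel_op Q 0 (sc (Const a)) (sc (Const a))"
  by (simp add: rel_op_def graded_rel_def app_sc_fun)

lemma rel_op_u: "graded_rel Q \<Longrightarrow> rel_op Q 0 (nil_u i) (nil_u i)"
  by (simp add: rel_op_def graded_rel_def)

lemma rel_fps_mult:
  assumes "graded_rel Q" "rel_fps Q s F F'" "rel_fps Q s L L'"
  shows "rel_fps Q s (F * L) (F' * L')"
  unfolding rel_fps_def
proof
  fix m
  have "rel_op Q (s * m) (F $ i * L $ (m - i)) (F' $ i * L' $ (m - i))" if "i \<in> {0..m}" for i
  proof -
    have "rel_op Q (s * i + s * (m - i)) (F $ i * L $ (m - i)) (F' $ i * L' $ (m - i))"
      by (rule rel_op_mult) (use assms in \<open>simp_all add: rel_fps_def\<close>)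
    moreover have "s * i + s * (m - i) = s * m" using that by (simp flip: distrib_left)
    ultimately show ?thesis by simp
  qed
  then show "rel_op Q (s * m) ((F * L) $ m) ((F' * L') $ m)"
    unfolding fps_mult_nth by (rule rel_op_sum[OF assms(1)])
qed

lemma rel_fps_1: "graded_rel Q \<Longrightarrow> rel_fps Q s 1 1"
  by (simp add: rel_fps_def rel_op_0 rel_op_1)

lemma rel_fps_prod_list:
  assumes "graded_rel Q" "\<And>a. a \<in> set as \<Longrightarrow> rel_fps Q s (F a) (F' a)"
  shows "rel_fps Q s (prod_list (map F as)) (prod_list (map F' as))"
  using assms(2) by (induction as) (simp_all add: rel_fps_1 rel_fps_mult assms(1))

lemma rel_fps_H:
  assumes "graded_rel Q" "rel_op Q s (sc x) (sc x')"
  shows "rel_fps Q s (H_fps i x) (H_fps i x')"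
  using rel_op_mult[OF assms(2) rel_op_u[OF assms(1)]] rel_op_0[OF assms(1)] rel_op_1
  by (simp add: rel_fps_def H_nth)

lemma rel_fps_A: "graded_rel Q \<Longrightarrow> rel_op Q s (sc x) (sc x') \<Longrightarrow> rel_fps Q s (A_fps N i x) (A_fps N i x')"
  unfolding A_fps_def by (intro rel_fps_prod_list rel_fps_H)

lemma rel_fps_A': "graded_rel Q \<Longrightarrow> rel_op Q s (sc x) (sc x') \<Longrightarrow> rel_fps Q s (A_fps' N i x) (A_fps' N i x')"
  unfolding A_fps'_def by (intro rel_fps_prod_list rel_fps_H)

lemma rel_fps_C: "graded_rel Q \<Longrightarrow> rel_op Q s (sc x) (sc x') \<Longrightarrow> rel_fps Q s (C_fps N x) (C_fps N x')"
  unfolding C_fps_def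
  by (intro rel_fps_mult rel_fps_A rel_fps_A' rel_fps_H) (simp_all only: sc_simps rel_op_add)

lemma of_nat_eq_sc: "of_nat m = sc (Const (of_nat m))"
  unfolding Const_of_nat by (induction m) (simp_all add: sc_simps)

text \<open>\<open>log_C\<close> is built from C at the constants 1 and -1, so it has degree 0 and
  is compatible with every substitution.\<close>

lemma rel_op_e:
  assumes "graded_rel Q" "\<And>a. rel_fps Q 0 (C_fps N (Const a)) (C_fps N' (Const a))"
  shows "rel_op Q 0 (log_C N k) (log_C N' k)"
proof -
  have "rel_op Q 0 (of_nat m * C_fps N 1 $ m) (of_nat m * C_fps N' 1 $ m)" for m
    using rel_op_mult[OF rel_op_Const[OF assms(1)], of 0 "C_fps N 1 $ m" "C_fps N' 1 $ m" "of_nat m"]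
      assms(2)[of 1] by (simp add: of_nat_eq_sc rel_fps_def Const_1)
  then have "rel_fps Q 0 (fps_X * fps_deriv (C_fps N 1)) (fps_X * fps_deriv (C_fps N' 1))"
    unfolding rel_fps_def fps_X_deriv_nth by simp
  moreover have "rel_fps Q 0 (C_fps N (- 1)) (C_fps N' (- 1))"
    using assms(2)[of "- 1"] by (simp add: Const_uminus Const_1)
  ultimately have "rel_fps Q 0 (fps_X * fps_deriv (C_fps N 1) * C_fps N (- 1)) (fps_X * fps_deriv (C_fps N' 1) * C_fps N' (- 1))"
    by (rule rel_fps_mult[OF assms(1)])
  then show ?thesis by (simp add: rel_fps_def log_C_def)
qed

lemma rel_fps_G:
  assumes Q: "graded_rel Q" and lc: "\<And>k. rel_op Q 0 (log_C N k) (log_C N' k)"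
    and p: "\<And>k. rel_op Q (s * k) (sc (p k)) (sc (p' k))"
  shows "rel_fps Q s (G_fps N p) (G_fps N' p')"
  unfolding rel_fps_def
proof
  fix m show "rel_op Q (s * m) (G_fps N p $ m) (G_fps N' p' $ m)"
  proof (induction m rule: less_induct)
    case (less m)
    show ?case
    proof (cases "m = 0")
      case True
      then show ?thesis by (simp add: G_nth_0 rel_op_1)
    next
      case False
      have "rel_op Q (s * m) (sc (p k) * log_C N k * G_fps N p $ (m - k)) (sc (p' k) * log_C N' k * G_fps N' p' $ (m - k))"
        if k: "k \<in> {1..m}" for k
      proof -
        have "rel_op Q (s * k + 0 + s * (m - k)) (sc (p k) * log_C N k * G_fps N p $ (m - k))
            (sc (p' k) * log_C N' k * G_fps N' p' $ (m - k))"
          using k by (intro rel_op_mult p lc less) auto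
        moreover have "s * k + 0 + s * (m - k) = s * m" using k by (simp flip: distrib_left)
        ultimately show ?thesis by simp
      qed
      then have "rel_op Q (0 + s * m) (G_fps N p $ m) (G_fps N' p' $ m)"
        unfolding G_nth_rec[OF False] by (intro rel_op_mult rel_op_Const[OF Q] rel_op_sum[OF Q])
      then show ?thesis by simp
    qed
  qed
qed

text \<open>The Fomin--Stanley generating function of the type A Schubert polynomials.\<close>

definition S_fps :: "nat \<Rightarrow> (nat \<Rightarrow> mpoly) \<Rightarrow> op fps" where
  "S_fps N z = prod_list (map (\<lambda>i. A_fps N i (z i)) [1..<Suc N])"

lemma rel_fps_SS:
  assumes "graded_rel Q" "\<And>i. 1 \<le> i \<Longrightarrow> rel_op Q s (sc (z i)) (sc (z' i))"
  shows "rel_fps Q s (S_fps N z) (S_fps N z')"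
  unfolding S_fps_def using assms by (intro rel_fps_prod_list rel_fps_A) auto

section \<open>Degrees, homomorphisms and change of rank as graded relations\<close>

definition zp_deg :: "nat \<Rightarrow> mpoly set" where
  "zp_deg d = zp_ring \<inter> hom_deg d"

definition deg_rel :: "nat \<Rightarrow> coeff_fun \<Rightarrow> coeff_fun \<Rightarrow> bool" where
  "deg_rel d f f' \<longleftrightarrow> (\<forall>w. f w \<in> zp_deg d)"

lemma zp_deg_mult: "f \<in> zp_deg d \<Longrightarrow> g \<in> zp_deg d' \<Longrightarrow> f * g \<in> zp_deg (d + d')"
  by (simp add: zp_deg_def zp_ring_eq vars_in_mult hom_deg_mult)

lemma zp_deg_Const: "Const a \<in> zp_deg 0"
  by (simp add: zp_deg_def zp_ring_eq vars_in_Const hom_deg_Const)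

lemma zp_deg_0: "0 \<in> zp_deg d"
  by (simp add: zp_deg_def zp_ring_eq vars_in_0 hom_deg_0)

lemma graded_rel_deg: "graded_rel deg_rel"
  unfolding graded_rel_def deg_rel_def
proof (intro conjI allI impI)
  fix f g :: mpoly and a b and d
  show "(0 :: mpoly) \<in> zp_deg d" by (rule zp_deg_0)
next
  fix d and f g :: coeff_fun and w
  assume "\<forall>w. f w \<in> zp_deg d" "\<forall>w. g w \<in> zp_deg d"
  then show "f w + g w \<in> zp_deg d"
    by (simp add: zp_deg_def zp_ring_eq vars_in_add hom_deg_add)
next
  fix d and f :: coeff_fun and a w
  assume "\<forall>w. f w \<in> zp_deg d"
  then show "Const a * f w \<in> zp_deg d"
    using zp_deg_mult[OF zp_deg_Const, of "f w" d a] by simp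
next
  fix d and f :: coeff_fun and i w
  assume "\<forall>w. f w \<in> zp_deg d"
  then show "app (nil_u i) f w \<in> zp_deg d" by (simp add: app_nil_u zp_deg_0)
qed

lemma rel_op_deg: "x \<in> zp_deg s \<Longrightarrow> rel_op deg_rel s (sc x) (sc x)"
  using zp_deg_mult by (auto simp: rel_op_def deg_rel_def app_sc add.commute[of _ s])

definition hom_rel :: "(mpoly \<Rightarrow> mpoly) \<Rightarrow> nat \<Rightarrow> coeff_fun \<Rightarrow> coeff_fun \<Rightarrow> bool" where
  "hom_rel \<phi> d f f' \<longleftrightarrow> (\<forall>w. f' w = \<phi> (f w))"

lemma graded_rel_hom: "alg_hom \<phi> \<Longrightarrow> graded_rel (hom_rel \<phi>)"
  by (simp add: graded_rel_def hom_rel_def alg_hom_simps app_nil_u)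

lemma rel_op_hom: "alg_hom \<phi> \<Longrightarrow> rel_op (hom_rel \<phi>) s (sc x) (sc (\<phi> x))"
  by (simp add: rel_op_def hom_rel_def app_sc alg_hom_simps)

definition BC_rel :: "nat \<Rightarrow> nat \<Rightarrow> coeff_fun \<Rightarrow> coeff_fun \<Rightarrow> bool" where
  "BC_rel n d f f' \<longleftrightarrow> (\<forall>w\<in>BC n. f w = f' w)"

lemma BC_comp_sgen_desc: "w \<in> BC n \<Longrightarrow> desc w i \<Longrightarrow> w \<circ> sgen i \<in> BC n"
  using not_desc_outside BC_comp sgen_BC by (meson not_le)

lemma graded_rel_BC: "graded_rel (BC_rel n)"
  by (simp add: graded_rel_def BC_rel_def app_nil_u BC_comp_sgen_desc)

lemma rel_op_BC: "rel_op (BC_rel n) s (sc x) (sc x)"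
  by (simp add: rel_op_def BC_rel_def app_sc)

text \<open>No element of \<open>BC n\<close> has a descent at \<open>n\<close> or beyond, so on
  these coefficients h_j acts as the identity.\<close>

lemma rel_fps_BC_H: assumes "n \<le> j" shows "rel_fps (BC_rel n) s (H_fps j x) 1"
proof -
  have "rel_op (BC_rel n) s (sc x * nil_u j) 0"
    using not_desc_outside[OF _ assms] by (simp add: rel_op_def BC_rel_def app_simps app_nil_u)
  then show ?thesis
    using rel_op_0[OF graded_rel_BC] rel_op_1 by (simp add: rel_fps_def H_nth)
qed

lemma rel_fps_BC_A:
  assumes "n \<le> Suc N" shows "rel_fps (BC_rel n) s (A_fps (Suc N) i x) (A_fps N i x)"
proof (cases "i \<le> Suc N")
  case True
  have "rel_fps (BC_rel n) s (H_fps (Suc N) x * A_fps N i x) (1 * A_fps N i x)"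
    by (rule rel_fps_mult[OF graded_rel_BC rel_fps_BC_H[OF assms] rel_fps_A[OF graded_rel_BC rel_op_BC]])
  then show ?thesis using True by (simp add: A_fps_def)
next
  case False
  then show ?thesis by (simp add: A_empty rel_fps_1[OF graded_rel_BC])
qed

lemma rel_fps_BC_A':
  assumes "n \<le> Suc N" shows "rel_fps (BC_rel n) s (A_fps' (Suc N) i x) (A_fps' N i x)"
proof (cases "i \<le> Suc N")
  case True
  have "rel_fps (BC_rel n) s (A_fps' N i x * H_fps (Suc N) x) (A_fps' N i x * 1)"
    by (rule rel_fps_mult[OF graded_rel_BC rel_fps_A'[OF graded_rel_BC rel_op_BC] rel_fps_BC_H[OF assms]])
  then show ?thesis using True by (simp add: A_fps'_def)
next
  case False
  then show ?thesis by (simp add: A'_empty rel_fps_1[OF graded_rel_BC])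
qed

lemma rel_fps_BC_C:
  assumes "n \<le> Suc N" shows "rel_fps (BC_rel n) s (C_fps (Suc N) x) (C_fps N x)"
  unfolding C_fps_def
  by (intro rel_fps_mult[OF graded_rel_BC] rel_fps_BC_A rel_fps_BC_A' rel_fps_H[OF graded_rel_BC] rel_op_BC assms)

lemma rel_fps_BC_G:
  assumes "n \<le> Suc N" shows "rel_fps (BC_rel n) s (G_fps (Suc N) p) (G_fps N p)"
  by (intro rel_fps_G rel_op_e graded_rel_BC rel_fps_BC_C rel_op_BC assms)

lemma rel_fps_BC_SS:
  assumes "n \<le> Suc N" shows "rel_fps (BC_rel n) s (S_fps (Suc N) z) (S_fps N z)"
proof -
  have "rel_fps (BC_rel n) s (A_fps (Suc N) (Suc N) (z (Suc N))) 1"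
    using rel_fps_BC_A[OF assms, of s "Suc N" "z (Suc N)"] by (simp add: A_empty)
  then have "rel_fps (BC_rel n) s
      (prod_list (map (\<lambda>i. A_fps (Suc N) i (z i)) [1..<Suc N]) * A_fps (Suc N) (Suc N) (z (Suc N))) (S_fps N z * 1)"
    unfolding S_fps_def
    by (intro rel_fps_mult[OF graded_rel_BC] rel_fps_prod_list[OF graded_rel_BC] rel_fps_BC_A assms)
  then show ?thesis by (simp add: S_fps_def)
qed

section \<open>The type C_fps Schubert polynomials\<close>

lemma SS_split:
  assumes "1 \<le> i" "Suc i \<le> N"
  shows "S_fps N z = prod_list (map (\<lambda>j. A_fps N j (z j)) [1..<i]) * (A_fps N i (z i) * A_fps N (Suc i) (z (Suc i))) *
    prod_list (map (\<lambda>j. A_fps N j (z j)) [Suc (Suc i)..<Suc N])"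
proof -
  have "[1..<Suc N] = [1..<i] @ [i..<Suc N]"
    using assms upt_add_eq_append[of 1 i "Suc N - i"] by simp
  moreover have "[i..<Suc N] = i # Suc i # [Suc (Suc i)..<Suc N]"
    using assms by (simp add: upt_conv_Cons del: upt_Suc)
  ultimately show ?thesis unfolding S_fps_def by (simp only: map_append prod_list.append list.map prod_list.Cons mult.assoc)
qed

lemma H_prod_A_comm:
  "(\<And>j. j \<in> set js \<Longrightarrow> i + 2 \<le> j) \<Longrightarrow>
    H_fps i x * prod_list (map (\<lambda>j. A_fps N j (z j)) js) = prod_list (map (\<lambda>j. A_fps N j (z j)) js) * H_fps i x"
proof (induction js)
  case (Cons j js)
  have "H_fps i x * prod_list (map (\<lambda>j. A_fps N j (z j)) (j # js)) =
      (H_fps i x * A_fps N j (z j)) * prod_list (map (\<lambda>j. A_fps N j (z j)) js)"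
    by (simp add: mult.assoc)
  also have "\<dots> = A_fps N j (z j) * (H_fps i x * prod_list (map (\<lambda>j. A_fps N j (z j)) js))"
    using Cons.prems[of j] by (simp add: H_A_comm mult.assoc)
  also have "H_fps i x * prod_list (map (\<lambda>j. A_fps N j (z j)) js) = prod_list (map (\<lambda>j. A_fps N j (z j)) js) * H_fps i x"
    using Cons by simp
  finally show ?case by (simp add: mult.assoc)
qed simp

text \<open>A_(i+1)(y) = A_i(y) h_i(-y), and A_i(x) commutes with A_i(y).\<close>

lemma A_exchange:
  assumes "1 \<le> i" "i \<le> N"
  shows "A_fps N i x * A_fps N (Suc i) y = A_fps N i y * A_fps N (Suc i) x * H_fps i (x - y)"
proof -
  have "A_fps N (Suc i) y = A_fps N i y * H_fps i (- y)"
    using assms by (simp add: A_rec mult.assoc H_inverse)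
  then have "A_fps N i x * A_fps N (Suc i) y = (A_fps N i x * A_fps N i y) * H_fps i (- y)"
    by (simp only: mult.assoc)
  also have "\<dots> = A_fps N i y * A_fps N i x * H_fps i (- y)" by (simp only: A_comm[OF assms(1)])
  also have "\<dots> = A_fps N i y * A_fps N (Suc i) x * (H_fps i x * H_fps i (- y))"
    using assms(2) by (simp only: A_rec[of i N x] mult.assoc)
  finally show ?thesis by (simp add: H_add)
qed

text \<open>The effect of s_i on the z variables; the parameter of the extra factor is the divisor
  of the i-th divided difference.\<close>

lemma SS_exchange:
  assumes "1 \<le> i" "Suc i \<le> N"
  shows "S_fps N z = S_fps N (z \<circ> transpose i (Suc i)) * H_fps i (z i - z (Suc i))"
proof -
  let ?P = "\<lambda>z. prod_list (map (\<lambda>j. A_fps N j (z j)) [1..<i])"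
  let ?Q = "\<lambda>z. prod_list (map (\<lambda>j. A_fps N j (z j)) [Suc (Suc i)..<Suc N])"
  let ?z = "z \<circ> transpose i (Suc i)"
  have PQ: "?P ?z = ?P z" "?Q ?z = ?Q z"
    by (rule arg_cong[where f = prod_list]; rule map_cong; auto simp: transpose_def simp del: upt_Suc)+
  have "S_fps N ?z * H_fps i (z i - z (Suc i)) =
      ?P z * (A_fps N i (z (Suc i)) * A_fps N (Suc i) (z i)) * (?Q z * H_fps i (z i - z (Suc i)))"
    by (simp only: SS_split[OF assms] PQ mult.assoc) (simp add: transpose_def)
  also have "?Q z * H_fps i (z i - z (Suc i)) = H_fps i (z i - z (Suc i)) * ?Q z"
    by (rule H_prod_A_comm[symmetric]) (auto simp del: upt_Suc)
  also have "?P z * (A_fps N i (z (Suc i)) * A_fps N (Suc i) (z i)) * (H_fps i (z i - z (Suc i)) * ?Q z) =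
      ?P z * (A_fps N i (z (Suc i)) * A_fps N (Suc i) (z i) * H_fps i (z i - z (Suc i))) * ?Q z"
    by (simp only: mult.assoc)
  also have "\<dots> = S_fps N z"
    using assms by (simp only: A_exchange[symmetric] SS_split[OF assms, of z])
  finally show ?thesis by (rule sym)
qed

text \<open>In C(z_1) A_1(-z_1) the increasing half of C cancels, which leaves A_1(z_1) h_0(2 z_1);
  then h_0 passes the later rows, whose letters are at least 2. Up to sign 2 z_1 is the divisor for
  \<open>i = 0\<close>.\<close>

lemma C_SS:
  assumes "1 \<le> N"
  shows "C_fps N (z 1) * S_fps N (z(1 := - z 1)) = S_fps N z * H_fps 0 (z 1 + z 1)"
proof -
  let ?Q = "\<lambda>z. prod_list (map (\<lambda>j. A_fps N j (z j)) [2..<Suc N])"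
  have S: "S_fps N z = A_fps N 1 (z 1) * ?Q z" for z
    using assms unfolding S_fps_def by (simp add: upt_conv_Cons numeral_2_eq_2 del: upt_Suc)
  have Q: "?Q (z(1 := - z 1)) = ?Q z"
    by (rule arg_cong[where f = prod_list]; rule map_cong; auto simp del: upt_Suc)
  have "C_fps N (z 1) * S_fps N (z(1 := - z 1)) =
      A_fps N 1 (z 1) * H_fps 0 (z 1 + z 1) * (A_fps' N 1 (z 1) * A_fps N 1 (- z 1)) * ?Q z"
    by (simp only: S Q C_fps_def mult.assoc fun_upd_same)
  also have "\<dots> = A_fps N 1 (z 1) * (H_fps 0 (z 1 + z 1) * ?Q z)"
    using A_A'_inverse[of N 1 "z 1"] by (simp add: mult.assoc)
  also have "H_fps 0 (z 1 + z 1) * ?Q z = ?Q z * H_fps 0 (z 1 + z 1)"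
    by (rule H_prod_A_comm) (auto simp del: upt_Suc)
  finally show ?thesis by (simp only: S mult.assoc)
qed

lemma G_C_coeff_comm: assumes "1 \<le> N" shows "G_fps N p $ m * C_coeff N j = C_coeff N j * G_fps N p $ m"
proof (induction m rule: less_induct)
  case (less m)
  show ?case
  proof (cases "m = 0")
    case False
    have *: "(sc (p k) * log_C N k * G_fps N p $ (m - k)) * C_coeff N j = C_coeff N j * (sc (p k) * log_C N k * G_fps N p $ (m - k))"
      if "k \<in> {1..m}" for k
    proof -
      have "(sc (p k) * log_C N k * G_fps N p $ (m - k)) * C_coeff N j = sc (p k) * (log_C N k * C_coeff N j) * G_fps N p $ (m - k)"
        using less[of "m - k"] that by (simp add: mult.assoc)
      also have "\<dots> = (sc (p k) * C_coeff N j) * (log_C N k * G_fps N p $ (m - k))"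
        by (simp only: log_C_comm[OF assms] mult.assoc)
      also have "sc (p k) * C_coeff N j = C_coeff N j * sc (p k)" by (simp only: sc_comm)
      finally show ?thesis by (simp only: mult.assoc)
    qed
    let ?s = "\<Sum>k=1..m. sc (p k) * log_C N k * G_fps N p $ (m - k)"
    have s: "?s * C_coeff N j = C_coeff N j * ?s"
      unfolding sum_distrib_left sum_distrib_right by (rule sum.cong[OF refl *])
    have "G_fps N p $ m * C_coeff N j = (sc (Const (1 / of_nat m)) * ?s) * C_coeff N j"
      by (simp only: G_nth_rec[OF False])
    also have "\<dots> = sc (Const (1 / of_nat m)) * (?s * C_coeff N j)" by (rule mult.assoc)
    also have "?s * C_coeff N j = C_coeff N j * ?s" by (rule s)
    also have "sc (Const (1 / of_nat m)) * (C_coeff N j * ?s) = (sc (Const (1 / of_nat m)) * C_coeff N j) * ?s"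
      by (rule mult.assoc[symmetric])
    also have "sc (Const (1 / of_nat m)) * C_coeff N j = C_coeff N j * sc (Const (1 / of_nat m))"
      by (rule sc_comm[symmetric])
    also have "\<dots> * ?s = C_coeff N j * (sc (Const (1 / of_nat m)) * ?s)" by (rule mult.assoc)
    finally show ?thesis by (simp only: G_nth_rec[OF False])
  qed (simp add: G_nth_0)
qed

lemma G_C_comm: assumes "1 \<le> N" shows "G_fps N p * C_fps N x = C_fps N x * G_fps N p"
proof (rule fps_ext)
  fix m
  have t: "G_fps N p $ (m - i) * (sc (x ^ i) * C_coeff N i) = (sc (x ^ i) * C_coeff N i) * G_fps N p $ (m - i)" for i
    using sc_mult_interchange[of 1 "G_fps N p $ (m - i)" "x ^ i" "C_coeff N i"] G_C_coeff_comm[OF assms]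
    by (simp add: sc_simps mult.assoc)
  have "(G_fps N p * C_fps N x) $ m = (\<Sum>i=0..m. G_fps N p $ i * (sc (x ^ (m - i)) * C_coeff N (m - i)))"
    by (simp only: fps_mult_nth C_nth)
  also have "\<dots> = (\<Sum>i=0..m. G_fps N p $ (m - i) * (sc (x ^ i) * C_coeff N i))"
    by (subst sum.atLeastAtMost_rev) (rule sum.cong; simp)
  also have "\<dots> = (C_fps N x * G_fps N p) $ m"
    by (simp only: fps_mult_nth C_nth t)
  finally show "(G_fps N p * C_fps N x) $ m = (C_fps N x * G_fps N p) $ m" .
qed

section \<open>The generating function and its coefficients\<close>

definition p_var :: "nat \<Rightarrow> mpoly" where
  "p_var k = (if odd k then Var (P k) else 0)"

definition z_var :: "nat \<Rightarrow> mpoly" where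
  "z_var i = Var (Z i)"

definition T_fps :: "nat \<Rightarrow> (nat \<Rightarrow> mpoly) \<Rightarrow> (nat \<Rightarrow> mpoly) \<Rightarrow> op fps" where
  "T_fps N p z = G_fps N p * S_fps N z"

text \<open>The unit of the nilCoxeter algebra as a coefficient function.\<close>

definition delta :: coeff_fun where
  "delta w = (if w = id then 1 else 0)"

text \<open>The basis element of \<open>w\<close> sits in length degree \<open>len w\<close>, so its
  coefficient is read off there.\<close>

definition coef :: "op fps \<Rightarrow> (int \<Rightarrow> int) \<Rightarrow> mpoly" where
  "coef F w = app (F $ len w) delta w"

lemma mult_H_nth: "(F * H_fps i x) $ m = F $ m + (if m = 0 then 0 else sc x * (F $ (m - 1) * nil_u i))"
proof -
  have s: "F * H_fps i x = F + F * (fps_const (sc x * nil_u i)) * fps_X"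
    by (simp add: H_fps_def scal_def nil_v_def distrib_left mult.assoc flip: fps_const_mult)
  have "F $ k * (sc x * nil_u i) = sc x * (F $ k * nil_u i)" for k
    by (metis sc_comm mult.assoc)
  then show ?thesis unfolding s by (simp add: fps_mult_fps_X_commute[symmetric] fps_X_mult_nth fps_mult_right_const_nth)
qed

lemma mult_H_nth_nil_u: "(F * H_fps i x) $ m * nil_u i = F $ m * nil_u i"
  by (simp add: mult_H_nth distrib_right mult.assoc nil_u_square)

text \<open>\<open>nil_u i\<close> squares to 0, so F and F h_i(x) agree after multiplication by
  \<open>nil_u i\<close>. The difference can therefore be written with a coefficient of F h_i(x),
  which gives it the shape of a divided difference.\<close>

lemma coef_mult_H:
  assumes "w \<in> BC_inf"
  shows "coef (F * H_fps i x) w - coef F w = (if desc w i then x * coef (F * H_fps i x) (w \<circ> sgen i) else 0)"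
proof (cases "len w = 0")
  case True
  then have "w = id" using len_eq_0_iff[OF assms] by simp
  then have "\<not> desc w i" by (simp add: desc_def)
  then show ?thesis using True by (simp add: coef_def H_nth)
next
  case False
  have "coef (F * H_fps i x) w - coef F w = x * app (F $ (len w - 1) * nil_u i) delta w"
    using False by (simp add: coef_def mult_H_nth app_simps sc_comm[symmetric] app_sc_mult del: app_simps(6))
  also have "\<dots> = x * app ((F * H_fps i x) $ (len w - 1) * nil_u i) delta w"
    by (simp only: mult_H_nth_nil_u)
  also have "\<dots> = (if desc w i then x * coef (F * H_fps i x) (w \<circ> sgen i) else 0)"
    using assms len_desc[OF assms, of i] by (simp add: app_simps app_nil_u coef_def)
  finally show ?thesis .
qed

lemma coef_hom:
  assumes "alg_hom \<phi>" "rel_fps (hom_rel \<phi>) 0 F F'"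
  shows "\<phi> (coef F w) = coef F' w"
proof -
  have "hom_rel \<phi> 0 delta delta" by (simp add: hom_rel_def delta_def alg_hom_simps[OF assms(1)])
  then have "hom_rel \<phi> (0 + 0 * len w) (app (F $ len w) delta) (app (F' $ len w) delta)"
    using assms(2) unfolding rel_fps_def rel_op_def by blast
  then show ?thesis by (simp add: hom_rel_def coef_def)
qed

lemma rel_fps_hom_TT:
  assumes "alg_hom \<phi>"
  shows "rel_fps (hom_rel \<phi>) 0 (T_fps N p z) (T_fps N (\<lambda>k. \<phi> (p k)) (\<lambda>i. \<phi> (z i)))"
proof -
  note Q = graded_rel_hom[OF assms]
  have "rel_op (hom_rel \<phi>) 0 (sc (Const a)) (sc (Const a))" for a
    using rel_op_hom[OF assms, of 0 "Const a"] by (simp add: alg_hom_simps[OF assms])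
  then show ?thesis unfolding T_fps_def
    by (intro rel_fps_mult[OF Q] rel_fps_G[OF Q] rel_fps_SS[OF Q] rel_op_e[OF Q] rel_fps_C[OF Q] rel_op_hom[OF assms])
qed

lemma coef_hom_TT:
  "alg_hom \<phi> \<Longrightarrow> \<phi> (coef (T_fps N p z) w) = coef (T_fps N (\<lambda>k. \<phi> (p k)) (\<lambda>i. \<phi> (z i))) w"
  by (rule coef_hom[OF _ rel_fps_hom_TT])

text \<open>The candidate for C_w built from the letters 0, ..., N; \<open>C_rank_stable\<close>
  removes the dependence on \<open>N\<close>.\<close>

definition C_rank :: "nat \<Rightarrow> (int \<Rightarrow> int) \<Rightarrow> mpoly" where
  "C_rank N w = coef (T_fps N p_var z_var) w"

lemma act_C_rank: "act i (C_rank N w) = coef (T_fps N (\<lambda>k. act i (p_var k)) (\<lambda>j. act i (z_var j))) w"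
  unfolding C_rank_def act_def by (rule coef_hom_TT[OF alg_hom_subst])

text \<open>Only odd entries of \<open>p\<close> enter, by \<open>G_cong_odd\<close>. This allows
  \<open>p_var\<close> to be 0 at even indices, where the ring has no generator.\<close>

lemma TT_cong:
  assumes "1 \<le> N" "\<And>k. odd k \<Longrightarrow> p k = q k" "\<And>i. 1 \<le> i \<Longrightarrow> z i = z' i"
  shows "T_fps N p z = T_fps N q z'"
proof -
  have "S_fps N z = S_fps N z'"
    unfolding S_fps_def by (rule arg_cong[where f = prod_list], rule map_cong) (use assms(3) in auto)
  then show ?thesis using G_cong_odd[OF assms(1,2)] by (simp add: T_fps_def)
qed

lemma divisor_C_rank:
  assumes w: "w \<in> BC_inf" and N: "1 \<le> N" "Suc i \<le> N"
  shows "divisor i * (if desc w i then C_rank N (w \<circ> sgen i) else 0) = C_rank N w - act i (C_rank N w)"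
proof (cases "i = 0")
  case False
  have "act i (C_rank N w) = coef (T_fps N p_var (z_var \<circ> transpose i (Suc i))) w"
    unfolding act_C_rank using False N(1)
    by (intro arg_cong2[where f = coef] TT_cong refl)
       (auto simp: p_var_def z_var_def act_simps gr0_conv_Suc)
  moreover have "T_fps N p_var z_var =
      T_fps N p_var (z_var \<circ> transpose i (Suc i)) * H_fps i (z_var i - z_var (Suc i))"
    unfolding T_fps_def using SS_exchange[of i N z_var] False N(2) by (simp add: mult.assoc)
  moreover have "divisor i = z_var i - z_var (Suc i)"
    using False by (simp add: divisor_def z_var_def)
  ultimately show ?thesis
    using coef_mult_H[OF w, of "T_fps N p_var (z_var \<circ> transpose i (Suc i))" i "z_var i - z_var (Suc i)"]
    by (simp add: C_rank_def)
next
  case True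
  have "T_fps N (\<lambda>k. act 0 (p_var k)) (\<lambda>j. act 0 (z_var j)) =
      T_fps N (\<lambda>k. p_var k + z_var 1 ^ k) (z_var(1 := - z_var 1))"
    by (intro TT_cong N(1)) (auto simp: p_var_def z_var_def act_simps)
  also have "\<dots> = (C_fps N (z_var 1) * G_fps N p_var) * S_fps N (z_var(1 := - z_var 1))"
    unfolding T_fps_def C_mult_G[OF N(1)] ..
  also have "\<dots> = G_fps N p_var * (C_fps N (z_var 1) * S_fps N (z_var(1 := - z_var 1)))"
    by (simp only: G_C_comm[OF N(1), symmetric] mult.assoc)
  also have "\<dots> = T_fps N p_var z_var * H_fps 0 (z_var 1 + z_var 1)"
    by (simp only: C_SS[OF N(1)] T_fps_def mult.assoc)
  finally have act: "act 0 (C_rank N w') = coef (T_fps N p_var z_var * H_fps 0 (z_var 1 + z_var 1)) w'" for w'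
    by (simp only: act_C_rank)
  \<comment> \<open>\<open>act 0\<close> turns T into T h_0(y), and T comes back from it through
    h_0(-y); this reversal produces the sign in the divisor -2 z_1.\<close>
  define T y where "T = T_fps N p_var z_var" and "y = z_var 1 + z_var 1"
  have T: "T * H_fps 0 y * H_fps 0 (- y) = T" by (simp add: mult.assoc H_inverse)
  have "C_rank N w - act 0 (C_rank N w) = coef T w - coef (T * H_fps 0 y) w"
    by (simp only: act) (simp only: C_rank_def T_def y_def)
  also have "\<dots> = (if desc w 0 then - y * coef T (w \<circ> sgen 0) else 0)"
    using coef_mult_H[OF w, of "T * H_fps 0 y" 0 "- y"] by (simp only: T)
  also have "\<dots> = divisor 0 * (if desc w 0 then C_rank N (w \<circ> sgen 0) else 0)"
    by (simp add: divisor_def z_var_def y_def T_def C_rank_def)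
  finally show ?thesis using True by simp
qed

lemma C_rank_zp_deg: "C_rank N w \<in> zp_deg (len w)"
proof -
  have Q: "graded_rel deg_rel" by (rule graded_rel_deg)
  have p: "rel_op deg_rel (1 * k) (sc (p_var k)) (sc (p_var k))" for k
  proof -
    have "p_var k \<in> zp_deg k"
      using hom_deg_Var[of "P k"]
      by (auto simp: p_var_def zp_deg_def zp_ring_eq vars_in_0 hom_deg_0 intro!: vars_in_Var)
    then show ?thesis by (simp add: rel_op_deg)
  qed
  have z: "rel_op deg_rel 1 (sc (z_var i)) (sc (z_var i))" if "1 \<le> i" for i
  proof -
    have "z_var i \<in> zp_deg 1"
      using that hom_deg_Var[of "Z i"] by (auto simp: z_var_def zp_deg_def zp_ring_eq intro!: vars_in_Var)
    then show ?thesis by (rule rel_op_deg)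
  qed
  have "rel_fps deg_rel 1 (T_fps N p_var z_var) (T_fps N p_var z_var)"
    unfolding T_fps_def
    by (intro rel_fps_mult[OF Q] rel_fps_G[OF Q] rel_fps_SS[OF Q] rel_op_e[OF Q] rel_fps_C[OF Q]
        p z rel_op_Const[OF Q])
  moreover have "deg_rel 0 delta delta"
    using zp_deg_Const[of 0] zp_deg_Const[of 1] by (simp add: deg_rel_def delta_def Const_0 Const_1)
  ultimately have "deg_rel (0 + 1 * len w) (app (T_fps N p_var z_var $ len w) delta) (app (T_fps N p_var z_var $ len w) delta)"
    unfolding rel_fps_def rel_op_def by blast
  then show ?thesis by (simp add: deg_rel_def C_rank_def coef_def)
qed

lemma coef_BC:
  assumes "w \<in> BC n" "rel_fps (BC_rel n) 0 F F'" shows "coef F w = coef F' w"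
proof -
  have "BC_rel n 0 delta delta" by (simp add: BC_rel_def)
  then have "BC_rel n (0 + 0 * len w) (app (F $ len w) delta) (app (F' $ len w) delta)"
    using assms(2) unfolding rel_fps_def rel_op_def by blast
  then show ?thesis using assms(1) by (simp add: BC_rel_def coef_def)
qed

lemma C_rank_Suc: assumes "w \<in> BC n" "n \<le> Suc N" shows "C_rank (Suc N) w = C_rank N w"
  unfolding C_rank_def T_fps_def
  by (rule coef_BC[OF assms(1)])
     (intro rel_fps_mult[OF graded_rel_BC] rel_fps_BC_G rel_fps_BC_SS assms(2))

lemma C_rank_stable: assumes "w \<in> BC n" "n \<le> M" "M \<le> N" shows "C_rank N w = C_rank M w"
  using assms(3)
proof (induction rule: dec_induct)
  case (step N)
  then show ?case using C_rank_Suc[OF assms(1), of N] assms(2) by simp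
qed simp

section \<open>Existence of the family\<close>

definition C_rank_family :: "(int \<Rightarrow> int) \<Rightarrow> mpoly" where
  "C_rank_family = restrict (\<lambda>w. C_rank (LEAST n. w \<in> BC n) w) BC_inf"

text \<open>Taking the least rank is a mere choice: by stability every rank whose group contains
  \<open>w\<close> gives the same value.\<close>

lemma C_rank_family_eq: assumes "w \<in> BC n" shows "C_rank_family w = C_rank n w"
proof -
  define m where "m = (LEAST n. w \<in> BC n)"
  have "w \<in> BC m" unfolding m_def using assms by (rule LeastI)
  moreover have "m \<le> n" unfolding m_def using assms by (rule Least_le)
  ultimately have "C_rank n w = C_rank m w" by (rule C_rank_stable[OF _ order_refl])
  then show ?thesis
    using BC_inf_I[OF assms] unfolding C_rank_family_def m_def by (simp only: restrict_apply if_True)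
qed

lemma SS_nth_0: "S_fps N z $ 0 = 1"
  unfolding S_fps_def A_fps_def by (intro prod_list_nth_0) (simp add: H_nth)

lemma C_rank_id: "C_rank N id = 1"
proof -
  have "T_fps N p_var z_var $ 0 = 1"
    unfolding T_fps_def fps_mult_nth_0 G_nth_0 SS_nth_0 by simp
  then show ?thesis
    unfolding C_rank_def coef_def len_id by (simp only: app_simps delta_def refl if_True)
qed

lemma schubert_C_family_C_rank: "schubert_C_family C_rank_family"
  unfolding schubert_C_family_def
proof (intro conjI ballI allI)
  show "C_rank_family \<in> BC_inf \<rightarrow>\<^sub>E zp_ring \<inter> homogeneous"
  proof
    fix w assume "w \<in> BC_inf"
    then obtain n where "w \<in> BC n" by (auto simp: BC_inf_def)
    then show "C_rank_family w \<in> zp_ring \<inter> homogeneous"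
      using C_rank_zp_deg[of n w] by (auto simp: C_rank_family_eq zp_deg_def homogeneous_eq)
  qed (simp add: C_rank_family_def)
  show "C_rank_family id = 1" by (simp only: C_rank_family_eq[OF id_BC[of 0]] C_rank_id)
  fix w i assume w: "w \<in> BC_inf"
  then obtain n where n: "Suc i \<le> n" "w \<in> BC n" by (rule BC_inf_obtain)
  have ws: "w \<circ> sgen i \<in> BC n" using n by (intro BC_comp sgen_BC) simp_all
  have "divdiff i (C_rank n w) = (if desc w i then C_rank n (w \<circ> sgen i) else 0)"
    by (rule divdiff_eqI[OF divisor_C_rank[OF w]]) (use n in simp_all)
  then show "divdiff i (C_rank_family w) =
      (if len (w \<circ> sgen i) < len w then C_rank_family (w \<circ> sgen i) else 0)"
    using desc_iff_len[OF w] by (simp add: C_rank_family_eq[OF n(2)] C_rank_family_eq[OF ws])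
qed

section \<open>Uniqueness of the family\<close>

lemma schubert_C_family_divisor:
  assumes "schubert_C_family F" "w \<in> BC_inf"
  shows "divisor i * (if desc w i then F (w \<circ> sgen i) else 0) = F w - act i (F w)"
proof -
  have "F w \<in> zp_ring" using assms by (auto simp: schubert_C_family_def)
  \<comment> \<open>Divisibility guarantees that \<open>divdiff\<close> denotes an actual quotient,
    so the axioms of the family become equations between polynomials.\<close>
  then have "divisor i dvd F w - act i (F w)" by (rule divisor_dvd)
  then obtain g where g: "F w - act i (F w) = divisor i * g" by (rule dvdE)
  then have "divdiff i (F w) = g" by (intro divdiff_eqI) simp
  then have "g = (if desc w i then F (w \<circ> sgen i) else 0)"
    using assms desc_iff_len[OF assms(2)] by (simp add: schubert_C_family_def)
  then show ?thesis using g by simp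
qed

lemma act_Const: "act i (Const a) = Const a"
  by (rule act_simps)

lemma schubert_C_family_nonzero:
  assumes "schubert_C_family F" "w \<in> BC_inf"
  shows "F w \<noteq> 0"
  using assms(2)
proof (induction "len w" arbitrary: w rule: less_induct)
  case less
  show ?case
  proof (cases "w = id")
    case True
    then show ?thesis using assms(1) by (simp add: schubert_C_family_def)
  next
    case False
    then obtain i where i: "desc w i" using ex_desc less by blast
    then have "F (w \<circ> sgen i) \<noteq> 0"
      using less comp_sgen_BC_inf_iff len_desc by simp
    then have "F w - act i (F w) \<noteq> 0"
      using schubert_C_family_divisor[OF assms(1) less(2), of i] i divisor_nonzero by auto
    then show ?thesis using act_Const[of i 0] by (auto simp: Const_0)
  qed
qed

text \<open>Homogeneity leaves the degree open. A nonzero constant term would make it 0, so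
  \<open>F w\<close> would be constant with all divided differences 0, whereas at a descent the
  divided difference is a nonzero member of the family.\<close>

lemma schubert_C_family_lookup_0:
  assumes F: "schubert_C_family F" and w: "w \<in> BC_inf" "w \<noteq> id"
  shows "Poly_Mapping.lookup (F w) 0 = 0"
proof (rule ccontr)
  assume nz: "Poly_Mapping.lookup (F w) 0 \<noteq> 0"
  obtain i where i: "desc w i" using ex_desc[OF w] by blast
  have zp: "F w \<in> zp_ring" and "F w \<in> homogeneous"
    using F w by (auto simp: schubert_C_family_def)
  then obtain d where d: "F w \<in> hom_deg d" by (auto simp: homogeneous_eq)
  have "0 \<in> Poly_Mapping.keys (F w)" using nz by (simp add: in_keys_iff)
  then have "mdeg 0 = d" using d unfolding hom_deg_def by blast
  then have "d = 0" by (simp add: mdeg_def)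
  have "m = 0" if m: "m \<in> Poly_Mapping.keys (F w)" for m
  proof -
    have "mdeg m = 0" using m d \<open>d = 0\<close> by (simp add: hom_deg_def)
    then have zero: "\<forall>x\<in>Poly_Mapping.keys m. Poly_Mapping.lookup m x * var_degree x = 0"
      unfolding mdeg_def by (subst (asm) sum_eq_0_iff) simp_all
    have pos: "0 < var_degree x" if "x \<in> Poly_Mapping.keys m" for x
    proof -
      have "x \<in> {Z i | i. 1 \<le> i} \<union> {P k | k. odd k}"
        using zp m that unfolding zp_ring_eq vars_in_def by blast
      then show ?thesis by (auto elim: oddE)
    qed
    show ?thesis
    proof (rule poly_mapping_eqI)
      fix x
      show "Poly_Mapping.lookup m x = Poly_Mapping.lookup 0 x"
      proof (cases "x \<in> Poly_Mapping.keys m")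
        case True
        then have "Poly_Mapping.lookup m x * var_degree x = 0" using zero by blast
        then show ?thesis using pos[OF True] by simp
      qed (simp add: in_keys_iff)
    qed
  qed
  then have "Poly_Mapping.keys (F w) \<subseteq> {0}" by blast
  then have "F w \<in> vars_in {}" by (auto simp: vars_in_def)
  then have "act i (F w) = F w"
    by (induction rule: mpoly_induct) (simp_all add: act_simps)
  then have "divisor i * F (w \<circ> sgen i) = 0"
    using schubert_C_family_divisor[OF F w(1), of i] i by simp
  then show False
    using divisor_nonzero schubert_C_family_nonzero[OF F] comp_sgen_BC_inf_iff w(1) by auto
qed

text \<open>By induction on the length both members have the same divided differences. Their
  difference is then invariant, so constant, and the constant terms are 0.\<close>

lemma schubert_C_family_unique:
  assumes F: "schubert_C_family F" and F': "schubert_C_family F'"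
  shows "F = F'"
proof
  fix w
  show "F w = F' w"
  proof (cases "w \<in> BC_inf")
    case False
    then have arb: "L w = undefined" if "schubert_C_family L" for L
      using that PiE_arb[of L BC_inf "\<lambda>_. zp_ring \<inter> homogeneous" w]
      unfolding schubert_C_family_def by blast
    show ?thesis using arb[OF F] arb[OF F'] by simp
  next
    case True
    then show ?thesis
    proof (induction "len w" arbitrary: w rule: less_induct)
      case less
      show ?case
      proof (cases "w = id")
        case True
        then show ?thesis using F F' by (simp add: schubert_C_family_def)
      next
        case False
        have "act i (F w - F' w) = F w - F' w" for i
        proof -
          have "(if desc w i then F (w \<circ> sgen i) else 0) = (if desc w i then F' (w \<circ> sgen i) else 0)"
            using less(1)[of "w \<circ> sgen i"] less(2) len_desc[OF less(2), of i] comp_sgen_BC_inf_iff by simp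
          then have "F w - act i (F w) = F' w - act i (F' w)"
            using schubert_C_family_divisor[OF F less(2), of i]
              schubert_C_family_divisor[OF F' less(2), of i] by simp
          then show ?thesis by (simp add: act_simps algebra_simps)
        qed
        moreover have "F w - F' w \<in> zp_ring"
        proof -
          have "F w \<in> zp_ring" "F' w \<in> zp_ring"
            using F F' less(2) by (auto simp: schubert_C_family_def)
          then show ?thesis
            using vars_in_add[of "F w" _ "- F' w"] vars_in_uminus[of "F' w"] by (simp add: zp_ring_eq)
        qed
        ultimately obtain a where a: "F w - F' w = Const a" using invariant_Const by blast
        have "a = Poly_Mapping.lookup (F w - F' w) 0" by (simp add: a Const_def)
        also have "\<dots> = 0"
          using schubert_C_family_lookup_0[OF F less(2) False] schubert_C_family_lookup_0[OF F' less(2) False]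
          by (simp add: lookup_minus)
        finally show ?thesis using a by (simp add: Const_0)
      qed
    qed
  qed
qed

lemma schubert_C_eq: assumes "w \<in> BC n" shows "schubert_C w = C_rank n w"
proof -
  have "schubert_C = C_rank_family"
    unfolding schubert_C_def
    by (rule the_equality) (use schubert_C_family_C_rank schubert_C_family_unique in blast)+
  then show ?thesis by (simp add: C_rank_family_eq[OF assms])
qed

lemma truncate_schubert_C:
  assumes "w \<in> BC n" "1 \<le> n"
  shows "truncate k (schubert_C w) =
    coef (prod_list (map (\<lambda>i. C_fps n (Var (X i))) (rev [1..<k + 1])) * S_fps n z_var) w"
proof -
  have "truncate k (schubert_C w) = coef (T_fps n (\<lambda>j. truncate k (p_var j)) (\<lambda>i. truncate k (z_var i))) w"
    unfolding schubert_C_eq[OF assms(1)] C_rank_def truncate_def by (rule coef_hom_TT[OF alg_hom_subst])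
  also have "T_fps n (\<lambda>j. truncate k (p_var j)) (\<lambda>i. truncate k (z_var i)) =
      T_fps n (\<lambda>j. \<Sum>i=1..k. Var (X i) ^ j) z_var"
    by (intro TT_cong assms(2)) (simp_all add: truncate_def p_var_def z_var_def subst_Var)
  finally show ?thesis by (simp only: T_fps_def G_power_sums[OF assms(2)])
qed

section \<open>Expansion over words and pipe dreams\<close>

definition uword :: "nat list \<Rightarrow> op" where
  "uword a = prod_list (map nil_u a)"

text \<open>A product of generators is a basis element if the word is reduced and 0
  otherwise.\<close>

lemma app_uword: "w \<in> BC_inf \<Longrightarrow> app (uword a) delta w = (if a \<in> R w then 1 else 0)"
proof (induction a arbitrary: w rule: rev_induct)
  case Nil
  then show ?case by (simp add: uword_def app_simps delta_def Nil_R_iff)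
next
  case (snoc i a)
  have "uword (a @ [i]) = uword a * nil_u i" by (simp add: uword_def)
  then have "app (uword (a @ [i])) delta w = (if desc w i then app (uword a) delta (w \<circ> sgen i) else 0)"
    using snoc.prems by (simp add: app_simps app_nil_u)
  moreover have "w \<circ> sgen i \<in> BC_inf" using snoc.prems by (simp only: comp_sgen_BC_inf_iff)
  ultimately show ?case
    using snoc.IH[of "w \<circ> sgen i"] snoc_R_iff[OF snoc.prems, of a i] by (simp add: comp_def)
qed

definition words :: "nat \<Rightarrow> nat \<Rightarrow> nat list set" where
  "words N m = {a. set a \<subseteq> {..N} \<and> length a = m}"

lemma finite_words: "finite (words N m)"
  unfolding words_def by (rule finite_lists_length_eq) simp

text \<open>Such a \<open>g\<close> is not unique: different words can have the same product, and
  words that are not reduced have product 0.\<close>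

definition rep :: "nat \<Rightarrow> op fps \<Rightarrow> (nat list \<Rightarrow> mpoly) \<Rightarrow> bool" where
  "rep N F g \<longleftrightarrow> (\<forall>m. F $ m = (\<Sum>a\<in>words N m. sc (g a) * uword a))"

text \<open>Multiplication of series on the level of word coefficients, see \<open>rep_mult\<close>:
  a convolution over all cuts of the word.\<close>

definition wconv :: "(nat list \<Rightarrow> mpoly) \<Rightarrow> (nat list \<Rightarrow> mpoly) \<Rightarrow> nat list \<Rightarrow> mpoly" where
  "wconv f g a = (\<Sum>i=0..length a. f (take i a) * g (drop i a))"

lemma coef_rep:
  assumes "rep N F g" "w \<in> BC (Suc N)"
  shows "coef F w = (\<Sum>a\<in>R w. g a)"
proof -
  have w: "w \<in> BC_inf" using assms(2) by (rule BC_inf_I)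
  have "coef F w = (\<Sum>a\<in>words N (len w). g a * app (uword a) delta w)"
    using assms(1) unfolding rep_def coef_def
    by (simp only: app_sum sc_comm[symmetric] app_sc_mult)
  also have "\<dots> = (\<Sum>a\<in>words N (len w). if a \<in> R w then g a else 0)"
    by (rule sum.cong) (simp_all add: app_uword[OF w])
  also have "\<dots> = (\<Sum>a\<in>words N (len w) \<inter> R w. g a)"
    by (rule sum.inter_restrict[symmetric, OF finite_words])
  also have "words N (len w) \<inter> R w = R w"
    using R_letters[OF assms(2)] R_length by (fastforce simp: words_def)
  finally show ?thesis .
qed

lemma rep_1: "rep N 1 (\<lambda>a. if a = [] then 1 else 0)"
  unfolding rep_def
proof
  fix m
  show "(1 :: op fps) $ m = (\<Sum>a\<in>words N m. sc (if a = [] then 1 else 0) * uword a)"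
  proof (cases "m = 0")
    case True
    have "words N 0 = {[]}" by (auto simp: words_def)
    then show ?thesis using True by (simp add: uword_def sc_simps)
  next
    case False
    have "(\<Sum>a\<in>words N m. sc (if a = [] then 1 else 0) * uword a) = 0"
      by (rule sum.neutral) (use False in \<open>auto simp: words_def sc_simps\<close>)
    then show ?thesis using False by simp
  qed
qed

lemma rep_H:
  assumes "i \<le> N"
  shows "rep N (H_fps i x) (\<lambda>a. if a = [] then 1 else if a = [i] then x else 0)"
  unfolding rep_def
proof
  fix m
  let ?g = "\<lambda>a. if a = [] then 1 else if a = [i] then x else (0 :: mpoly)"
  show "H_fps i x $ m = (\<Sum>a\<in>words N m. sc (?g a) * uword a)"
  proof -
    consider "m = 0" | "m = 1" | "1 < m" by linarith
    then show ?thesis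
    proof cases
      case 1
      have "words N 0 = {[]}" by (auto simp: words_def)
      then show ?thesis using 1 by (simp add: uword_def sc_simps H_nth)
    next
      case 2
      have "(\<Sum>a\<in>words N m. sc (?g a) * uword a) = (\<Sum>a\<in>{[i]}. sc (?g a) * uword a)"
        by (rule sum.mono_neutral_right[OF finite_words])
           (use assms 2 in \<open>auto simp: words_def sc_simps\<close>)
      then show ?thesis using 2 by (simp add: uword_def H_nth)
    next
      case 3
      have "(\<Sum>a\<in>words N m. sc (?g a) * uword a) = 0"
        by (rule sum.neutral) (use 3 in \<open>auto simp: words_def sc_simps\<close>)
      then show ?thesis using 3 by (simp add: H_nth)
    qed
  qed
qed

lemma rep_mult:
  assumes "rep N F f" "rep N L g"
  shows "rep N (F * L) (wconv f g)"
  unfolding rep_def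
proof
  fix m
  have *: "F $ i * L $ (m - i) = (\<Sum>a\<in>words N m. sc (f (take i a) * g (drop i a)) * uword a)"
    if i: "i \<in> {0..m}" for i
  proof -
    have "F $ i * L $ (m - i) = (\<Sum>b\<in>words N i. \<Sum>d\<in>words N (m - i). sc (f b * g d) * (uword b * uword d))"
      using assms unfolding rep_def by (simp only: sum_product sc_mult_interchange)
    also have "\<dots> = (\<Sum>(b, d)\<in>words N i \<times> words N (m - i). sc (f b * g d) * uword (b @ d))"
      by (simp add: sum.cartesian_product uword_def)
    also have "\<dots> = (\<Sum>a\<in>words N m. sc (f (take i a) * g (drop i a)) * uword a)"
      by (rule sum.reindex_bij_witness[where i = "\<lambda>a. (take i a, drop i a)" and j = "\<lambda>(b, d). b @ d"])
         (use i in \<open>auto simp: words_def dest: in_set_takeD in_set_dropD\<close>)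
    finally show ?thesis .
  qed
  have "(F * L) $ m = (\<Sum>i=0..m. \<Sum>a\<in>words N m. sc (f (take i a) * g (drop i a)) * uword a)"
    unfolding fps_mult_nth by (rule sum.cong[OF refl *])
  also have "\<dots> = (\<Sum>a\<in>words N m. \<Sum>i=0..m. sc (f (take i a) * g (drop i a)) * uword a)"
    by (rule sum.swap)
  also have "\<dots> = (\<Sum>a\<in>words N m. sc (wconv f g a) * uword a)"
    by (rule sum.cong[OF refl]) (simp add: wconv_def words_def sc_sum sum_distrib_right)
  finally show "(F * L) $ m = (\<Sum>a\<in>words N m. sc (wconv f g a) * uword a)" .
qed

lemma wconv_letter:
  "wconv (\<lambda>a. if a = [] then 1 else if a = [i] then x else 0) g a =
    g a + (if a \<noteq> [] \<and> hd a = i then x * g (tl a) else 0)"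
proof (cases a)
  case Nil
  then show ?thesis by (simp add: wconv_def)
next
  case (Cons j b)
  let ?f = "\<lambda>a. if a = [] then 1 else if a = [i] then x else 0"
  have "wconv ?f g a = g a + (\<Sum>t=0..length b. ?f (j # take t b) * g (drop t b))"
    unfolding wconv_def Cons by (simp add: sum.atLeast0_atMost_Suc_shift del: sum.cl_ivl_Suc)
  also have "(\<Sum>t=0..length b. ?f (j # take t b) * g (drop t b)) =
      (\<Sum>t=0..length b. if t = 0 then (if j = i then x * g b else 0) else 0)"
    by (rule sum.cong) auto
  finally show ?thesis using Cons by simp
qed

lemma wconv_letter_right:
  "wconv g (\<lambda>a. if a = [] then 1 else if a = [i] then x else 0) a =
    g a + (if a \<noteq> [] \<and> last a = i then g (butlast a) * x else 0)"
proof (cases a rule: rev_cases)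
  case Nil
  then show ?thesis by (simp add: wconv_def)
next
  case (snoc b j)
  let ?f = "\<lambda>a. if a = [] then 1 else if a = [i] then x else 0"
  have "wconv g ?f a = (\<Sum>t=0..length b. g (take t b) * ?f (drop t b @ [j])) + g a"
    unfolding wconv_def snoc by simp
  also have "(\<Sum>t=0..length b. g (take t b) * ?f (drop t b @ [j])) =
      (\<Sum>t=0..length b. if t = length b then (if j = i then g b * x else 0) else 0)"
    by (rule sum.cong) auto
  finally show ?thesis using snoc by (simp add: add.commute)
qed

text \<open>For the boxes in reading order, \<open>S\<close> will be the set of boxes with a
  significant element.\<close>

definition subword_sum :: "('b \<Rightarrow> nat) \<Rightarrow> ('b \<Rightarrow> mpoly) \<Rightarrow> 'b list \<Rightarrow> nat list \<Rightarrow> mpoly" where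
  "subword_sum idx wt L a =
     (\<Sum>S\<in>Pow (set L). if map idx (filter (\<lambda>b. b \<in> S) L) = a then \<Prod>b\<in>S. wt b else 0)"

lemma subword_sum_Cons:
  assumes "b \<notin> set L"
  shows "subword_sum idx wt (b # L) a =
    subword_sum idx wt L a + (if a \<noteq> [] \<and> hd a = idx b then wt b * subword_sum idx wt L (tl a) else 0)"
proof -
  let ?t = "\<lambda>S. if map idx (filter (\<lambda>b. b \<in> S) (b # L)) = a then \<Prod>b\<in>S. wt b else 0"
  have disj: "Pow (set L) \<inter> insert b ` Pow (set L) = {}" using assms by auto
  have inj: "inj_on (insert b) (Pow (set L))" using assms by (intro inj_onI) (metis PowD insert_ident subsetD)
  have "subword_sum idx wt (b # L) a = (\<Sum>S\<in>Pow (set L). ?t S) + (\<Sum>S\<in>Pow (set L). ?t (insert b S))"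
    unfolding subword_sum_def
    by (simp add: Pow_insert sum.union_disjoint[OF _ _ disj] sum.reindex[OF inj] del: filter.simps)
  also have "(\<Sum>S\<in>Pow (set L). ?t S) = subword_sum idx wt L a"
    unfolding subword_sum_def by (rule sum.cong) (use assms in auto)
  also have "(\<Sum>S\<in>Pow (set L). ?t (insert b S)) =
      (\<Sum>S\<in>Pow (set L). if a \<noteq> [] \<and> hd a = idx b then
         wt b * (if map idx (filter (\<lambda>b. b \<in> S) L) = tl a then \<Prod>b\<in>S. wt b else 0) else 0)"
  proof (rule sum.cong[OF refl])
    fix S assume "S \<in> Pow (set L)"
    then have S: "finite S" "b \<notin> S" using assms finite_subset by auto
    have "filter (\<lambda>d. d \<in> insert b S) (b # L) = b # filter (\<lambda>d. d \<in> S) L"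
      using assms by (auto intro!: filter_cong)
    then show "?t (insert b S) = (if a \<noteq> [] \<and> hd a = idx b then
         wt b * (if map idx (filter (\<lambda>b. b \<in> S) L) = tl a then \<Prod>b\<in>S. wt b else 0) else 0)"
      using S by (cases a) auto
  qed
  also have "\<dots> = (if a \<noteq> [] \<and> hd a = idx b then wt b * subword_sum idx wt L (tl a) else 0)"
    by (simp add: subword_sum_def sum_distrib_left)
  finally show ?thesis .
qed

lemma rep_subword_sum:
  "distinct L \<Longrightarrow> (\<And>b. b \<in> set L \<Longrightarrow> idx b \<le> N) \<Longrightarrow>
    rep N (prod_list (map (\<lambda>b. H_fps (idx b) (wt b)) L)) (subword_sum idx wt L)"
proof (induction L)
  case Nil
  have "subword_sum idx wt [] = (\<lambda>a. if a = [] then 1 else 0)"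
    by (auto simp: fun_eq_iff subword_sum_def)
  then show ?case by (simp add: rep_1)
next
  case (Cons b L)
  have "rep N (H_fps (idx b) (wt b) * prod_list (map (\<lambda>b. H_fps (idx b) (wt b)) L))
      (wconv (\<lambda>a. if a = [] then 1 else if a = [idx b] then wt b else 0) (subword_sum idx wt L))"
    using Cons by (intro rep_mult rep_H) simp_all
  then show ?case
    using Cons.prems(1) by (simp add: wconv_letter subword_sum_Cons rep_def)
qed

section \<open>Boxes in reading order\<close>

lemma distinct_concat_map:
  assumes "distinct xs" "\<And>x. x \<in> set xs \<Longrightarrow> distinct (f x)"
    "\<And>x y. x \<in> set xs \<Longrightarrow> y \<in> set xs \<Longrightarrow> x \<noteq> y \<Longrightarrow> set (f x) \<inter> set (f y) = {}"
  shows "distinct (concat (map f xs))"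
  using assms
proof (induction xs)
  case (Cons x xs)
  then have "set (f x) \<inter> set (f y) = {}" if "y \<in> set xs" for y using that by auto
  then have "set (f x) \<inter> set (concat (map f xs)) = {}" by auto
  moreover have "distinct (concat (map f xs))" using Cons by auto
  ultimately show ?case using Cons.prems(2)[of x] by simp
qed simp

lemma set_reading: "set (reading n k) = base n k"
proof (rule set_eqI)
  fix b show "b \<in> set (reading n k) \<longleftrightarrow> b \<in> base n k"
    by (cases b) (auto simp: reading_def base_def image_iff simp del: upt_Suc)
qed

lemma distinct_reading: "distinct (reading n k)"
proof -
  have "distinct (concat (map (\<lambda>m. map (Hor m) (rev [1..<n]) @ [Corner m] @ map (Vert m) [1..<n]) (rev [1..<k + 1])))"
    by (rule distinct_concat_map) (auto simp: distinct_map inj_on_def simp del: upt_Suc)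
  moreover have "distinct (concat (map (\<lambda>i. map (Stair i) (rev [1..<n - i + 1])) [1..<n]))"
    by (rule distinct_concat_map) (auto simp: distinct_map inj_on_def simp del: upt_Suc)
  ultimately show ?thesis unfolding reading_def by (auto simp del: upt_Suc)
qed

text \<open>A corner counts twice because C(x) contains h_0(2x), whereas the weight of a pipe dream
  counts it once; \<open>prod_C_weight\<close> collects the surplus powers of 2.\<close>

definition C_weight :: "box \<Rightarrow> mpoly" where
  "C_weight b = (case b of Corner m \<Rightarrow> Var (X m) + Var (X m) | _ \<Rightarrow> Var (box_var b))"

lemma prod_list_concat_map:
  "prod_list (map f (concat (map g xs))) = prod_list (map (\<lambda>x. prod_list (map f (g x))) xs)"
  for f :: "'b \<Rightarrow> 'c :: monoid_mult"
  by (induction xs) simp_all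

lemma map_row_index: "1 \<le> i \<Longrightarrow> map (\<lambda>j. i + j - 1) [1..<n - i + 1] = [i..<n]"
  by (rule nth_equalityI) (auto simp del: upt_Suc)

text \<open>In reading order the block with variable x_m spells the factors of C(x_m), and row i of
  the staircase those of A_i(z_i).\<close>

lemma prod_reading:
  "prod_list (map (\<lambda>b. H_fps (box_index b) (C_weight b)) (reading (Suc N) k)) =
    prod_list (map (\<lambda>i. C_fps N (Var (X i))) (rev [1..<k + 1])) * S_fps N z_var"
proof -
  let ?h = "\<lambda>b. H_fps (box_index b) (C_weight b)"
  have g: "prod_list (map ?h (map (Hor m) (rev [1..<Suc N]) @ [Corner m] @ map (Vert m) [1..<Suc N])) =
      C_fps N (Var (X m))" for m
    by (simp add: C_fps_def A_fps_def A_fps'_def C_weight_def comp_def mult.assoc del: upt_Suc)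
  have s: "prod_list (map ?h (map (Stair i) (rev [1..<Suc N - i + 1]))) = A_fps N i (z_var i)"
    if "i \<in> set [1..<Suc N]" for i
  proof -
    have "map ?h (map (Stair i) (rev [1..<Suc N - i + 1])) =
        rev (map (\<lambda>j. H_fps j (Var (Z i))) (map (\<lambda>j. i + j - 1) [1..<Suc N - i + 1]))"
      by (simp add: C_weight_def rev_map comp_def del: upt_Suc)
    also have "map (\<lambda>j. i + j - 1) [1..<Suc N - i + 1] = [i..<Suc N]"
      by (rule map_row_index) (use that in auto)
    finally show ?thesis by (simp add: A_fps_def z_var_def rev_map del: upt_Suc)
  qed
  have s': "map (\<lambda>i. prod_list (map ?h (map (Stair i) (rev [1..<Suc N - i + 1])))) [1..<Suc N] =
      map (\<lambda>i. A_fps N i (z_var i)) [1..<Suc N]"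
    by (rule map_cong[OF refl s])
  show ?thesis
    unfolding reading_def map_append[of ?h "concat _"] prod_list.append prod_list_concat_map S_fps_def
    by (simp only: g s')
qed

lemma box_index_le: "b \<in> base (Suc N) k \<Longrightarrow> box_index b \<le> N"
  by (auto simp: base_def)

lemma truncate_schubert_C_subsets:
  assumes "w \<in> BC (Suc N)"
  shows "truncate k (schubert_C w) =
    (\<Sum>a\<in>R w. subword_sum box_index C_weight (reading (Suc N) k) a)"
proof -
  have "truncate k (schubert_C w) =
      coef (prod_list (map (\<lambda>i. C_fps (Suc N) (Var (X i))) (rev [1..<k + 1])) * S_fps (Suc N) z_var) w"
    by (rule truncate_schubert_C[OF assms]) simp
  \<comment> \<open>The letter \<open>Suc N\<close> of rank \<open>Suc N\<close> indexes no box; on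
    \<open>BC (Suc N)\<close> the rank \<open>N\<close> gives the same coefficients.\<close>
  also have "\<dots> = coef (prod_list (map (\<lambda>i. C_fps N (Var (X i))) (rev [1..<k + 1])) * S_fps N z_var) w"
    by (rule coef_BC[OF assms])
       (intro rel_fps_mult[OF graded_rel_BC] rel_fps_prod_list[OF graded_rel_BC] rel_fps_BC_C rel_fps_BC_SS order_refl)
  also have "\<dots> = (\<Sum>a\<in>R w. subword_sum box_index C_weight (reading (Suc N) k) a)"
    unfolding prod_reading[symmetric]
    by (rule coef_rep[OF rep_subword_sum[OF distinct_reading] assms]) (simp add: set_reading box_index_le)
  finally show ?thesis .
qed

section \<open>Pipe dreams as sets of boxes\<close>

definition fill :: "nat \<Rightarrow> nat \<Rightarrow> box set \<Rightarrow> box \<Rightarrow> tile" where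
  "fill n k S = restrict (\<lambda>b. case b of Corner m \<Rightarrow> if b \<in> S then Faucet else Single_Elbow
     | _ \<Rightarrow> if b \<in> S then Cross else Double_Elbow) (base n k)"

lemma significant_fill: "S \<subseteq> base n k \<Longrightarrow> b \<in> base n k \<Longrightarrow> significant (fill n k S) b \<longleftrightarrow> b \<in> S"
  by (auto simp: significant_def fill_def split: box.splits)

lemma fill_pipe_dream: "fill n k S \<in> pipe_dreams n k"
  unfolding pipe_dreams_def fill_def by (auto split: box.splits)

lemma fill_significant:
  fixes pd :: "box \<Rightarrow> tile"
  assumes "pd \<in> pipe_dreams n k"
  shows "fill n k {b \<in> base n k. significant pd b} = pd"
proof
  fix b
  show "fill n k {b \<in> base n k. significant pd b} b = pd b"
  proof (cases "b \<in> base n k")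
    case True
    then have "pd b \<in> tiles b" using assms by (auto simp: pipe_dreams_def)
    then show ?thesis using True by (cases b) (auto simp: fill_def significant_def)
  next
    case False
    then show ?thesis using assms PiE_arb[of pd "base n k" tiles b] by (simp add: fill_def pipe_dreams_def)
  qed
qed

text \<open>A filling is determined by its significant boxes, since each box offers one significant
  and one insignificant tile.\<close>

lemma sum_PD:
  "(\<Sum>pd\<in>PD n k w. weight n k pd) =
    (\<Sum>S | S \<subseteq> base n k \<and> map box_index (filter (\<lambda>b. b \<in> S) (reading n k)) \<in> R w.
       \<Prod>b\<in>S. Var (box_var b))"
proof (rule sum.reindex_bij_witness[where i = "fill n k" and j = "\<lambda>pd. {b \<in> base n k. significant pd b}"])
  fix pd assume "pd \<in> PD n k w"
  then have pd: "pd \<in> pipe_dreams n k" "word n k pd \<in> R w" by (auto simp: PD_def)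
  show "fill n k {b \<in> base n k. significant pd b} = pd" by (rule fill_significant[OF pd(1)])
  have "filter (\<lambda>b. b \<in> {b \<in> base n k. significant pd b}) (reading n k) = filter (significant pd) (reading n k)"
    by (rule filter_cong) (auto simp: set_reading)
  then show "{b \<in> base n k. significant pd b} \<in>
      {S. S \<subseteq> base n k \<and> map box_index (filter (\<lambda>b. b \<in> S) (reading n k)) \<in> R w}"
    using pd(2) by (auto simp: word_def)
  show "(\<Prod>b\<in>{b \<in> base n k. significant pd b}. Var (box_var b)) = weight n k pd"
    by (simp add: weight_def)
next
  fix S assume "S \<in> {S. S \<subseteq> base n k \<and> map box_index (filter (\<lambda>b. b \<in> S) (reading n k)) \<in> R w}"
  then have S: "S \<subseteq> base n k" "map box_index (filter (\<lambda>b. b \<in> S) (reading n k)) \<in> R w" by auto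
  show "{b \<in> base n k. significant (fill n k S) b} = S"
    using S(1) significant_fill[OF S(1)] by auto
  have "filter (significant (fill n k S)) (reading n k) = filter (\<lambda>b. b \<in> S) (reading n k)"
    by (rule filter_cong) (auto simp: set_reading significant_fill[OF S(1)])
  then show "fill n k S \<in> PD n k w"
    using S(2) fill_pipe_dream by (simp add: PD_def word_def)
qed

lemma finite_base: "finite (base n k)"
  by (metis finite_set set_reading)

lemma prod_C_weight:
  assumes "S \<subseteq> base n k"
  shows "(\<Prod>b\<in>S. C_weight b) =
    2 ^ count_list (map box_index (filter (\<lambda>b. b \<in> S) (reading n k))) 0 * (\<Prod>b\<in>S. Var (box_var b))"
proof -
  have wt_eq: "C_weight b = (if box_index b = 0 then 2 else 1) * Var (box_var b)" if "b \<in> base n k" for b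
    using that by (auto simp: base_def C_weight_def)
  have "distinct (filter (\<lambda>b. b \<in> S) (reading n k))" by (simp add: distinct_reading)
  moreover have "set (filter (\<lambda>b. b \<in> S) (reading n k)) = S" using assms by (auto simp: set_reading)
  moreover have "2 ^ count_list (map box_index L) 0 = (\<Prod>b\<in>set L. if box_index b = 0 then 2 else (1 :: mpoly))"
    if "distinct L" for L
    using that by (induction L) auto
  ultimately have "2 ^ count_list (map box_index (filter (\<lambda>b. b \<in> S) (reading n k))) 0 =
      (\<Prod>b\<in>S. if box_index b = 0 then 2 else (1 :: mpoly))"
    by metis
  moreover have "(\<Prod>b\<in>S. C_weight b) = (\<Prod>b\<in>S. (if box_index b = 0 then 2 else 1) * Var (box_var b))"
    by (rule prod.cong[OF refl wt_eq]) (use assms in blast)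
  ultimately show ?thesis by (simp only: prod.distrib)
qed

lemma Const_two_power: "Const (2 powi (- int m)) * 2 ^ m = 1"
proof -
  have "Const (2 powi (- int m)) * Const (2 ^ m) = 1"
    by (simp add: Const_mult[symmetric] power_int_minus Const_1)
  moreover have "Const 2 = 2" using Const_of_nat[of 2] by simp
  ultimately show ?thesis by (simp add: Const_power)
qed

lemma sum_PD_eq_truncate_schubert_B:
  assumes "1 \<le> n" "w \<in> BC n"
  shows "(\<Sum>pd\<in>PD n k w. weight n k pd) = truncate k (schubert_B w)"
proof -
  obtain N where n: "n = Suc N" using assms(1) by (cases n) auto
  let ?word = "\<lambda>S. map box_index (filter (\<lambda>b. b \<in> S) (reading n k))"
  let ?p = "\<lambda>S. \<Prod>b\<in>S. Var (box_var b)"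
  have "truncate k (schubert_C w) =
      (\<Sum>a\<in>R w. \<Sum>S\<in>Pow (base n k). if ?word S = a then \<Prod>b\<in>S. C_weight b else 0)"
    using truncate_schubert_C_subsets[of w N k] assms(2) by (simp add: n subword_sum_def set_reading)
  also have "\<dots> = (\<Sum>S\<in>Pow (base n k). \<Sum>a\<in>R w. if ?word S = a then \<Prod>b\<in>S. C_weight b else 0)"
    by (rule sum.swap)
  \<comment> \<open>A reduced word of \<open>w\<close> contains the letter 0 exactly
    \<open>neg w\<close> times, so the power of 2 is the same for all pipe dreams of shape
    \<open>w\<close>.\<close>
  also have "\<dots> = (\<Sum>S\<in>Pow (base n k). if ?word S \<in> R w then 2 ^ neg w * ?p S else 0)"
    by (rule sum.cong[OF refl]) (auto simp: sum.delta' finite_R prod_C_weight count_zeros_R)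
  also have "\<dots> = (\<Sum>S | S \<subseteq> base n k \<and> ?word S \<in> R w. 2 ^ neg w * ?p S)"
    by (subst sum.inter_filter[symmetric]) (simp_all add: finite_base Pow_def)
  also have "\<dots> = 2 ^ neg w * (\<Sum>pd\<in>PD n k w. weight n k pd)"
    by (simp add: sum_PD sum_distrib_left)
  finally have "truncate k (schubert_C w) = 2 ^ neg w * (\<Sum>pd\<in>PD n k w. weight n k pd)" .
  then have "truncate k (schubert_B w) =
      Const (2 powi (- int (neg w))) * (2 ^ neg w * (\<Sum>pd\<in>PD n k w. weight n k pd))"
    by (simp add: schubert_B_def truncate_def subst_mult subst_Const)
  then show ?thesis by (simp add: mult.assoc[symmetric] Const_two_power)
qed

section \<open>Admissible monomials\<close>

text \<open>All reduced words are of this kind (\<open>good_R\<close>) and prefixes and suffixes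
  inherit it, so word coefficients need to be known only here.\<close>

definition good :: "nat \<Rightarrow> nat list \<Rightarrow> bool" where
  "good N a \<longleftrightarrow> set a \<subseteq> {..N} \<and> (\<forall>i. Suc i < length a \<longrightarrow> a ! i \<noteq> a ! Suc i)"

lemma good_take: "good N a \<Longrightarrow> good N (take i a)"
  by (auto simp: good_def dest: in_set_takeD)

lemma good_drop: "good N a \<Longrightarrow> good N (drop i a)"
  unfolding good_def using set_drop_subset[of i a] by (auto simp: add.commute[of i])

lemma good_R: assumes "w \<in> BC (Suc N)" "a \<in> R w" shows "good N a"
  using R_letters[OF assms] R_adjacent_distinct[OF assms(2)] by (auto simp: good_def)

text \<open>Words with equal neighbours have product 0, and on them the expansion of C(x) does not
  follow the count by peaks; so \<open>g\<close> is prescribed on good words only.\<close>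

definition rep_good :: "nat \<Rightarrow> op fps \<Rightarrow> (nat list \<Rightarrow> mpoly) \<Rightarrow> bool" where
  "rep_good N F g \<longleftrightarrow> (\<exists>f. rep N F f \<and> (\<forall>a. good N a \<longrightarrow> f a = g a))"

lemma rep_goodI: "rep N F f \<Longrightarrow> rep_good N F f"
  by (auto simp: rep_good_def)

lemma rep_good_cong: "rep_good N F f \<Longrightarrow> (\<And>a. good N a \<Longrightarrow> f a = g a) \<Longrightarrow> rep_good N F g"
  by (auto simp: rep_good_def)

lemma rep_good_mult:
  assumes "rep_good N F f" "rep_good N L g"
  shows "rep_good N (F * L) (wconv f g)"
proof -
  obtain f' g' where f: "rep N F f'" "\<And>a. good N a \<Longrightarrow> f' a = f a"
    and g: "rep N L g'" "\<And>a. good N a \<Longrightarrow> g' a = g a"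
    using assms by (auto simp: rep_good_def)
  have "wconv f' g' a = wconv f g a" if "good N a" for a
    unfolding wconv_def by (rule sum.cong) (simp_all add: f(2) g(2) good_take good_drop that)
  then show ?thesis using rep_mult[OF f(1) g(1)] by (auto simp: rep_good_def)
qed

lemma coef_rep_good:
  assumes "rep_good N F g" "w \<in> BC (Suc N)"
  shows "coef F w = (\<Sum>a\<in>R w. g a)"
proof -
  obtain f where f: "rep N F f" "\<And>a. good N a \<Longrightarrow> f a = g a"
    using assms(1) by (auto simp: rep_good_def)
  have "coef F w = (\<Sum>a\<in>R w. f a)" by (rule coef_rep[OF f(1) assms(2)])
  also have "\<dots> = (\<Sum>a\<in>R w. g a)"
    by (rule sum.cong) (simp_all add: f(2) good_R[OF assms(2)])
  finally show ?thesis .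
qed

section \<open>Peaks and V-shaped words\<close>

lemma peaks_take: "i \<le> length a \<Longrightarrow> t \<in> peaks (take i a) \<longleftrightarrow> t \<in> peaks a \<and> t + 1 < i"
  by (auto simp: peaks_def)

lemma peaks_drop: "i \<le> length a \<Longrightarrow> t \<in> peaks (drop i a) \<longleftrightarrow> 0 < t \<and> i + t \<in> peaks a"
  by (cases t) (auto simp: peaks_def)

lemma peaks_Cons_max:
  assumes "set a \<subseteq> {..n}" shows "peaks (n # a) = {} \<longleftrightarrow> peaks a = {}"
proof -
  have "peaks (n # a) = Suc ` peaks a"
  proof (rule set_eqI)
    fix t
    consider "t = 0" | "t = 1" | s where "t = Suc (Suc s)" by (metis One_nat_def not0_implies_Suc)
    then show "t \<in> peaks (n # a) \<longleftrightarrow> t \<in> Suc ` peaks a"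
    proof cases
      case 2
      have "a ! 0 \<le> n" if "a \<noteq> []"
      proof -
        have "a ! 0 \<in> set a" using that by (intro nth_mem) simp
        then show ?thesis using assms by auto
      qed
      then show ?thesis using 2 by (cases a) (auto simp: peaks_def)
    qed (auto simp: peaks_def)
  qed
  then show ?thesis by simp
qed

lemma peaks_snoc_max:
  assumes "set a \<subseteq> {..n}" shows "peaks (a @ [n]) = peaks a"
proof (rule set_eqI)
  fix t
  show "t \<in> peaks (a @ [n]) \<longleftrightarrow> t \<in> peaks a"
  proof (cases "t + 1 = length a")
    case True
    then have "a ! t \<in> set a" by (intro nth_mem) simp
    then have "a ! t \<le> n" using assms by auto
    then show ?thesis using True by (auto simp: peaks_def nth_append)
  next
    case False
    then show ?thesis by (auto simp: peaks_def nth_append)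
  qed
qed

text \<open>The neighbours of an interior maximal letter are at most as large and, in a good word,
  different from it.\<close>

lemma interior_max_peak:
  assumes "good M a" "set a \<subseteq> {..n}" "a = p @ n # q" "p \<noteq> []" "q \<noteq> []"
  shows "peaks a \<noteq> {}"
proof -
  obtain p' x where p: "p = p' @ [x]" using assms(4) by (cases p rule: rev_cases) auto
  obtain y q' where q: "q = y # q'" using assms(5) by (cases q) auto
  have "a ! length p' = x" "a ! Suc (length p') = n" "a ! Suc (Suc (length p')) = y"
    by (simp_all add: assms(3) p q nth_append)
  moreover have l: "Suc (Suc (length p')) < length a" by (simp add: assms(3) p q)
  moreover have "a ! length p' \<noteq> a ! Suc (length p')" "a ! Suc (length p') \<noteq> a ! Suc (Suc (length p'))"
    using assms(1) l by (simp_all add: good_def)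
  moreover have "x \<le> n" "y \<le> n" using assms(2,3) p q by auto
  ultimately have "Suc (length p') \<in> peaks a"
    by (simp add: peaks_def)
  then show ?thesis by blast
qed

text \<open>Good words without peaks strictly decrease and then strictly increase, like the letters
  in the factors of C(x). The 2 counts the two halves in which the smallest letter can be placed; if
  that letter is 0, it comes from h_0(2x).\<close>

definition V_word :: "nat \<Rightarrow> mpoly \<Rightarrow> nat list \<Rightarrow> mpoly" where
  "V_word N x a = (if peaks a = {} \<and> set a \<subseteq> {..N} then (if a = [] then 1 else 2) * x ^ length a else 0)"

lemma V_word_outside: "\<not> set a \<subseteq> {..N} \<Longrightarrow> V_word N x a = 0"
  by (simp add: V_word_def)

lemma V_word_Cons_max:
  assumes "good M (Suc N # a)" "a \<noteq> []" "last a \<noteq> Suc N"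
  shows "V_word (Suc N) x (Suc N # a) = x * V_word N x a"
proof (cases "set a \<subseteq> {..N}")
  case True
  then have "set a \<subseteq> {..Suc N}" by auto
  then show ?thesis using True assms(2) by (simp add: V_word_def peaks_Cons_max)
next
  case False
  have "V_word (Suc N) x (Suc N # a) = 0"
  proof (cases "set a \<subseteq> {..Suc N}")
    case True
    then have "Suc N \<in> set a" using False by (auto simp: le_Suc_eq)
    then obtain p q where a: "a = p @ Suc N # q" by (auto simp: in_set_conv_decomp)
    then have "q \<noteq> []" using assms(3) by auto
    then have "peaks (Suc N # a) \<noteq> {}"
      using interior_max_peak[OF assms(1), of "Suc N" "Suc N # p" q] True a by simp
    then show ?thesis by (simp add: V_word_def)
  qed (simp add: V_word_def)
  then show ?thesis using False by (simp add: V_word_outside)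
qed

lemma V_word_snoc_max:
  assumes "good M (a @ [Suc N])" "a \<noteq> []" "hd a \<noteq> Suc N"
  shows "V_word (Suc N) x (a @ [Suc N]) = V_word N x a * x"
proof (cases "set a \<subseteq> {..N}")
  case True
  then have "set a \<subseteq> {..Suc N}" by auto
  then show ?thesis using True assms(2) by (simp add: V_word_def peaks_snoc_max mult_ac)
next
  case False
  have "V_word (Suc N) x (a @ [Suc N]) = 0"
  proof (cases "set a \<subseteq> {..Suc N}")
    case True
    then have "Suc N \<in> set a" using False by (auto simp: le_Suc_eq)
    then obtain p q where a: "a = p @ Suc N # q" by (auto simp: in_set_conv_decomp)
    then have "p \<noteq> []" using assms(3) by auto
    then have "peaks (a @ [Suc N]) \<noteq> {}"
      using interior_max_peak[OF assms(1), of "Suc N" p "q @ [Suc N]"] True a by simp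
    then show ?thesis by (simp add: V_word_def)
  qed (simp add: V_word_def)
  then show ?thesis using False by (simp add: V_word_outside)
qed

lemma V_word_both_max:
  assumes "good M (Suc N # a @ [Suc N])" "a \<noteq> []"
  shows "V_word (Suc N) x (Suc N # a @ [Suc N]) = x * (V_word N x a * x)"
proof (cases "set a \<subseteq> {..N}")
  case True
  then have "set a \<subseteq> {..Suc N}" by auto
  then show ?thesis using True assms(2) by (simp add: V_word_def peaks_snoc_max peaks_Cons_max mult_ac)
next
  case False
  have "V_word (Suc N) x (Suc N # a @ [Suc N]) = 0"
  proof (cases "set a \<subseteq> {..Suc N}")
    case True
    then have "Suc N \<in> set a" using False by (auto simp: le_Suc_eq)
    then obtain p q where a: "a = p @ Suc N # q" by (auto simp: in_set_conv_decomp)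
    then have "peaks (Suc N # a @ [Suc N]) \<noteq> {}"
      using interior_max_peak[OF assms(1), of "Suc N" "Suc N # p" "q @ [Suc N]"] True by simp
    then show ?thesis by (simp add: V_word_def)
  qed (simp add: V_word_def)
  then show ?thesis using False by (simp add: V_word_outside)
qed

lemma V_word_interior_max:
  assumes "good M a" "Suc N \<in> set a" "hd a \<noteq> Suc N" "last a \<noteq> Suc N"
  shows "V_word (Suc N) x a = 0"
proof (cases "set a \<subseteq> {..Suc N}")
  case True
  obtain p q where a: "a = p @ Suc N # q" using assms(2) by (auto simp: in_set_conv_decomp)
  then have "p \<noteq> []" "q \<noteq> []" using assms(3,4) by auto
  then have "peaks a \<noteq> {}" by (rule interior_max_peak[OF assms(1) True a])
  then show ?thesis by (simp add: V_word_def)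
qed (simp add: V_word_def)

text \<open>Multiplying by \<open>H_fps (Suc N) x\<close> on both sides adds the maximal letter at the two ends of a
  word without peaks.\<close>

lemma V_word_rec:
  fixes N x
  defines "h \<equiv> \<lambda>a. V_word N x a + (if a \<noteq> [] \<and> last a = Suc N then V_word N x (butlast a) * x else 0)"
  assumes "good M a"
  shows "h a + (if a \<noteq> [] \<and> hd a = Suc N then x * h (tl a) else 0) = V_word (Suc N) x a"
proof (cases "Suc N \<in> set a")
  case False
  then have "set a \<subseteq> {..Suc N} \<longleftrightarrow> set a \<subseteq> {..N}" by (auto simp: le_Suc_eq)
  moreover have "hd a \<noteq> Suc N" "last a \<noteq> Suc N" if "a \<noteq> []"
    using False that by (metis hd_in_set, metis last_in_set)
  ultimately show ?thesis by (auto simp: h_def V_word_def)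
next
  case True
  then have out: "V_word N x a = 0" by (intro V_word_outside) auto
  show ?thesis
  proof (cases "hd a = Suc N")
    case hd: True
    then obtain b where a: "a = Suc N # b" using True by (cases a) auto
    show ?thesis
    proof (cases "last a = Suc N")
      case last: True
      show ?thesis
      proof (cases "b = []")
        \<comment> \<open>The one-letter word \<open>[Suc N]\<close> arises from either outer
          factor, hence the coefficient 2x.\<close>
        case True
        then show ?thesis by (simp add: a h_def V_word_def peaks_def)
      next
        case False
        then obtain d where b: "b = d @ [Suc N]" using last a by (cases b rule: rev_cases) auto
        \<comment> \<open>An empty \<open>d\<close> would put two copies of \<open>Suc N\<close>
          side by side.\<close>
        have "d \<noteq> []" using assms(2) by (auto simp: good_def a b)
        moreover have "V_word N x b = 0" "V_word N x (Suc N # d) = 0"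
          by (intro V_word_outside; simp add: b)+
        ultimately show ?thesis
          using out V_word_both_max[of M N d x] assms(2) by (simp add: h_def a b)
      qed
    next
      case False
      then have "b \<noteq> []" "last b \<noteq> Suc N" using a by (auto split: if_splits)
      then show ?thesis using out V_word_Cons_max[of M N b x] assms(2) by (simp add: h_def a)
    qed
  next
    case hd: False
    show ?thesis
    proof (cases "last a = Suc N")
      case last: True
      then obtain b where a: "a = b @ [Suc N]" using True by (cases a rule: rev_cases) auto
      then have "b \<noteq> []" "hd b \<noteq> Suc N" using hd by (cases b; simp)+
      then show ?thesis using out V_word_snoc_max[of M b N x] assms(2) by (simp add: h_def a)
    next
      case False
      then show ?thesis
        using out hd V_word_interior_max[OF assms(2) True hd False] by (simp add: h_def)
    qed
  qed
qed

lemma rep_good_C: "N \<le> M \<Longrightarrow> rep_good M (C_fps N x) (V_word N x)"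
proof (induction N)
  case 0
  have "C_fps 0 x = H_fps 0 (x + x)" by (simp add: C_fps_def A_fps_def A_fps'_def)
  then have "rep_good M (C_fps 0 x) (\<lambda>a. if a = [] then 1 else if a = [0] then x + x else 0)"
    using rep_H[of 0 M "x + x"] by (simp add: rep_goodI)
  then show ?case
  proof (rule rep_good_cong)
    fix a assume g: "good M a"
    show "(if a = [] then 1 else if a = [0] then x + x else 0) = V_word 0 x a"
    proof (cases "set a \<subseteq> {..0}")
      case True
      have "length a \<le> 1"
      proof (rule ccontr)
        assume "\<not> length a \<le> 1"
        then have l: "Suc 0 < length a" by simp
        then have "a ! 0 \<in> set a" "a ! Suc 0 \<in> set a" by (intro nth_mem; linarith)+
        then have "a ! 0 \<in> {..0}" "a ! Suc 0 \<in> {..0}" using True by blast+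
        then have "a ! 0 = a ! Suc 0" by simp
        then show False using g l by (auto simp: good_def)
      qed
      then have "a = [] \<or> a = [0]" using True by (cases a) auto
      then show ?thesis by (auto simp: V_word_def peaks_def)
    qed (auto simp: V_word_def)
  qed
next
  case (Suc N)
  have C_Suc: "C_fps (Suc N) x = H_fps (Suc N) x * (C_fps N x * H_fps (Suc N) x)"
    by (simp add: C_fps_def A_fps_def A_fps'_def mult.assoc)
  let ?f = "\<lambda>a. if a = [] then 1 else if a = [Suc N] then x else 0"
  have "rep_good M (C_fps (Suc N) x) (wconv ?f (wconv (V_word N x) ?f))"
    unfolding C_Suc using Suc by (intro rep_good_mult rep_goodI[OF rep_H]) simp_all
  then show ?case
    by (rule rep_good_cong) (simp only: wconv_letter wconv_letter_right V_word_rec)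
qed

section \<open>Sequences that are x-admissible\<close>

definition x_sum :: "nat \<Rightarrow> nat list \<Rightarrow> mpoly" where
  "x_sum k a = (\<Sum>js | x_admissible a js \<and> set js \<subseteq> {1..k}.
     2 ^ card (set js) * prod_list (map (\<lambda>j. Var (X j)) js))"

lemma finite_x_admissible: "finite {js. x_admissible a js \<and> set js \<subseteq> {1..k}}"
  by (rule finite_subset[OF _ finite_lists_length_eq[of "{1..k}" "length a"]])
     (auto simp: x_admissible_def)

text \<open>A weakly decreasing sequence with values up to k + 1 begins with its block of the
  largest value. Inside the block all triples are constant, which forbids every peak of the prefix;
  a triple across its end is not constant.\<close>

lemma x_admissible_split:
  assumes i: "i \<le> length a" and js: "set js \<subseteq> {1..k}"
  shows "x_admissible a (replicate i (Suc k) @ js) \<longleftrightarrow>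
    peaks (take i a) = {} \<and> x_admissible (drop i a) js"
proof -
  let ?J = "replicate i (Suc k) @ js"
  let ?T = "\<lambda>a js. \<forall>t. 0 < t \<and> t + 1 < length a \<and> js ! (t - 1) = js ! t \<and> js ! t = js ! (t + 1) \<longrightarrow> t \<notin> peaks a"
  have len: "length ?J = length a \<longleftrightarrow> length js = length (drop i a)" using i by auto
  have sorted: "sorted_wrt (\<ge>) ?J \<longleftrightarrow> sorted_wrt (\<ge>) js"
  proof -
    have "sorted_wrt (\<ge>) (replicate i (Suc k))" by (induction i) auto
    moreover have "\<forall>y\<in>set js. y \<le> Suc k" using js by fastforce
    ultimately show ?thesis by (auto simp: sorted_wrt_append)
  qed
  have "?T a ?J \<longleftrightarrow> peaks (take i a) = {} \<and> ?T (drop i a) js" if l: "length js = length (drop i a)"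
  proof (intro iffI conjI allI impI)
    assume T: "?T a ?J"
    show "peaks (take i a) = {}"
    proof (rule ccontr)
      assume "peaks (take i a) \<noteq> {}"
      then obtain t where "t \<in> peaks (take i a)" by blast
      then have t: "t \<in> peaks a" "t + 1 < i" using peaks_take[OF i] by auto
      then have "0 < t" "t + 1 < length a" by (auto simp: peaks_def)
      moreover have "?J ! (t - 1) = ?J ! t" "?J ! t = ?J ! (t + 1)"
        using t by (auto simp: nth_append)
      ultimately show False using T t(1) by blast
    qed
    fix t assume t: "0 < t \<and> t + 1 < length (drop i a) \<and> js ! (t - 1) = js ! t \<and> js ! t = js ! (t + 1)"
    then have "?J ! (i + t - 1) = ?J ! (i + t)" "?J ! (i + t) = ?J ! (i + t + 1)"
      by (auto simp: nth_append)
    then have "i + t \<notin> peaks a" using T t by auto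
    then show "t \<notin> peaks (drop i a)" using peaks_drop[OF i] by blast
  next
    fix t
    assume T: "peaks (take i a) = {} \<and> ?T (drop i a) js"
    assume t: "0 < t \<and> t + 1 < length a \<and> ?J ! (t - 1) = ?J ! t \<and> ?J ! t = ?J ! (t + 1)"
    consider "t + 1 < i" | "t - 1 < i" "i \<le> t + 1" | "i \<le> t - 1" by linarith
    then show "t \<notin> peaks a"
    proof cases
      case 1
      then show ?thesis using T peaks_take[OF i, of t] by blast
    next
      \<comment> \<open>The triple straddles the end of the block: its left value is k + 1, its
        right value at most k.\<close>
      case 2
      have "?J ! (t - 1) = Suc k" using 2 by (simp add: nth_append)
      moreover have "?J ! (t + 1) = js ! (t + 1 - i)" using 2 by (simp add: nth_append)
      moreover have "t + 1 - i < length js" using 2 t l unfolding length_drop by arith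
      then have "js ! (t + 1 - i) \<in> set js" by (rule nth_mem)
      ultimately show ?thesis using t js by auto
    next
      case 3
      define s where "s = t - i"
      have s: "0 < s" "t = i + s" using 3 t by (auto simp: s_def)
      have "?J ! (t - 1) = js ! (s - 1)" "?J ! t = js ! s" "?J ! (t + 1) = js ! (s + 1)"
        using s by (auto simp: nth_append)
      then have "s \<notin> peaks (drop i a)" using T t s by auto
      then show ?thesis using peaks_drop[OF i, of s] s by blast
    qed
  qed
  then show ?thesis
    unfolding x_admissible_def len sorted using js by auto
qed

lemma sorted_desc_split:
  "sorted_wrt (\<ge>) js \<Longrightarrow> set js \<subseteq> {1..Suc k} \<Longrightarrow>
    js = replicate (length js - length (filter (\<lambda>j. j \<noteq> Suc k) js)) (Suc k) @ filter (\<lambda>j. j \<noteq> Suc k) js"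
proof (induction js)
  case (Cons j js)
  show ?case
  proof (cases "j = Suc k")
    case True
    have "length (filter (\<lambda>j. j \<noteq> Suc k) js) \<le> length js" by simp
    then show ?thesis using True Cons by (simp add: Suc_diff_le)
  next
    case False
    then have "\<forall>i\<in>set js. i \<noteq> Suc k" using Cons.prems by fastforce
    then have "filter (\<lambda>j. j \<noteq> Suc k) (j # js) = j # js" using False by simp
    then show ?thesis by simp
  qed
qed simp

text \<open>The block of the new variable adds a distinct variable exactly if it is nonempty, and
  exactly then \<open>V_word\<close> has its factor 2.\<close>

lemma x_sum_Suc:
  assumes "good N a"
  shows "wconv (V_word N (Var (X (Suc k)))) (x_sum k) a = x_sum (Suc k) a"
proof -
  let ?x = "Var (X (Suc k))"
  let ?p = "\<lambda>js. 2 ^ card (set js) * prod_list (map (\<lambda>j. Var (X j)) js)"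
  let ?S = "\<lambda>i. {js. x_admissible (drop i a) js \<and> set js \<subseteq> {1..k}}"
  let ?f = "\<lambda>js. filter (\<lambda>j. j \<noteq> Suc k) js"
  have V: "V_word N ?x (take i a) * x_sum k (drop i a) =
      (\<Sum>js | js \<in> ?S i \<and> peaks (take i a) = {}. ?p (replicate i (Suc k) @ js))" if i: "i \<in> {0..length a}" for i
  proof (cases "peaks (take i a) = {}")
    case True
    have "set (take i a) \<subseteq> {..N}" using good_take[OF assms, of i] by (simp add: good_def)
    then have Vt: "V_word N ?x (take i a) = (if i = 0 then 1 else 2) * ?x ^ i"
      using True i by (auto simp: V_word_def min_def)
    have P: "?p (replicate i (Suc k) @ js) = (if i = 0 then 1 else 2) * ?x ^ i * ?p js"
      if "set js \<subseteq> {1..k}" for js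
    proof -
      have "Suc k \<notin> set js" using that by auto
      then have "2 ^ card (set (replicate i (Suc k) @ js)) = (if i = 0 then 1 else 2) * (2 :: mpoly) ^ card (set js)"
        by (cases "i = 0") (simp_all add: set_replicate_conv_if)
      moreover have "prod_list (map (\<lambda>j. Var (X j)) (replicate i (Suc k))) = ?x ^ i"
        by (induction i) simp_all
      ultimately show ?thesis by (simp only: map_append prod_list.append mult_ac)
    qed
    have "V_word N ?x (take i a) * x_sum k (drop i a) =
        (\<Sum>js\<in>?S i. (if i = 0 then 1 else 2) * ?x ^ i * ?p js)"
      by (simp only: Vt x_sum_def sum_distrib_left)
    also have "\<dots> = (\<Sum>js | js \<in> ?S i \<and> peaks (take i a) = {}. ?p (replicate i (Suc k) @ js))"
    proof (rule sum.cong)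
      fix js assume "js \<in> {js. js \<in> ?S i \<and> peaks (take i a) = {}}"
      then have "set js \<subseteq> {1..k}" by blast
      then show "(if i = 0 then 1 else 2) * ?x ^ i * ?p js = ?p (replicate i (Suc k) @ js)"
        by (rule P[symmetric])
    qed (use True in blast)
    finally show ?thesis .
  qed (simp add: V_word_def)
  have "wconv (V_word N ?x) (x_sum k) a =
      (\<Sum>i\<in>{0..length a}. \<Sum>js | js \<in> ?S i \<and> peaks (take i a) = {}. ?p (replicate i (Suc k) @ js))"
    unfolding wconv_def by (rule sum.cong[OF refl V])
  also have "\<dots> = (\<Sum>(i, js)\<in>Sigma {0..length a} (\<lambda>i. {js. js \<in> ?S i \<and> peaks (take i a) = {}}).
      ?p (replicate i (Suc k) @ js))"
  proof (rule sum.Sigma)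
    have "finite {js. js \<in> ?S i \<and> peaks (take i a) = {}}" for i
      by (rule finite_subset[OF _ finite_x_admissible[of "drop i a" k]]) blast
    then show "\<forall>i\<in>{0..length a}. finite {js. js \<in> ?S i \<and> peaks (take i a) = {}}" by blast
  qed simp
  also have "\<dots> = x_sum (Suc k) a"
    unfolding x_sum_def
  proof (rule sum.reindex_bij_witness[where i = "\<lambda>js. (length js - length (?f js), ?f js)"
        and j = "\<lambda>(i, js). replicate i (Suc k) @ js"])
    fix t assume "t \<in> Sigma {0..length a} (\<lambda>i. {js. js \<in> ?S i \<and> peaks (take i a) = {}})"
    then obtain i js where t: "t = (i, js)" "i \<le> length a" "x_admissible (drop i a) js" "set js \<subseteq> {1..k}"
      "peaks (take i a) = {}" by auto
    have f: "?f (replicate i (Suc k) @ js) = js"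
      using t(4) by (auto simp: filter_id_conv)
    show "(case case t of (i, js) \<Rightarrow> replicate i (Suc k) @ js of js \<Rightarrow> (length js - length (?f js), ?f js)) = t"
      using f by (simp add: t(1))
    show "(case t of (i, js) \<Rightarrow> replicate i (Suc k) @ js) \<in> {js. x_admissible a js \<and> set js \<subseteq> {1..Suc k}}"
      using t x_admissible_split[OF t(2,4)] by (auto simp: set_replicate_conv_if)
    show "?p (case t of (i, js) \<Rightarrow> replicate i (Suc k) @ js) = (case t of (i, js) \<Rightarrow> ?p (replicate i (Suc k) @ js))"
      by (simp add: t(1))
  next
    fix js assume "js \<in> {js. x_admissible a js \<and> set js \<subseteq> {1..Suc k}}"
    then have js: "x_admissible a js" "set js \<subseteq> {1..Suc k}" by auto
    define i where "i = length js - length (?f js)"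
    have eq: "js = replicate i (Suc k) @ ?f js"
      unfolding i_def by (rule sorted_desc_split) (use js in \<open>auto simp: x_admissible_def\<close>)
    then show "(case (length js - length (?f js), ?f js) of (i, js) \<Rightarrow> replicate i (Suc k) @ js) = js"
      by (simp add: i_def)
    have f: "set (?f js) \<subseteq> {1..k}" using js(2) by (auto simp: le_Suc_eq)
    have i: "i \<le> length a" using js(1) by (simp add: i_def x_admissible_def)
    show "(length js - length (?f js), ?f js) \<in> Sigma {0..length a} (\<lambda>i. {js. js \<in> ?S i \<and> peaks (take i a) = {}})"
      using x_admissible_split[OF i f] js(1) eq f i by (simp add: i_def[symmetric])
  qed
  finally show ?thesis .
qed

lemma x_sum_0: "x_sum 0 a = (if a = [] then 1 else 0)"
proof -
  have "{js. x_admissible a js \<and> set js \<subseteq> {1..0}} = (if a = [] then {[]} else {})"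
    by (auto simp: x_admissible_def)
  then show ?thesis by (simp add: x_sum_def)
qed

lemma rep_good_C_prod:
  "rep_good N (prod_list (map (\<lambda>i. C_fps N (Var (X i))) (rev [1..<k + 1]))) (x_sum k)"
proof (induction k)
  case 0
  then show ?case using rep_goodI[OF rep_1[of N]] by (simp add: x_sum_0[abs_def])
next
  case (Suc k)
  have "rep_good N (C_fps N (Var (X (Suc k))) * prod_list (map (\<lambda>i. C_fps N (Var (X i))) (rev [1..<k + 1])))
      (wconv (V_word N (Var (X (Suc k)))) (x_sum k))"
    by (intro rep_good_mult rep_good_C order_refl Suc)
  then have "rep_good N (C_fps N (Var (X (Suc k))) * prod_list (map (\<lambda>i. C_fps N (Var (X i))) (rev [1..<k + 1])))
      (x_sum (Suc k))"
    by (rule rep_good_cong) (rule x_sum_Suc)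
  then show ?case by simp
qed

section \<open>Decreasing words and z-admissible sequences\<close>

definition dec_word :: "nat \<Rightarrow> nat \<Rightarrow> mpoly \<Rightarrow> nat list \<Rightarrow> mpoly" where
  "dec_word N i x a = (if sorted_wrt (>) a \<and> set a \<subseteq> {i..N} then x ^ length a else 0)"

lemma dec_word_rec:
  assumes "i \<le> N"
  shows "dec_word N (Suc i) x a + (if a \<noteq> [] \<and> last a = i then dec_word N (Suc i) x (butlast a) * x else 0)
    = dec_word N i x a"
proof (cases a rule: rev_cases)
  case Nil
  then show ?thesis by (simp add: dec_word_def)
next
  case (snoc b j)
  have split: "sorted_wrt (>) (b @ [j]) \<longleftrightarrow> sorted_wrt (>) b \<and> (\<forall>t\<in>set b. j < t)"
    by (auto simp: sorted_wrt_append)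
  show ?thesis
  proof (cases "j = i")
    case True
    have "(\<forall>t\<in>set b. i < t) \<and> set (b @ [i]) \<subseteq> {i..N} \<longleftrightarrow> set b \<subseteq> {Suc i..N}"
      using assms by force
    then have eq: "sorted_wrt (>) (b @ [i]) \<and> set (b @ [i]) \<subseteq> {i..N} \<longleftrightarrow>
        sorted_wrt (>) b \<and> set b \<subseteq> {Suc i..N}"
      using split[unfolded True] by blast
    have "dec_word N i x (b @ [i]) = dec_word N (Suc i) x b * x"
      unfolding dec_word_def eq by (simp add: mult.commute)
    moreover have "dec_word N (Suc i) x (b @ [i]) = 0" by (simp add: dec_word_def)
    ultimately show ?thesis using snoc True by simp
  next
    case False
    have "sorted_wrt (>) (b @ [j]) \<and> set (b @ [j]) \<subseteq> {i..N} \<longleftrightarrow>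
        sorted_wrt (>) (b @ [j]) \<and> set (b @ [j]) \<subseteq> {Suc i..N}"
      unfolding split using False by force
    then show ?thesis using snoc False by (simp only: dec_word_def) simp
  qed
qed

text \<open>In the product h_N ... h_i each letter is taken or skipped, always in decreasing
  order.\<close>

lemma rep_A: "N \<le> M \<Longrightarrow> rep M (A_fps N i x) (dec_word N i x)"
proof (induction i rule: A_induct[where N = N])
  case (empty i)
  have "dec_word N i x = (\<lambda>a. if a = [] then 1 else 0)"
    using empty by (auto simp: fun_eq_iff dec_word_def)
  then show ?case using empty rep_1 by (simp add: A_empty)
next
  case (step i)
  have "rep M (A_fps N (Suc i) x * H_fps i x)
      (wconv (dec_word N (Suc i) x) (\<lambda>a. if a = [] then 1 else if a = [i] then x else 0))"
    using step by (intro rep_mult rep_H) simp_all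
  then show ?case
    unfolding wconv_letter_right[abs_def] dec_word_rec[OF step(1)] using step(1) by (simp add: A_rec)
qed

definition z_sum :: "nat \<Rightarrow> nat list \<Rightarrow> mpoly" where
  "z_sum m b = (\<Sum>js | z_admissible b js \<and> set js \<subseteq> {1..m}. prod_list (map (\<lambda>j. Var (Z j)) js))"

lemma finite_z_admissible: "finite {js. z_admissible b js \<and> set js \<subseteq> {1..m}}"
  by (rule finite_subset[OF _ finite_lists_length_eq[of "{1..m}" "length b"]])
     (auto simp: z_admissible_def)

text \<open>Here the largest value m + 1 forms the final block. On it the bound by the letters makes
  them at least m + 1, and equality of neighbouring values makes them decrease.\<close>

lemma z_admissible_split:
  assumes i: "i \<le> length b" and l: "length js = i" and js: "set js \<subseteq> {1..m}"
  shows "z_admissible b (js @ replicate (length b - i) (Suc m)) \<longleftrightarrow>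
    z_admissible (take i b) js \<and> sorted_wrt (>) (drop i b) \<and> set (drop i b) \<subseteq> {Suc m..}"
proof -
  let ?J = "js @ replicate (length b - i) (Suc m)"
  have le: "\<forall>j\<in>set js. j \<le> m" using js by auto
  have sorted: "sorted_wrt (\<le>) ?J \<longleftrightarrow> sorted_wrt (\<le>) js"
  proof -
    have "sorted_wrt (\<le>) (replicate p (Suc m))" for p by (induction p) auto
    then show ?thesis using le by (auto simp: sorted_wrt_append)
  qed
  have J: "?J ! t = (if t < i then js ! t else Suc m)" if "t < length b" for t
    using that l by (auto simp: nth_append)
  have bound: "(\<forall>t<length b. ?J ! t \<le> b ! t) \<longleftrightarrow>
      (\<forall>t<i. js ! t \<le> b ! t) \<and> set (drop i b) \<subseteq> {Suc m..}"
  proof -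
    have "(\<forall>t<length b. ?J ! t \<le> b ! t) \<longleftrightarrow>
        (\<forall>t<i. js ! t \<le> b ! t) \<and> (\<forall>t<length b. i \<le> t \<longrightarrow> Suc m \<le> b ! t)"
      using i J by (auto simp: not_less)
    also have "(\<forall>t<length b. i \<le> t \<longrightarrow> Suc m \<le> b ! t) \<longleftrightarrow> (\<forall>s<length (drop i b). Suc m \<le> drop i b ! s)"
    proof
      assume *: "\<forall>t<length b. i \<le> t \<longrightarrow> Suc m \<le> b ! t"
      show "\<forall>s<length (drop i b). Suc m \<le> drop i b ! s" using * i by simp
    next
      assume *: "\<forall>s<length (drop i b). Suc m \<le> drop i b ! s"
      show "\<forall>t<length b. i \<le> t \<longrightarrow> Suc m \<le> b ! t"
      proof (intro allI impI)
        fix t assume "t < length b" "i \<le> t"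
        then show "Suc m \<le> b ! t" using *[rule_format, of "t - i"] i by simp
      qed
    qed
    also have "\<dots> \<longleftrightarrow> set (drop i b) \<subseteq> {Suc m..}"
      by (auto simp: subset_iff set_conv_nth)
    finally show ?thesis .
  qed
  have adj: "(\<forall>t. t + 1 < length b \<and> ?J ! t = ?J ! (t + 1) \<longrightarrow> b ! t > b ! (t + 1)) \<longleftrightarrow>
      (\<forall>t. t + 1 < i \<and> js ! t = js ! (t + 1) \<longrightarrow> b ! t > b ! (t + 1)) \<and> sorted_wrt (>) (drop i b)"
  proof -
    \<comment> \<open>The last value before the block is at most m, so the letters at the junction
      need not decrease.\<close>
    have ne: "?J ! t \<noteq> ?J ! (t + 1)" if "t + 1 = i" "t + 1 < length b" for t
    proof -
      have "js ! t \<in> set js" using that l by (intro nth_mem) simp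
      then have "js ! t \<le> m" using le by blast
      then show ?thesis using that J[of t] J[of "t + 1"] by simp
    qed
    have "(\<forall>t. t + 1 < length b \<and> ?J ! t = ?J ! (t + 1) \<longrightarrow> b ! t > b ! (t + 1)) \<longleftrightarrow>
        (\<forall>t. t + 1 < i \<and> js ! t = js ! (t + 1) \<longrightarrow> b ! t > b ! (t + 1)) \<and>
        (\<forall>t. t + 1 < length b \<and> i \<le> t \<longrightarrow> b ! t > b ! (t + 1))" (is "?L \<longleftrightarrow> ?R1 \<and> ?R2")
    proof (intro iffI conjI allI impI)
      fix t assume ?L "t + 1 < i \<and> js ! t = js ! (t + 1)"
      then show "b ! t > b ! (t + 1)" using J[of t] J[of "t + 1"] i by simp
    next
      fix t assume ?L "t + 1 < length b \<and> i \<le> t"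
      then show "b ! t > b ! (t + 1)" using J[of t] J[of "t + 1"] i by simp
    next
      fix t assume R: "?R1 \<and> ?R2" and t: "t + 1 < length b \<and> ?J ! t = ?J ! (t + 1)"
      consider "t + 1 < i" | "t + 1 = i" | "i \<le> t" by linarith
      then show "b ! t > b ! (t + 1)"
      proof cases
        case 1
        then show ?thesis using R t J[of t] J[of "t + 1"] by simp
      next
        case 2
        then show ?thesis using ne t by blast
      next
        case 3
        then show ?thesis using R t by blast
      qed
    qed
    also have "?R2 \<longleftrightarrow> (\<forall>s. Suc s < length (drop i b) \<longrightarrow> drop i b ! s > drop i b ! Suc s)"
    proof
      assume ?R2
      then show "\<forall>s. Suc s < length (drop i b) \<longrightarrow> drop i b ! s > drop i b ! Suc s"
        using i by auto
    next
      assume *: "\<forall>s. Suc s < length (drop i b) \<longrightarrow> drop i b ! s > drop i b ! Suc s"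
      show ?R2
      proof (intro allI impI)
        fix t assume t: "t + 1 < length b \<and> i \<le> t"
        then have "Suc (t - i) < length (drop i b)" unfolding length_drop by arith
        then show "b ! t > b ! (t + 1)" using *[rule_format, of "t - i"] i t by simp
      qed
    qed
    also have "\<dots> \<longleftrightarrow> sorted_wrt (>) (drop i b)"
      by (subst sorted_wrt_iff_nth_Suc_transp) (auto intro: transpI)
    finally show ?thesis .
  qed
  have take: "z_admissible (take i b) js \<longleftrightarrow> (\<forall>j\<in>set js. 1 \<le> j) \<and> sorted_wrt (\<le>) js \<and>
      (\<forall>t<i. js ! t \<le> b ! t) \<and> (\<forall>t. t + 1 < i \<and> js ! t = js ! (t + 1) \<longrightarrow> b ! t > b ! (t + 1))"
    using i l by (auto simp: z_admissible_def)
  have len: "length ?J = length b" using i l by simp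
  have pos: "(\<forall>j\<in>set ?J. 1 \<le> j) \<longleftrightarrow> (\<forall>j\<in>set js. 1 \<le> j)" by auto
  show ?thesis
    unfolding z_admissible_def[of b] sorted bound adj take pos using len by blast
qed

lemma sorted_asc_split:
  "sorted_wrt (\<le>) js \<Longrightarrow> set js \<subseteq> {1..Suc m} \<Longrightarrow>
    js = filter (\<lambda>j. j \<noteq> Suc m) js @ replicate (length js - length (filter (\<lambda>j. j \<noteq> Suc m) js)) (Suc m)"
proof (induction js rule: rev_induct)
  case (snoc j js)
  show ?case
  proof (cases "j = Suc m")
    case True
    have "length (filter (\<lambda>j. j \<noteq> Suc m) js) \<le> length js" by simp
    moreover have "js = filter (\<lambda>j. j \<noteq> Suc m) js @
        replicate (length js - length (filter (\<lambda>j. j \<noteq> Suc m) js)) (Suc m)"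
      using snoc by (simp add: sorted_wrt_append)
    ultimately show ?thesis using True
      by (simp add: Suc_diff_le replicate_append_same[symmetric] del: replicate_append_same)
  next
    case False
    then have "\<forall>i\<in>set js. i \<noteq> Suc m" using snoc.prems by (fastforce simp: sorted_wrt_append)
    then have "filter (\<lambda>j. j \<noteq> Suc m) (js @ [j]) = js @ [j]" using False by simp
    then show ?thesis by simp
  qed
qed simp

text \<open>Cutting off the final block is the deconcatenation that belongs to multiplication by
  A_(m+1)(z_(m+1)).\<close>

lemma z_sum_Suc:
  assumes "good N b"
  shows "wconv (z_sum m) (dec_word N (Suc m) (Var (Z (Suc m)))) b = z_sum (Suc m) b"
proof -
  let ?z = "Var (Z (Suc m))"
  let ?p = "\<lambda>js. prod_list (map (\<lambda>j. Var (Z j)) js)"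
  let ?S = "\<lambda>i. {js. z_admissible (take i b) js \<and> set js \<subseteq> {1..m}}"
  let ?ok = "\<lambda>i. sorted_wrt (>) (drop i b) \<and> set (drop i b) \<subseteq> {Suc m..}"
  let ?f = "\<lambda>js. filter (\<lambda>j. j \<noteq> Suc m) js"
  let ?r = "\<lambda>i js. js @ replicate (length b - i) (Suc m)"
  have V: "z_sum m (take i b) * dec_word N (Suc m) ?z (drop i b) =
      (\<Sum>js | js \<in> ?S i \<and> ?ok i. ?p (?r i js))" if i: "i \<in> {0..length b}" for i
  proof (cases "?ok i")
    case True
    have "set (drop i b) \<subseteq> {..N}" using good_drop[OF assms, of i] by (simp add: good_def)
    then have "set (drop i b) \<subseteq> {Suc m..N}" using True by fastforce
    then have V: "dec_word N (Suc m) ?z (drop i b) = ?z ^ (length b - i)"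
      using True by (simp add: dec_word_def)
    have P: "?p (?r i js) = ?p js * ?z ^ (length b - i)" for js
    proof -
      have "?p (replicate p (Suc m)) = ?z ^ p" for p by (induction p) simp_all
      then show ?thesis by (simp only: map_append prod_list.append)
    qed
    have "z_sum m (take i b) * dec_word N (Suc m) ?z (drop i b) = (\<Sum>js\<in>?S i. ?p (?r i js))"
      by (simp only: V P z_sum_def sum_distrib_right)
    also have "?S i = {js. js \<in> ?S i \<and> ?ok i}" using True by blast
    finally show ?thesis .
  next
    case False
    then have "dec_word N (Suc m) ?z (drop i b) = 0" by (auto simp: dec_word_def)
    moreover have "{js. js \<in> ?S i \<and> ?ok i} = {}" using False by blast
    ultimately show ?thesis by (simp only: mult_zero_right sum.empty)
  qed
  have "wconv (z_sum m) (dec_word N (Suc m) ?z) b =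
      (\<Sum>i\<in>{0..length b}. \<Sum>js | js \<in> ?S i \<and> ?ok i. ?p (?r i js))"
    unfolding wconv_def by (rule sum.cong[OF refl V])
  also have "\<dots> = (\<Sum>(i, js)\<in>Sigma {0..length b} (\<lambda>i. {js. js \<in> ?S i \<and> ?ok i}). ?p (?r i js))"
  proof (rule sum.Sigma)
    have "finite {js. js \<in> ?S i \<and> ?ok i}" for i
      by (rule finite_subset[OF _ finite_z_admissible[of "take i b" m]]) blast
    then show "\<forall>i\<in>{0..length b}. finite {js. js \<in> ?S i \<and> ?ok i}" by blast
  qed simp
  also have "\<dots> = z_sum (Suc m) b"
    unfolding z_sum_def
  proof (rule sum.reindex_bij_witness[where i = "\<lambda>js. (length (?f js), ?f js)"
        and j = "\<lambda>(i, js). ?r i js"])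
    fix t assume "t \<in> Sigma {0..length b} (\<lambda>i. {js. js \<in> ?S i \<and> ?ok i})"
    then obtain i js where t: "t = (i, js)" "i \<le> length b" "z_admissible (take i b) js" "set js \<subseteq> {1..m}" "?ok i"
      by auto
    have l: "length js = i" using t(2,3) by (simp add: z_admissible_def)
    have f: "?f (?r i js) = js" using t(4) by (auto simp: filter_id_conv)
    show "(case case t of (i, js) \<Rightarrow> ?r i js of js \<Rightarrow> (length (?f js), ?f js)) = t"
      using f l by (simp add: t(1))
    show "(case t of (i, js) \<Rightarrow> ?r i js) \<in> {js. z_admissible b js \<and> set js \<subseteq> {1..Suc m}}"
      using t z_admissible_split[OF t(2) l t(4)] by (auto simp: set_replicate_conv_if)
    show "?p (case t of (i, js) \<Rightarrow> ?r i js) = (case t of (i, js) \<Rightarrow> ?p (?r i js))"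
      by (simp add: t(1))
  next
    fix js assume "js \<in> {js. z_admissible b js \<and> set js \<subseteq> {1..Suc m}}"
    then have js: "z_admissible b js" "set js \<subseteq> {1..Suc m}" by auto
    then have lb: "length js = length b" by (simp add: z_admissible_def)
    have eq: "js = ?r (length (?f js)) (?f js)"
      using sorted_asc_split[of js m] js lb by (simp add: z_admissible_def)
    then show "(case (length (?f js), ?f js) of (i, js) \<Rightarrow> ?r i js) = js" by simp
    have f: "set (?f js) \<subseteq> {1..m}" using js(2) by (auto simp: le_Suc_eq)
    have i: "length (?f js) \<le> length b" using lb by (metis length_filter_le)
    have "z_admissible b (?r (length (?f js)) (?f js))" using js(1) eq by simp
    then show "(length (?f js), ?f js) \<in> Sigma {0..length b} (\<lambda>i. {js. js \<in> ?S i \<and> ?ok i})"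
      using z_admissible_split[OF i refl f] f i by simp
  qed
  finally show ?thesis .
qed

lemma z_sum_0: "z_sum 0 b = (if b = [] then 1 else 0)"
proof -
  have "{js. z_admissible b js \<and> set js \<subseteq> {1..0}} = (if b = [] then {[]} else {})"
    by (auto simp: z_admissible_def)
  then show ?thesis by (simp add: z_sum_def)
qed

lemma rep_good_SS: "rep_good N (S_fps N z_var) (z_sum N)"
proof -
  have "rep_good N (prod_list (map (\<lambda>i. A_fps N i (z_var i)) [1..<Suc m])) (z_sum m)" for m
  proof (induction m)
    case 0
    then show ?case using rep_goodI[OF rep_1[of N]] by (simp add: z_sum_0[abs_def])
  next
    case (Suc m)
    have "rep_good N (prod_list (map (\<lambda>i. A_fps N i (z_var i)) [1..<Suc m]) * A_fps N (Suc m) (z_var (Suc m)))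
        (wconv (z_sum m) (dec_word N (Suc m) (Var (Z (Suc m)))))"
      unfolding z_var_def[of "Suc m"] by (intro rep_good_mult rep_goodI rep_A order_refl Suc)
    then have "rep_good N (prod_list (map (\<lambda>i. A_fps N i (z_var i)) [1..<Suc m]) * A_fps N (Suc m) (z_var (Suc m)))
        (z_sum (Suc m))"
      by (rule rep_good_cong) (rule z_sum_Suc)
    then show ?case by simp
  qed
  then show ?thesis by (simp add: S_fps_def)
qed

section \<open>From index sequences to monomials\<close>

definition seq_monomial :: "(nat \<Rightarrow> var) \<Rightarrow> nat list \<Rightarrow> monomial" where
  "seq_monomial f js = (\<Sum>j\<leftarrow>js. Poly_Mapping.single (f j) 1)"

lemma lookup_seq_monomial: "inj f \<Longrightarrow> Poly_Mapping.lookup (seq_monomial f js) (f i) = count_list js i"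
  by (induction js) (auto simp: seq_monomial_def lookup_add lookup_single when_def inj_eq)

lemma keys_seq_monomial: "Poly_Mapping.keys (seq_monomial f js) = f ` set js"
proof (induction js)
  case (Cons j js)
  have "seq_monomial f (j # js) = Poly_Mapping.single (f j) 1 + seq_monomial f js"
    by (simp add: seq_monomial_def)
  then have "Poly_Mapping.keys (seq_monomial f (j # js)) = insert (f j) (Poly_Mapping.keys (seq_monomial f js))"
    by (auto simp: in_keys_iff lookup_add lookup_single when_def split: if_splits)
  then show ?case using Cons by simp
qed (simp add: seq_monomial_def)

lemma monom_poly_seq_monomial: "monom_poly (seq_monomial f js) = prod_list (map (\<lambda>j. Var (f j)) js)"
  by (induction js) (simp_all add: seq_monomial_def monom_poly_0 monom_poly_add Var_def)

lemma seq_monomial_inject: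
  assumes "inj f" "seq_monomial f js = seq_monomial f js'"
  shows "mset js = mset js'"
proof (rule multiset_eqI)
  fix i
  show "count (mset js) i = count (mset js') i"
    using lookup_seq_monomial[OF assms(1), of js i] lookup_seq_monomial[OF assms(1), of js' i] assms(2)
    by (simp add: count_mset)
qed

lemma sorted_mset_unique:
  assumes "sorted_wrt (\<le>) xs" "sorted_wrt (\<le>) ys" "mset xs = mset ys"
  shows "xs = (ys :: nat list)"
  using assms by (metis properties_for_sort sorted_sort_id)

lemma inj_Var_constructors: "inj X" "inj Z"
  by (simp_all add: inj_def)

text \<open>The theorem sums over monomials, \<open>x_sum\<close> over sequences. A weakly
  decreasing sequence is recovered from the multiset of its values, so the two sums have matching
  terms.\<close>

lemma sum_A_x:
  "(\<Sum>\<alpha>\<in>{\<alpha> \<in> A_x a. \<forall>i>k. Poly_Mapping.lookup \<alpha> (X i) = 0}. 2 ^ num_vars \<alpha> * monom_poly \<alpha>) = x_sum k a"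
proof -
  let ?J = "{js. x_admissible a js \<and> set js \<subseteq> {1..k}}"
  have set: "{\<alpha> \<in> A_x a. \<forall>i>k. Poly_Mapping.lookup \<alpha> (X i) = 0} = seq_monomial X ` ?J"
  proof -
    have "(\<forall>i>k. Poly_Mapping.lookup (seq_monomial X js) (X i) = 0) \<longleftrightarrow> set js \<subseteq> {1..k}"
      if "x_admissible a js" for js
      using that by (auto simp: lookup_seq_monomial[OF inj_Var_constructors(1)] count_list_0_iff
          x_admissible_def subset_iff not_less[symmetric])
    then show ?thesis unfolding A_x_def seq_monomial_def[symmetric] by auto
  qed
  have inj: "inj_on (seq_monomial X) ?J"
  proof (rule inj_onI)
    fix js js' assume *: "js \<in> ?J" "js' \<in> ?J" "seq_monomial X js = seq_monomial X js'"
    have "mset (rev js) = mset (rev js')"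
      using seq_monomial_inject[OF inj_Var_constructors(1) *(3)] by simp
    moreover have "sorted_wrt (\<le>) (rev js)" "sorted_wrt (\<le>) (rev js')"
      using * by (simp_all add: sorted_wrt_rev x_admissible_def)
    ultimately have "rev js = rev js'" by (intro sorted_mset_unique)
    then show "js = js'" by simp
  qed
  have "num_vars (seq_monomial X js) = card (set js)" for js
    unfolding num_vars_def keys_seq_monomial
    by (rule card_image) (rule inj_on_subset[OF inj_Var_constructors(1)], simp)
  then show ?thesis
    unfolding set x_sum_def sum.reindex[OF inj] by (simp add: monom_poly_seq_monomial)
qed

lemma sum_A_z:
  assumes "set b \<subseteq> {..N}"
  shows "(\<Sum>\<beta>\<in>A_z b. monom_poly \<beta>) = z_sum N b"
proof -
  let ?J = "{js. z_admissible b js \<and> set js \<subseteq> {1..N}}"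
  \<comment> \<open>The bound by the letters keeps all values within 1..N, so restricting
    \<open>z_sum\<close> to them loses nothing.\<close>
  have "set js \<subseteq> {1..N}" if "z_admissible b js" for js
  proof
    fix j assume "j \<in> set js"
    then obtain t where t: "t < length js" "js ! t = j" by (auto simp: in_set_conv_nth)
    then have "j \<le> b ! t" "b ! t \<in> set b" using that by (auto simp: z_admissible_def)
    then show "j \<in> {1..N}" using assms that \<open>j \<in> set js\<close> by (auto simp: z_admissible_def)
  qed
  then have set: "A_z b = seq_monomial Z ` ?J"
    unfolding A_z_def seq_monomial_def[symmetric] by auto
  have inj: "inj_on (seq_monomial Z) ?J"
  proof (rule inj_onI)
    fix js js' assume *: "js \<in> ?J" "js' \<in> ?J" "seq_monomial Z js = seq_monomial Z js'"
    then show "js = js'"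
      using seq_monomial_inject[OF inj_Var_constructors(2) *(3)]
      by (intro sorted_mset_unique) (simp_all add: z_admissible_def)
  qed
  show ?thesis
    unfolding set z_sum_def sum.reindex[OF inj] by (simp add: monom_poly_seq_monomial)
qed

text \<open>Admissibility demands 1 <= j_i <= b_i, which excludes the letter 0. This places the
  right factor of a factorization in the symmetric group.\<close>

lemma z_sum_nonzero_Sym:
  assumes "z_sum N b \<noteq> 0" "set b \<subseteq> {..<n}"
  shows "word_prod b \<in> Sym n"
proof -
  obtain js where js: "z_admissible b js"
    using assms(1) unfolding z_sum_def by (metis (mono_tags, lifting) mem_Collect_eq sum.neutral empty_iff)
  have "1 \<le> j" if j: "j \<in> set b" for j
  proof -
    obtain t where t: "t < length b" "b ! t = j" using j by (auto simp: in_set_conv_nth)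
    then have "js ! t \<le> j" "js ! t \<in> set js" using js by (auto simp: z_admissible_def)
    then show ?thesis using js by (auto simp: z_admissible_def)
  qed
  then have "set b \<subseteq> {1..<n}" using assms(2) by auto
  then show ?thesis by (auto simp: Sym_def)
qed

section \<open>Length-additive factorizations\<close>

lemma R_nonempty: "w \<in> BC_inf \<Longrightarrow> R w \<noteq> {}"
  using ex_word_len2[of w] len_len2[of w] by (auto simp: R_def)

lemma Sym_BC: "Sym n \<subseteq> BC n"
proof
  fix w assume "w \<in> Sym n"
  then obtain a where "w = word_prod a" "set a \<subseteq> {1..<n}" by (auto simp: Sym_def)
  then show "w \<in> BC n" by (auto intro!: word_prod_BC)
qed

lemma sum_R_append:
  "(\<Sum>a\<in>R w. wconv f g a) = (\<Sum>(a, b)\<in>{(a, b). a @ b \<in> R w}. f a * g b)"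
proof -
  have "(\<Sum>a\<in>R w. wconv f g a) = (\<Sum>(a, i)\<in>Sigma (R w) (\<lambda>a. {0..length a}). f (take i a) * g (drop i a))"
    unfolding wconv_def by (rule sum.Sigma) (simp_all add: finite_R)
  also have "\<dots> = (\<Sum>(a, b)\<in>{(a, b). a @ b \<in> R w}. f a * g b)"
    by (rule sum.reindex_bij_witness[where i = "\<lambda>(a, b). (a @ b, length a)" and j = "\<lambda>(a, i). (take i a, drop i a)"])
       auto
  finally show ?thesis .
qed

lemma finite_R_append: "finite {(a, b). a @ b \<in> R w}"
proof (rule finite_subset)
  show "{(a, b). a @ b \<in> R w} \<subseteq> (\<lambda>(a, i). (take i a, drop i a)) ` Sigma (R w) (\<lambda>a. {0..length a})"
  proof clarify
    fix a b assume "a @ b \<in> R w"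
    then have "(a @ b, length a) \<in> Sigma (R w) (\<lambda>a. {0..length a})" by simp
    then show "(a, b) \<in> (\<lambda>(a, i). (take i a, drop i a)) ` Sigma (R w) (\<lambda>a. {0..length a})"
      by (rule rev_image_eqI) simp
  qed
qed (simp add: finite_R)

text \<open>Cutting a reduced word of \<open>w\<close> amounts to choosing a length-additive
  factorization and a reduced word of each factor. Cuts whose right part has its product outside
  \<open>Sym n\<close> contribute 0 through \<open>g\<close>.\<close>

lemma sum_factorizations:
  assumes w: "w \<in> BC n" and g: "\<And>b. set b \<subseteq> {..<n} \<Longrightarrow> g b \<noteq> 0 \<Longrightarrow> word_prod b \<in> Sym n"
  shows "(\<Sum>a\<in>R w. wconv f g a) =
    (\<Sum>(x, y)\<in>{(x, y). x \<in> BC n \<and> y \<in> Sym n \<and> x \<circ> y = w \<and> len x + len y = len w}.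
       \<Sum>a\<in>R x. \<Sum>b\<in>R y. f a * g b)"
proof -
  let ?F = "{(x, y). x \<in> BC n \<and> y \<in> Sym n \<and> x \<circ> y = w \<and> len x + len y = len w}"
  let ?T = "{(a, b). a @ b \<in> R w \<and> word_prod b \<in> Sym n}"
  have fin: "finite ?F"
  proof (rule finite_subset)
    show "?F \<subseteq> (\<lambda>(a, b). (word_prod a, word_prod b)) ` {(a, b). a @ b \<in> R w}"
    proof clarify
      fix x y assume xy: "x \<in> BC n" "y \<in> Sym n" "w = x \<circ> y" "len x + len y = len (x \<circ> y)"
      then obtain a b where ab: "a \<in> R x" "b \<in> R y"
        using R_nonempty[OF BC_inf_I[OF xy(1)]] R_nonempty[OF BC_inf_I] Sym_BC by blast
      then have "(a, b) \<in> {(a, b). a @ b \<in> R (x \<circ> y)}" using append_R_I xy by simp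
      then show "(x, y) \<in> (\<lambda>(a, b). (word_prod a, word_prod b)) ` {(a, b). a @ b \<in> R (x \<circ> y)}"
        by (rule rev_image_eqI) (use ab in \<open>simp add: R_def\<close>)
    qed
  qed (rule finite_imageI[OF finite_R_append])
  have "(\<Sum>a\<in>R w. wconv f g a) = (\<Sum>(a, b)\<in>?T. f a * g b)"
    unfolding sum_R_append
  proof (rule sum.mono_neutral_right[OF finite_R_append], blast, rule ballI)
    fix p assume "p \<in> {(a, b). a @ b \<in> R w} - ?T"
    then obtain a b where p: "p = (a, b)" "a @ b \<in> R w" "(a, b) \<notin> ?T" by blast
    then have "word_prod b \<notin> Sym n" by blast
    moreover have "set b \<subseteq> {..<n}" using R_letters[OF w p(2)] by simp
    ultimately have "g b = 0" using g by blast
    then show "(case p of (a, b) \<Rightarrow> f a * g b) = 0" by (simp add: p(1))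
  qed
  also have "\<dots> = (\<Sum>(p, a, b)\<in>Sigma ?F (\<lambda>p. R (fst p) \<times> R (snd p)). f a * g b)"
  proof (rule sum.reindex_bij_witness[where i = "\<lambda>(p, a, b). (a, b)"
        and j = "\<lambda>(a, b). ((word_prod a, word_prod b), a, b)"])
    fix t assume "t \<in> ?T"
    then obtain a b where t: "t = (a, b)" "a @ b \<in> R w" "word_prod b \<in> Sym n" by blast
    have "set a \<subseteq> {..<n}" using R_letters[OF w t(2)] by simp
    then have "word_prod a \<in> BC n" by (rule word_prod_BC)
    then show "(case t of (a, b) \<Rightarrow> ((word_prod a, word_prod b), a, b)) \<in> Sigma ?F (\<lambda>p. R (fst p) \<times> R (snd p))"
      using append_R[OF t(2)] t by (simp add: R_def word_prod_append)
  next
    fix t assume "t \<in> Sigma ?F (\<lambda>p. R (fst p) \<times> R (snd p))"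
    then obtain x y a b where t: "t = ((x, y), a, b)" "y \<in> Sym n" "x \<circ> y = w" "len x + len y = len w"
      "a \<in> R x" "b \<in> R y" by auto
    have ab: "word_prod a = x" "word_prod b = y" using t by (simp_all add: R_def)
    have "a @ b \<in> R w" using append_R_I[OF t(5,6)] t by simp
    then show "(case t of (p, a, b) \<Rightarrow> (a, b)) \<in> ?T" using t ab by simp
    show "(case case t of (p, a, b) \<Rightarrow> (a, b) of (a, b) \<Rightarrow> ((word_prod a, word_prod b), a, b)) = t"
      using t(1) ab by simp
  qed auto
  also have "\<dots> = (\<Sum>p\<in>?F. \<Sum>(a, b)\<in>R (fst p) \<times> R (snd p). f a * g b)"
    by (rule sum.Sigma[symmetric]) (simp_all add: fin finite_R)
  also have "\<dots> = (\<Sum>(x, y)\<in>?F. \<Sum>a\<in>R x. \<Sum>b\<in>R y. f a * g b)"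
    by (rule sum.cong[OF refl]) (auto simp: sum.cartesian_product)
  finally show ?thesis .
qed

lemma Const_two_power_diff:
  "Const (2 powi (int m - int n)) = Const (2 powi (- int n)) * 2 ^ m"
proof -
  have "2 powi (int m - int n) = (2 powi (- int n) * 2 ^ m :: rat)"
    by (simp add: power_int_diff power_int_minus field_simps)
  moreover have "Const 2 = 2" using Const_of_nat[of 2] by simp
  ultimately show ?thesis by (simp add: Const_mult Const_power)
qed

lemma admissible_sum_eq_truncate_schubert_B:
  assumes "1 \<le> n" "w \<in> BC n"
  shows "(\<Sum>(x, y)\<in>{(x, y). x \<in> BC n \<and> y \<in> Sym n \<and> x \<circ> y = w \<and> len x + len y = len w}.
      \<Sum>a\<in>R x. \<Sum>\<alpha>\<in>{\<alpha> \<in> A_x a. \<forall>i>k. Poly_Mapping.lookup \<alpha> (X i) = 0}.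
        \<Sum>b\<in>R y. \<Sum>\<beta>\<in>A_z b.
          Const (2 powi (int (num_vars \<alpha>) - int (neg w))) * monom_poly \<alpha> * monom_poly \<beta>) =
    truncate k (schubert_B w)" (is "?lhs = _")
proof -
  obtain N where n: "n = Suc N" using assms(1) by (cases n) auto
  let ?F = "{(x, y). x \<in> BC n \<and> y \<in> Sym n \<and> x \<circ> y = w \<and> len x + len y = len w}"
  let ?c = "Const (2 powi (- int (neg w)))"
  have w: "w \<in> BC (Suc N)" using assms(2) n by simp
  have rep: "rep N (prod_list (map (\<lambda>i. C_fps N (Var (X i))) (rev [1..<k + 1])) * S_fps N z_var)
      (subword_sum box_index C_weight (reading (Suc N) k))"
    unfolding prod_reading[symmetric]
    by (rule rep_subword_sum[OF distinct_reading]) (simp add: set_reading box_index_le)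
  \<comment> \<open>The expansion over boxes is folded back into a coefficient of the product, in
    rank \<open>N\<close>, so that it can be expanded again over admissible words.\<close>
  have "truncate k (schubert_C w) =
      coef (prod_list (map (\<lambda>i. C_fps N (Var (X i))) (rev [1..<k + 1])) * S_fps N z_var) w"
    using truncate_schubert_C_subsets[OF w, of k] coef_rep[OF rep w] by simp
  also have "\<dots> = (\<Sum>a\<in>R w. wconv (x_sum k) (z_sum N) a)"
    by (rule coef_rep_good[OF rep_good_mult[OF rep_good_C_prod rep_good_SS] w])
  also have "\<dots> = (\<Sum>(x, y)\<in>?F. \<Sum>a\<in>R x. \<Sum>b\<in>R y. x_sum k a * z_sum N b)"
    by (rule sum_factorizations[OF assms(2)]) (rule z_sum_nonzero_Sym)
  finally have trunc: "truncate k (schubert_C w) = (\<Sum>(x, y)\<in>?F. \<Sum>a\<in>R x. \<Sum>b\<in>R y. x_sum k a * z_sum N b)" .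
  \<comment> \<open>The constant splits into 2^(-s(w)), which is global, and 2 to the number of
    variables, which belongs to \<open>x_sum\<close>.\<close>
  have inner: "(\<Sum>\<alpha>\<in>{\<alpha> \<in> A_x a. \<forall>i>k. Poly_Mapping.lookup \<alpha> (X i) = 0}. \<Sum>b\<in>R y. \<Sum>\<beta>\<in>A_z b.
          Const (2 powi (int (num_vars \<alpha>) - int (neg w))) * monom_poly \<alpha> * monom_poly \<beta>) =
      (\<Sum>b\<in>R y. ?c * (x_sum k a * z_sum N b))" if "y \<in> Sym n" for a y
  proof -
    have y: "y \<in> BC (Suc N)" using that Sym_BC n by blast
    have z: "(\<Sum>\<beta>\<in>A_z b. q * monom_poly \<beta>) = q * z_sum N b" if "b \<in> R y" for b q
    proof -
      have "set b \<subseteq> {..N}" using R_letters[OF y that] by auto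
      then show ?thesis by (simp add: sum_A_z sum_distrib_left[symmetric])
    qed
    have "(\<Sum>\<alpha>\<in>{\<alpha> \<in> A_x a. \<forall>i>k. Poly_Mapping.lookup \<alpha> (X i) = 0}. \<Sum>b\<in>R y. \<Sum>\<beta>\<in>A_z b.
          Const (2 powi (int (num_vars \<alpha>) - int (neg w))) * monom_poly \<alpha> * monom_poly \<beta>) =
        (\<Sum>\<alpha>\<in>{\<alpha> \<in> A_x a. \<forall>i>k. Poly_Mapping.lookup \<alpha> (X i) = 0}. \<Sum>b\<in>R y.
          ?c * ((2 ^ num_vars \<alpha> * monom_poly \<alpha>) * z_sum N b))"
      by (intro sum.cong refl) (simp only: z, simp only: Const_two_power_diff mult.assoc)
    also have "\<dots> = (\<Sum>b\<in>R y. \<Sum>\<alpha>\<in>{\<alpha> \<in> A_x a. \<forall>i>k. Poly_Mapping.lookup \<alpha> (X i) = 0}.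
          ?c * ((2 ^ num_vars \<alpha> * monom_poly \<alpha>) * z_sum N b))"
      by (rule sum.swap)
    also have "\<dots> = (\<Sum>b\<in>R y. ?c * (x_sum k a * z_sum N b))"
      by (simp only: sum_distrib_left[symmetric] sum_distrib_right[symmetric] sum_A_x)
    finally show ?thesis .
  qed
  have "?lhs = (\<Sum>(x, y)\<in>?F. \<Sum>a\<in>R x. \<Sum>b\<in>R y. ?c * (x_sum k a * z_sum N b))"
  proof (rule sum.cong[OF refl])
    fix p assume "p \<in> ?F"
    then obtain x y where p: "p = (x, y)" "y \<in> Sym n" by blast
    show "(case p of (x, y) \<Rightarrow> \<Sum>a\<in>R x. \<Sum>\<alpha>\<in>{\<alpha> \<in> A_x a. \<forall>i>k. Poly_Mapping.lookup \<alpha> (X i) = 0}.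
          \<Sum>b\<in>R y. \<Sum>\<beta>\<in>A_z b.
            Const (2 powi (int (num_vars \<alpha>) - int (neg w))) * monom_poly \<alpha> * monom_poly \<beta>) =
        (case p of (x, y) \<Rightarrow> \<Sum>a\<in>R x. \<Sum>b\<in>R y. ?c * (x_sum k a * z_sum N b))"
      unfolding p(1) prod.case by (rule sum.cong[OF refl inner[OF p(2)]])
  qed
  also have "\<dots> = ?c * (\<Sum>(x, y)\<in>?F. \<Sum>a\<in>R x. \<Sum>b\<in>R y. x_sum k a * z_sum N b)"
    by (simp add: sum_distrib_left case_prod_beta)
  also have "\<dots> = truncate k (schubert_B w)"
    by (simp add: trunc[symmetric] schubert_B_def truncate_def subst_mult subst_Const)
  finally show ?thesis .
qed

theorem theorem3p7:
  fixes n k :: nat and w :: "int \<Rightarrow> int"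
  assumes "1 \<le> n" and "w \<in> BC n"
  shows "(\<Sum>D\<in>PD n k w. weight n k D) =
           (\<Sum>(u, v)\<in>{(u, v). u \<in> BC n \<and> v \<in> Sym n \<and> u \<circ> v = w \<and> len u + len v = len w}.
              \<Sum>a\<in>R u. \<Sum>\<alpha>\<in>{\<alpha> \<in> A_x a. \<forall>i>k. Poly_Mapping.lookup \<alpha> (X i) = 0}.
                \<Sum>b\<in>R v. \<Sum>\<beta>\<in>A_z b.
                  Const (2 powi (int (num_vars \<alpha>) - int (neg w))) * monom_poly \<alpha> * monom_poly \<beta>)
         \<and>
         (\<Sum>(u, v)\<in>{(u, v). u \<in> BC n \<and> v \<in> Sym n \<and> u \<circ> v = w \<and> len u + len v = len w}.
              \<Sum>a\<in>R u. \<Sum>\<alpha>\<in>{\<alpha> \<in> A_x a. \<forall>i>k. Poly_Mapping.lookup \<alpha> (X i) = 0}.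
                \<Sum>b\<in>R v. \<Sum>\<beta>\<in>A_z b.
                  Const (2 powi (int (num_vars \<alpha>) - int (neg w))) * monom_poly \<alpha> * monom_poly \<beta>)
         = truncate k (schubert_B w)"
  unfolding sum_PD_eq_truncate_schubert_B[OF assms]
    admissible_sum_eq_truncate_schubert_B[OF assms]
  by (rule conjI[OF refl refl])

end
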